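(* Consider a sequence of network separable models as in the context, indexed by the number of nodes $N\ge 3$, where $K$, $H$, $p$, $g$ and $\boldsymbol\theta^\star$ may depend on $N$, and let $\epsilon^\star>0$ be a constant independent of $N$ and $p$. Assume that for all $N$, $\mathbb E\|\bm Y\|_1\ge 1$ and $p\le N$. (a) (Maximum likelihood.) If $$\delta_N:=\sqrt{\frac{3\,p\log N}{\mathbb E\|\bm Y\|_1}}\;\frac{\sqrt{1+[D_g]^+}}{\xi_{\epsilon^\star}}\longrightarrow 0\quad(N\to\infty),$$ then there exists $N_0\ge 3$ such that for all $N\ge N_0$, with probability at least $1-3(\mathbb E\|\bm Y\|_1)^{-1}$, the set $\widehat\Theta$ of maximizers of $\boldsymbol\theta\mapsto\ell(\boldsymbol\theta;\bm X,\bm Y)$ over $\mathbb R^p$ is non-empty, its element $\widehat{\boldsymbol\theta}$ is unique, and $\|\widehat{\boldsymbol\theta}-\boldsymbol\theta^\star\|_2\le\delta_N$. (b) (Maximum pseudolikelihood.) If $$\widetilde\delta_N:=\sqrt{\frac{3\,p\,K^2\log N}{\mathbb E\|\bm Y\|_1}}\;\frac{\sqrt{1+[D_g]^+}}{\widetilde\xi_{\epsilon^\star}}\longrightarrow 0\quad(N\to\infty),$$ then there exists $N_0\ge3$ such that for all $N\ge N_0$, with probability at least $1-3(\mathbb E\|\bm Y\|_1)^{-1}$, the set $\widetilde\Theta$ of maximizers of $\boldsymbol\theta\mapsto\widetilde\ell(\boldsymbol\theta;\bm X,\bm Y)$ over $\mathbb R^p$ is non-empty and every $\widetilde{\boldsymbol\theta}\in\widetilde\Theta$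 satisfies $\|\widetilde{\boldsymbol\theta}-\boldsymbol\theta^\star\|_2\le\widetilde\delta_N$.
   Context: Fix integers $N\ge 3$, $K\ge1$, $H\in\{1,\dots,K\}$; let $\mathscr N=\{1,\dots,N\}$ and $\mathcal D=\{\{i,j\}: i,j\in\mathscr N,\ i\ne j\}$. A multilayer network is $\bm x=(x^{(k)}_{i,j})_{\{i,j\}\in\mathcal D,\,1\le k\le K}\in\mathbb X:=\{0,1\}^{K\binom N2}$ with dyad vectors $\bm x_{i,j}\in\{0,1\}^K$; $\bm x^{(-k)}_{i,j}$ denotes $\bm x_{i,j}$ with coordinate $k$ removed. A basis network is $\bm y\in\mathbb Y:=\{0,1\}^{\binom N2}$, $\|\bm y\|_1=\sum y_{i,j}$. Let $\mathcal L=\{L\subseteq\{1,\dots,K\}:1\le|L|\le H\}$, $p=|\mathcal L|$, $\boldsymbol\theta=(\theta_L)_{L\in\mathcal L}\in\mathbb R^p$. Sufficient statistics: $s_{L,i,j}(\bm x)=\prod_{k\in L}x^{(k)}_{i,j}$, $\bm s(\bm x)=\sum_{\{i,j\}}(s_{L,i,j}(\bm x))_{L}$. Define $f(\bm x,\boldsymbol\theta)=\exp(\langle\boldsymbol\theta,\bm s(\bm x)\rangle)$, $h(\bm x,\bm y)=\prod_{\{i,j\}}\mathbb 1(\|\bm x_{i,j}\|_1>0)^{y_{i,j}}\mathbb 1(\|\bm x_{i,j}\|_1=0)^{1-y_{i,j}}$, $\psi(\boldsymbol\theta,\bm y)=[\sum_{\bm x}f(\bm x,\boldsymbol\theta)h(\bm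 x,\bm y)]^{-1}$, and $g$ a strictly positive pmf on $\mathbb Y$ not depending on $\boldsymbol\theta$. The network separable model: $\mathbb P_{\boldsymbol\theta}(\bm X=\bm x,\bm Y=\bm y)=f(\bm x,\boldsymbol\theta)g(\bm y)h(\bm x,\bm y)\psi(\boldsymbol\theta,\bm y)$; pairs with $h=1$ are network concordant. $\boldsymbol\theta^\star$ is the data-generating parameter, $\mathbb P=\mathbb P_{\boldsymbol\theta^\star}$, $\mathbb E$ its expectation, $\mathbb C$ covariance. Log-likelihood: $\ell(\boldsymbol\theta;\bm x,\bm y)=\log\mathbb P_{\boldsymbol\theta}(\bm X=\bm x,\bm Y=\bm y)$. Log-pseudolikelihood (network concordant pairs): $\widetilde\ell(\boldsymbol\theta;\bm x,\bm y)=\sum_{\{i,j\}}\sum_{k=1}^K\log\mathbb P_{\boldsymbol\theta}(X^{(k)}_{i,j}=x^{(k)}_{i,j}\mid\bm X^{(-k)}_{i,j}=\bm x^{(-k)}_{i,j},\bm Y=\bm y)$. Single-dyad matrices: let $\mathcal Z=\{0,1\}^K\setminus\{\bm 0\}$, $\bm t(\bm z)=(\prod_{k\in L}z_k)_{L\in\mathcal L}$, and $Q_{\boldsymbol\theta}(\bm z)\propto\exp(\langle\boldsymbol\theta,\bm t(\bm z)\rangle)$ on $\mathcal Z$; $I(\boldsymbol\theta)=\mathrm{Cov}_{\bm Z\sim Q_{\boldsymbol\theta}}(\bm t(\bm Z))$ and $\widetilde I(\boldsymbol\theta)=\mathbb E_{\bm Z\sim Q_{\boldsymbol\theta^\star}}[-\nabla^2_{\boldsymbol\theta}\sum_{k=1}^K\log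 Q_{\boldsymbol\theta}(Z_k\mid\bm Z_{-k})]$. With $\mathscr B_2(\boldsymbol\theta^\star,\epsilon^\star)=\{\boldsymbol\theta:\|\boldsymbol\theta-\boldsymbol\theta^\star\|_2\le\epsilon^\star\}$, define $\xi_{\epsilon^\star}=\inf_{\boldsymbol\theta\in\mathscr B_2(\boldsymbol\theta^\star,\epsilon^\star)}\lambda_{\min}(I(\boldsymbol\theta))$ and $\widetilde\xi_{\epsilon^\star}=\inf_{\boldsymbol\theta\in\mathscr B_2(\boldsymbol\theta^\star,\epsilon^\star)}\lambda_{\min}(\widetilde I(\boldsymbol\theta))$. Define $D_g=\sum_{\{i,j\}\prec\{v,w\}}\mathbb C(Y_{i,j},Y_{v,w})$ (pairs of distinct dyads in lexicographic order) and $[D_g]^+=\max\{0,D_g\}$. *)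

theory Defs
  imports "HOL-Analysis.Analysis"
begin

definition dyads :: "nat \<Rightarrow> (nat \<times> nat) set" where
  "dyads N = {(i,j). 1 \<le> i \<and> i < j \<and> j \<le> N}"

definition dyad_prec :: "nat \<times> nat \<Rightarrow> nat \<times> nat \<Rightarrow> bool" where
  "dyad_prec d e \<longleftrightarrow> fst d < fst e \<or> (fst d = fst e \<and> snd d < snd e)"

definition Lfam :: "nat \<Rightarrow> nat \<Rightarrow> nat set set" where
  "Lfam K H = {L. L \<subseteq> {1..K} \<and> 1 \<le> card L \<and> card L \<le> H}"

definition pdim :: "nat \<Rightarrow> nat \<Rightarrow> nat" where
  "pdim K H = card (Lfam K H)"

(* parameter space R^p: functions on \<L>, zero outside \<L> *)
definition Theta :: "nat \<Rightarrow> nat \<Rightarrow> (nat set \<Rightarrow> real) set" where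
  "Theta K H = {\<theta>. \<forall>L. L \<notin> Lfam K H \<longrightarrow> \<theta> L = 0}"

definition norm2 :: "nat \<Rightarrow> nat \<Rightarrow> (nat set \<Rightarrow> real) \<Rightarrow> real" where
  "norm2 K H v = sqrt (\<Sum>L\<in>Lfam K H. (v L)\<^sup>2)"

(* multilayer networks x, x d k = x^(k)_d, and basis networks y *)
definition XX :: "nat \<Rightarrow> nat \<Rightarrow> (nat \<times> nat \<Rightarrow> nat \<Rightarrow> bool) set" where
  "XX N K = {x. \<forall>d k. x d k \<longrightarrow> d \<in> dyads N \<and> k \<in> {1..K}}"

definition YY :: "nat \<Rightarrow> (nat \<times> nat \<Rightarrow> bool) set" where
  "YY N = {y. \<forall>d. y d \<longrightarrow> d \<in> dyads N}"

definition ind :: "bool \<Rightarrow> real" where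
  "ind b = (if b then 1 else 0)"

definition suff :: "nat \<Rightarrow> (nat \<times> nat \<Rightarrow> nat \<Rightarrow> bool) \<Rightarrow> nat set \<Rightarrow> real" where
  "suff N x L = (\<Sum>d\<in>dyads N. ind (\<forall>k\<in>L. x d k))"

definition fmod :: "nat \<Rightarrow> nat \<Rightarrow> nat \<Rightarrow> (nat \<times> nat \<Rightarrow> nat \<Rightarrow> bool) \<Rightarrow> (nat set \<Rightarrow> real) \<Rightarrow> real" where
  "fmod N K H x \<theta> = exp (\<Sum>L\<in>Lfam K H. \<theta> L * suff N x L)"

definition hmod :: "nat \<Rightarrow> nat \<Rightarrow> (nat \<times> nat \<Rightarrow> nat \<Rightarrow> bool) \<Rightarrow> (nat \<times> nat \<Rightarrow> bool) \<Rightarrow> real" where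
  "hmod N K x y = (\<Prod>d\<in>dyads N. ind ((\<exists>k\<in>{1..K}. x d k) = y d))"

definition psi :: "nat \<Rightarrow> nat \<Rightarrow> nat \<Rightarrow> (nat set \<Rightarrow> real) \<Rightarrow> (nat \<times> nat \<Rightarrow> bool) \<Rightarrow> real" where
  "psi N K H \<theta> y = 1 / (\<Sum>x\<in>XX N K. fmod N K H x \<theta> * hmod N K x y)"

definition Pr :: "nat \<Rightarrow> nat \<Rightarrow> nat \<Rightarrow> ((nat \<times> nat \<Rightarrow> bool) \<Rightarrow> real) \<Rightarrow> (nat set \<Rightarrow> real)
    \<Rightarrow> (nat \<times> nat \<Rightarrow> nat \<Rightarrow> bool) \<Rightarrow> (nat \<times> nat \<Rightarrow> bool) \<Rightarrow> real" where
  "Pr N K H g \<theta> x y = fmod N K H x \<theta> * g y * hmod N K x y * psi N K H \<theta> y"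

definition loglik where
  "loglik N K H g \<theta> x y = ln (Pr N K H g \<theta> x y)"

definition condP where
  "condP N K H g \<theta> x y d k =
     (\<Sum>x'\<in>XX N K. ind (x' d = x d) * Pr N K H g \<theta> x' y) /
     (\<Sum>x'\<in>XX N K. ind (\<forall>j. j \<noteq> k \<longrightarrow> x' d j = x d j) * Pr N K H g \<theta> x' y)"

definition pseudolik where
  "pseudolik N K H g \<theta> x y = (\<Sum>d\<in>dyads N. \<Sum>k\<in>{1..K}. ln (condP N K H g \<theta> x y d k))"

definition argmax_Theta :: "nat \<Rightarrow> nat \<Rightarrow> ((nat set \<Rightarrow> real) \<Rightarrow> real) \<Rightarrow> (nat set \<Rightarrow> real) set" where
  "argmax_Theta K H F = {\<theta>\<in>Theta K H. \<forall>\<theta>'\<in>Theta K H. F \<theta>' \<le> F \<theta>}"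

definition prob_ev where
  "prob_ev N K H g \<theta> E = (\<Sum>(x,y)\<in>XX N K \<times> YY N. ind (E x y) * Pr N K H g \<theta> x y)"

definition expec where
  "expec N K H g \<theta> F = (\<Sum>(x,y)\<in>XX N K \<times> YY N. F x y * Pr N K H g \<theta> x y)"

definition EY1 where
  "EY1 N K H g \<theta> = expec N K H g \<theta> (\<lambda>x y. real (card {d\<in>dyads N. y d}))"

definition covY where
  "covY N K H g \<theta> d e = expec N K H g \<theta> (\<lambda>x y. ind (y d) * ind (y e))
      - expec N K H g \<theta> (\<lambda>x y. ind (y d)) * expec N K H g \<theta> (\<lambda>x y. ind (y e))"

definition Dg where
  "Dg N K H g \<theta> = (\<Sum>(d,e)\<in>{(d,e). d \<in> dyads N \<and> e \<in> dyads N \<and> dyad_prec d e}. covY N K H g \<theta> d e)"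

definition Zset :: "nat \<Rightarrow> (nat \<Rightarrow> bool) set" where
  "Zset K = {z. (\<forall>k. z k \<longrightarrow> k \<in> {1..K}) \<and> (\<exists>k\<in>{1..K}. z k)}"

definition tvec :: "(nat \<Rightarrow> bool) \<Rightarrow> nat set \<Rightarrow> real" where
  "tvec z L = ind (\<forall>k\<in>L. z k)"

definition Qd :: "nat \<Rightarrow> nat \<Rightarrow> (nat set \<Rightarrow> real) \<Rightarrow> (nat \<Rightarrow> bool) \<Rightarrow> real" where
  "Qd K H \<theta> z = ind (z \<in> Zset K) * exp (\<Sum>L\<in>Lfam K H. \<theta> L * tvec z L) /
      (\<Sum>z'\<in>Zset K. exp (\<Sum>L\<in>Lfam K H. \<theta> L * tvec z' L))"

definition Imat :: "nat \<Rightarrow> nat \<Rightarrow> (nat set \<Rightarrow> real) \<Rightarrow> nat set \<Rightarrow> nat set \<Rightarrow> real" where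
  "Imat K H \<theta> L L' = (\<Sum>z\<in>Zset K. Qd K H \<theta> z * tvec z L * tvec z L')
      - (\<Sum>z\<in>Zset K. Qd K H \<theta> z * tvec z L) * (\<Sum>z\<in>Zset K. Qd K H \<theta> z * tvec z L')"

definition Qcond where
  "Qcond K H \<theta> z k = Qd K H \<theta> z /
      (\<Sum>z'\<in>Zset K. ind (\<forall>j. j \<noteq> k \<longrightarrow> z' j = z j) * Qd K H \<theta> z')"

definition partial2 :: "((nat set \<Rightarrow> real) \<Rightarrow> real) \<Rightarrow> (nat set \<Rightarrow> real) \<Rightarrow> nat set \<Rightarrow> nat set \<Rightarrow> real" where
  "partial2 F \<theta> L L' = deriv (\<lambda>s. deriv (\<lambda>t. F (\<lambda>M. \<theta> M + t * ind (M = L) + s * ind (M = L'))) 0) 0"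

definition Itil :: "nat \<Rightarrow> nat \<Rightarrow> (nat set \<Rightarrow> real) \<Rightarrow> (nat set \<Rightarrow> real) \<Rightarrow> nat set \<Rightarrow> nat set \<Rightarrow> real" where
  "Itil K H \<theta>s \<theta> L L' = (\<Sum>z\<in>Zset K. Qd K H \<theta>s z *
      - partial2 (\<lambda>\<eta>. \<Sum>k\<in>{1..K}. ln (Qcond K H \<eta> z k)) \<theta> L L')"

definition eigvals :: "nat set set \<Rightarrow> (nat set \<Rightarrow> nat set \<Rightarrow> real) \<Rightarrow> real set" where
  "eigvals I M = {mu. \<exists>v. (\<forall>L. L \<notin> I \<longrightarrow> v L = 0) \<and> (\<exists>L\<in>I. v L \<noteq> 0) \<and>
       (\<forall>L\<in>I. (\<Sum>L'\<in>I. M L L' * v L') = mu * v L)}"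

definition lambda_min :: "nat set set \<Rightarrow> (nat set \<Rightarrow> nat set \<Rightarrow> real) \<Rightarrow> real" where
  "lambda_min I M = Min (eigvals I M)"

definition ball2 where
  "ball2 K H \<theta>s \<epsilon> = {\<theta>\<in>Theta K H. norm2 K H (\<lambda>L. \<theta> L - \<theta>s L) \<le> \<epsilon>}"

definition xi where
  "xi K H \<theta>s \<epsilon> = (INF \<theta>\<in>ball2 K H \<theta>s \<epsilon>. lambda_min (Lfam K H) (Imat K H \<theta>))"

definition xitil where
  "xitil K H \<theta>s \<epsilon> = (INF \<theta>\<in>ball2 K H \<theta>s \<epsilon>. lambda_min (Lfam K H) (Itil K H \<theta>s \<theta>))"

end

theory Submission
  imports Defs "HOL-Probability.Hoeffding"
begin

text \<open>
  Conditionally on the basis network, the active dyads form an independent sample of random size \<open>n\<close> from the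
  single-dyad model and all other dyads vanish, so both objectives are sums of \<open>n\<close> convex losses.
  It suffices to show that on the sphere of radius \<open>\<delta>\<close> around the true parameter the total loss exceeds its value
  at the slightly smaller radius \<open>(1 - s) * \<delta>\<close>: by convexity all minimizers then lie in the ball, and comparing
  two nearby radii (rather than sphere and centre) loses only a factor close to 1.
  The loss difference is a linear term plus a nonnegative remainder whose expectation is at least
  \<open>s * (1 - s) * \<xi> * \<delta>\<^sup>2\<close>. The linear term is the score, controlled coordinatewise by Hoeffding's
  inequality. For the likelihood the remainder is deterministic. For the pseudolikelihood it is random, and its uniform
  lower deviations are controlled in two steps: symmetrization and contraction (the remainder is a sum over layers of
  1-Lipschitz functions of linear forms) bound the expected deviation by \<open>2 * K * \<delta> * sqrt (n * p)\<close>, which is smaller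
  than the drift by a factor \<open>sqrt (ln N)\<close>; and infima of sums of nonnegative functions have sub-Gaussian lower tails
  whose variance proxy is proportional to the drift.
  Finally \<open>n\<close> is averaged out with Chebyshev's inequality, where \<open>Dg\<close> enters through the variance of \<open>n\<close>.
\<close>

section \<open>Expectations over independent samples\<close>

text \<open>The comparison of nearby radii is forced by the prescribed constants. Put
  \<open>\<tau> = sqrt (3 * ln N * (1 + D) / m)\<close> with \<open>m\<close> the value of
  \<open>EY1\<close>. The radius satisfies \<open>\<xi> * \<delta> = c * sqrt p * \<tau>\<close>,
  where \<open>c\<close> is 1 for the likelihood and \<open>K\<close> for the pseudolikelihood.
  Sphere against centre would give only half of the drift, so the Hoeffding exponent would be n
  \<tau>^2 / 2, about (3/2) ln N when n = m and D = 0. After the union bound over p \<le> N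
  coordinates this leaves about N^(-1/2), while the allowed failure 3/m can be of order N^(-2). With
  \<open>s = 1/20\<close> each score coordinate may be as large as (9/10) c n \<tau>, the exponent
  becomes (81/50) n \<tau>^2, and at n = (4/5) m it is at least 3.888 ln N, which beats p * m \<le>
  N^3. The gap between 9/10 and 1 - s = 19/20 pays for the random remainder of the pseudolikelihood.
  The constant 3 in the failure probability is tight too: Chebyshev's inequality at (2/5) m alone
  costs 25/9.\<close>

text \<open>A pmf on a finite set \<open>Z\<close> is a weight function \<open>q\<close>; \<open>EL Z q n F\<close> is the expectation of \<open>F\<close>
  over a list of \<open>n\<close> independent draws.\<close>

fun EL :: "'z set \<Rightarrow> ('z \<Rightarrow> real) \<Rightarrow> nat \<Rightarrow> ('z list \<Rightarrow> real) \<Rightarrow> real" where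
  "EL Z q 0 F = F []"
| "EL Z q (Suc n) F = (\<Sum>z\<in>Z. q z * EL Z q n (\<lambda>zs. F (z # zs)))"

definition lists_n :: "'z set \<Rightarrow> nat \<Rightarrow> 'z list set" where
  "lists_n Z n = {zs. set zs \<subseteq> Z \<and> length zs = n}"

lemma lists_n_Cons: "z \<in> Z \<Longrightarrow> zs \<in> lists_n Z n \<Longrightarrow> z # zs \<in> lists_n Z (Suc n)"
  by (auto simp: lists_n_def)

lemma finite_lists_n: "finite Z \<Longrightarrow> finite (lists_n Z n)"
  unfolding lists_n_def by (rule finite_lists_length_eq)

lemma ind_mono: "(P \<Longrightarrow> Q) \<Longrightarrow> ind P \<le> ind Q"
  by (simp add: ind_def)

locale fin_pmf =
  fixes Z :: "'z set" and q :: "'z \<Rightarrow> real"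
  assumes finZ: "finite Z" and q_nonneg: "\<And>z. z \<in> Z \<Longrightarrow> 0 \<le> q z" and q_sum: "(\<Sum>z\<in>Z. q z) = 1"
begin

abbreviation EZ :: "('z \<Rightarrow> real) \<Rightarrow> real" where "EZ f \<equiv> (\<Sum>z\<in>Z. q z * f z)"

lemma EZ_const [simp]: "EZ (\<lambda>z. c) = c"
  by (simp add: q_sum sum_distrib_right[symmetric])

lemma EZ_mono: "(\<And>z. z \<in> Z \<Longrightarrow> f z \<le> h z) \<Longrightarrow> EZ f \<le> EZ h"
  by (intro sum_mono mult_left_mono q_nonneg)

lemma Z_nonempty: "Z \<noteq> {}"
  using q_sum by auto

lemma EL_mono:
  assumes "\<And>zs. zs \<in> lists_n Z n \<Longrightarrow> F zs \<le> G zs"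
  shows "EL Z q n F \<le> EL Z q n G"
  using assms
proof (induction n arbitrary: F G)
  case 0
  then show ?case by (simp add: lists_n_def)
next
  case (Suc n)
  have "EL Z q n (\<lambda>zs. F (z # zs)) \<le> EL Z q n (\<lambda>zs. G (z # zs))" if "z \<in> Z" for z
    by (rule Suc.IH, rule Suc.prems, rule lists_n_Cons[OF that])
  then show ?case unfolding EL.simps by (rule EZ_mono)
qed

lemma EL_cong:
  assumes "\<And>zs. zs \<in> lists_n Z n \<Longrightarrow> F zs = G zs"
  shows "EL Z q n F = EL Z q n G"
  by (rule antisym; rule EL_mono; simp add: assms)

lemma EL_add: "EL Z q n (\<lambda>zs. F zs + G zs) = EL Z q n F + EL Z q n G"
  by (induction n arbitrary: F G) (simp_all add: distrib_left sum.distrib)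

lemma EL_cmult: "EL Z q n (\<lambda>zs. c * F zs) = c * EL Z q n F"
  by (induction n arbitrary: F) (simp_all add: sum_distrib_left mult_ac)

lemma EL_diff: "EL Z q n (\<lambda>zs. F zs - G zs) = EL Z q n F - EL Z q n G"
  using EL_add[of n F "\<lambda>zs. (-1) * G zs"] by (simp only: EL_cmult) simp

lemma EL_const [simp]: "EL Z q n (\<lambda>zs. c) = c"
  by (induction n) (simp_all only: EL.simps EZ_const)

lemma EL_sum: "finite S \<Longrightarrow> EL Z q n (\<lambda>zs. \<Sum>i\<in>S. F i zs) = (\<Sum>i\<in>S. EL Z q n (F i))"
  by (induction S rule: finite_induct) (simp_all add: EL_add)

lemma EL_EZ: "EL Z q n (\<lambda>zs. EZ (\<lambda>z. F z zs)) = EZ (\<lambda>z. EL Z q n (F z))"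
  by (simp add: EL_sum finZ EL_cmult)

lemma EL_exp_sum_list: "EL Z q n (\<lambda>zs. exp (\<Sum>z\<leftarrow>zs. f z)) = (EZ (\<lambda>z. exp (f z))) ^ n"
  by (induction n) (simp_all add: exp_add EL_cmult sum_distrib_right sum_distrib_left mult_ac)

lemma EL_Markov_exp:
  assumes "\<And>zs. zs \<in> lists_n Z n \<Longrightarrow> P zs \<Longrightarrow> u \<le> F zs"
  shows "EL Z q n (\<lambda>zs. ind (P zs)) \<le> exp (- u) * EL Z q n (\<lambda>zs. exp (F zs))"
  unfolding EL_cmult[symmetric]
  by (rule EL_mono) (use assms in \<open>auto simp: ind_def simp flip: exp_add\<close>)

lemma EL_union_bound:
  assumes "finite S" "\<And>zs. zs \<in> lists_n Z n \<Longrightarrow> P zs \<Longrightarrow> \<exists>i\<in>S. Q i zs"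
  shows "EL Z q n (\<lambda>zs. ind (P zs)) \<le> (\<Sum>i\<in>S. EL Z q n (\<lambda>zs. ind (Q i zs)))"
proof -
  have "EL Z q n (\<lambda>zs. ind (P zs)) \<le> EL Z q n (\<lambda>zs. \<Sum>i\<in>S. ind (Q i zs))"
  proof (rule EL_mono)
    fix zs assume zs: "zs \<in> lists_n Z n"
    show "ind (P zs) \<le> (\<Sum>i\<in>S. ind (Q i zs))"
    proof (cases "P zs")
      case True
      then obtain i where i: "i \<in> S" "Q i zs" using assms(2) zs by blast
      have "ind (Q i zs) \<le> (\<Sum>i\<in>S. ind (Q i zs))"
        by (rule member_le_sum) (use i assms(1) in \<open>auto simp: ind_def\<close>)
      with i show ?thesis by (simp add: ind_def split: if_splits)
    qed (auto simp: ind_def intro!: sum_nonneg)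
  qed
  then show ?thesis by (simp add: EL_sum assms(1))
qed

text \<open>The assumption is the moment bound of a centred variable of range \<open>c\<close>, not
  the range itself. The pseudolikelihood score has range up to twice the \<open>c\<close> for which
  the moment bound holds, and a range hypothesis would lose a factor 4 in the exponent.\<close>

lemma EL_Hoeffding:
  assumes mgf: "\<And>l. EZ (\<lambda>z. exp (l * f z)) \<le> exp (l\<^sup>2 * c\<^sup>2 / 8)"
    and u: "0 \<le> u" and c: "0 < c" and n: "0 < n"
  shows "EL Z q n (\<lambda>zs. ind (u \<le> \<bar>\<Sum>z\<leftarrow>zs. f z\<bar>)) \<le> 2 * exp (- 2 * u\<^sup>2 / (n * c\<^sup>2))"
proof -
  \<comment> \<open>Minimizer of the Chernoff exponent
    \<open>- l * u + n * l^2 * c^2 / 8\<close>.\<close>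
  define l where "l = 4 * u / (n * c\<^sup>2)"
  have one: "EL Z q n (\<lambda>zs. ind (u \<le> s * (\<Sum>z\<leftarrow>zs. f z))) \<le> exp (- 2 * u\<^sup>2 / (n * c\<^sup>2))"
    if s: "s\<^sup>2 = 1" for s :: real
  proof -
    have l: "0 \<le> l" using u c by (simp add: l_def)
    have "EL Z q n (\<lambda>zs. ind (u \<le> s * (\<Sum>z\<leftarrow>zs. f z)))
        \<le> exp (- (l * u)) * EL Z q n (\<lambda>zs. exp (\<Sum>z\<leftarrow>zs. l * s * f z))"
      by (rule EL_Markov_exp)
        (use l in \<open>simp add: sum_list_const_mult mult.assoc mult_left_mono\<close>)
    also have "\<dots> = exp (- (l * u)) * (EZ (\<lambda>z. exp (l * s * f z))) ^ n"
      by (simp only: EL_exp_sum_list)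
    also have "\<dots> \<le> exp (- (l * u)) * (exp ((l * s)\<^sup>2 * c\<^sup>2 / 8)) ^ n"
      by (intro mult_left_mono power_mono mgf sum_nonneg mult_nonneg_nonneg q_nonneg) auto
    also have "\<dots> = exp (- (l * u) + n * (l\<^sup>2 * c\<^sup>2 / 8))"
      unfolding exp_add by (simp add: exp_of_nat_mult[symmetric] power_mult_distrib s)
    also have "- (l * u) + n * (l\<^sup>2 * c\<^sup>2 / 8) = - 2 * u\<^sup>2 / (n * c\<^sup>2)"
      using c n by (simp add: l_def field_simps power2_eq_square)
    finally show ?thesis .
  qed
  have "EL Z q n (\<lambda>zs. ind (u \<le> \<bar>\<Sum>z\<leftarrow>zs. f z\<bar>))
      \<le> (\<Sum>s\<in>{1, -1::real}. EL Z q n (\<lambda>zs. ind (u \<le> s * (\<Sum>z\<leftarrow>zs. f z))))"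
    by (rule EL_union_bound) (auto simp: abs_if split: if_splits)
  also have "\<dots> \<le> (\<Sum>s\<in>{1, -1::real}. exp (- 2 * u\<^sup>2 / (n * c\<^sup>2)))"
    by (rule sum_mono, rule one) auto
  finally show ?thesis by simp
qed

end

text \<open>Hoeffding's lemma for a centred Bernoulli variable. \<open>Hoeffdings_lemma_aux\<close>
  treats nonnegative \<open>l\<close>; exchanging the two outcomes, \<open>m\<close> with
  \<open>1 - m\<close> and \<open>l\<close> with \<open>- l\<close>, gives the rest.\<close>

lemma Bernoulli_mgf:
  fixes m l :: real
  assumes "0 \<le> m" "m \<le> 1"
  shows "m * exp (l * (1 - m)) + (1 - m) * exp (l * (- m)) \<le> exp (l\<^sup>2 / 8)"
proof -
  have pos: "m * exp (l * (1 - m)) + (1 - m) * exp (l * (- m)) \<le> exp (l\<^sup>2 / 8)"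
    if m: "0 \<le> m" "m \<le> 1" and l: "0 \<le> l" for m l :: real
  proof -
    have p: "0 < 1 + m * (exp l - 1)"
      using m l by (intro add_pos_nonneg mult_nonneg_nonneg) auto
    have "m * exp (l * (1 - m)) + (1 - m) * exp (l * (- m)) = exp (- l * m) * (1 + m * (exp l - 1))"
      by (simp add: right_diff_distrib exp_diff exp_minus field_simps)
    also have "\<dots> = exp (- l * m + ln (1 + m * (exp l - 1)))"
      using p by (simp add: exp_add exp_diff exp_minus field_simps)
    also have "\<dots> \<le> exp (l\<^sup>2 / 8)"
      using Hoeffdings_lemma_aux[OF l m(1)] by simp
    finally show ?thesis .
  qed
  show ?thesis
  proof (cases "0 \<le> l")
    case True
    then show ?thesis by (rule pos[OF assms])
  next
    case False
    then show ?thesis using pos[of "1 - m" "- l"] assms by (simp add: algebra_simps)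
  qed
qed

text \<open>Unnormalized version with success probability \<open>a / (a + b)\<close>, meant for the
  weights of two configurations that differ in a single layer.\<close>

lemma Bernoulli_mgf_weights:
  fixes a b l :: real
  assumes "0 \<le> a" "0 \<le> b" "0 < a + b"
  shows "a * exp (l * (b / (a + b))) + b * exp (l * (- a / (a + b))) \<le> (a + b) * exp (l\<^sup>2 / 8)"
proof -
  have eq: "1 - a / (a + b) = b / (a + b)" using assms by (simp add: field_simps)
  have "a / (a + b) * exp (l * (b / (a + b))) + b / (a + b) * exp (l * (- (a / (a + b)))) \<le> exp (l\<^sup>2 / 8)"
    using Bernoulli_mgf[of "a / (a + b)" l] assms unfolding eq by simp
  then have "(a + b) * (a / (a + b) * exp (l * (b / (a + b))) + b / (a + b) * exp (l * (- (a / (a + b)))))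
      \<le> (a + b) * exp (l\<^sup>2 / 8)"
    using assms by (intro mult_left_mono) auto
  then show ?thesis using assms by (simp add: distrib_left)
qed

section \<open>Uniform lower tails\<close>

text \<open>Vectors are functions of which only the coordinates in \<open>I\<close> count, so this
  is an inner product only after restriction to functions vanishing off \<open>I\<close>.\<close>

definition ip :: "'i set \<Rightarrow> ('i \<Rightarrow> real) \<Rightarrow> ('i \<Rightarrow> real) \<Rightarrow> real" where
  "ip I u v = (\<Sum>i\<in>I. u i * v i)"

definition nrm :: "'i set \<Rightarrow> ('i \<Rightarrow> real) \<Rightarrow> real" where
  "nrm I u = sqrt (ip I u u)"

lemma ip_nonneg: "0 \<le> ip I u u"
  by (simp add: ip_def sum_nonneg)

lemma nrm_nonneg: "0 \<le> nrm I u"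
  by (simp add: nrm_def ip_nonneg)

lemma nrm_sq: "(nrm I u)\<^sup>2 = ip I u u"
  by (simp add: nrm_def ip_nonneg)

lemma ip_add_right: "ip I u (\<lambda>i. v i + c * w i) = ip I u v + c * ip I u w"
  by (simp add: ip_def distrib_left sum.distrib sum_distrib_left mult_ac)

lemma nrm_scale: "nrm I (\<lambda>i. c * u i) = \<bar>c\<bar> * nrm I u"
proof -
  have "ip I (\<lambda>i. c * u i) (\<lambda>i. c * u i) = c\<^sup>2 * ip I u u"
    by (simp add: ip_def sum_distrib_left mult_ac power2_eq_square)
  then show ?thesis by (simp add: nrm_def real_sqrt_mult)
qed

lemma Cauchy_Schwarz_ip: "\<bar>ip I u v\<bar> \<le> nrm I u * nrm I v"
proof -
  have "\<bar>ip I u v\<bar> \<le> (\<Sum>i\<in>I. \<bar>u i * v i\<bar>)"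
    unfolding ip_def by (rule sum_abs)
  also have "\<dots> \<le> L2_set u I * L2_set v I"
    by (simp add: abs_mult L2_set_mult_ineq)
  finally show ?thesis by (simp add: L2_set_def nrm_def ip_def power2_eq_square)
qed

text \<open>One random sign of the contraction principle. Take maximizers \<open>s\<close> and
  \<open>t\<close> of the two left maxima; their \<open>r\<close>-contributions add up to
  \<open>r s - r t\<close>, at most \<open>\<bar>a s - a t\<bar>\<close>. According to the sign of
  \<open>a s - a t\<close>, insert \<open>s\<close> in the plus maximum and \<open>t\<close> in the
  minus maximum, or the other way round.\<close>

lemma Max_contraction:
  fixes F r a :: "'t \<Rightarrow> real"
  assumes "finite T" "T \<noteq> {}"
    and lip: "\<And>s t. s \<in> T \<Longrightarrow> t \<in> T \<Longrightarrow> \<bar>r s - r t\<bar> \<le> \<bar>a s - a t\<bar>"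
  shows "Max ((\<lambda>t. F t + r t) ` T) + Max ((\<lambda>t. F t - r t) ` T)
      \<le> Max ((\<lambda>t. F t + a t) ` T) + Max ((\<lambda>t. F t - a t) ` T)"
proof -
  have "Max ((\<lambda>t. F t + r t) ` T) \<in> (\<lambda>t. F t + r t) ` T"
    "Max ((\<lambda>t. F t - r t) ` T) \<in> (\<lambda>t. F t - r t) ` T"
    using assms by (auto intro!: Max_in)
  then obtain s t where s: "s \<in> T" "Max ((\<lambda>t. F t + r t) ` T) = F s + r s"
    and t: "t \<in> T" "Max ((\<lambda>t. F t - r t) ` T) = F t - r t"
    by auto
  have up: "F x + a x \<le> Max ((\<lambda>t. F t + a t) ` T)" "F x - a x \<le> Max ((\<lambda>t. F t - a t) ` T)"
    if "x \<in> T" for x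
    using assms that by (auto intro!: Max_ge)
  show ?thesis
    unfolding s t using lip[OF s(1) t(1)] up[OF s(1)] up[OF t(1)] by linarith
qed

lemma sqrt_avg_le:
  assumes "0 \<le> x" "0 \<le> y"
  shows "(sqrt x + sqrt y) / 2 \<le> sqrt ((x + y) / 2)"
proof (rule real_le_rsqrt)
  have "0 \<le> (sqrt x - sqrt y)\<^sup>2" by simp
  then show "((sqrt x + sqrt y) / 2)\<^sup>2 \<le> (x + y) / 2"
    using assms by (simp add: power2_eq_square field_simps)
qed

context fin_pmf
begin

text \<open>Jensen's inequality introduces an independent copy, and convexity of the maximum splits it off;
  this gives random signs, to which the contraction principle applies.\<close>
lemma symmetrization_step:
  fixes F :: "'t \<Rightarrow> real"
  assumes T: "finite T" "T \<noteq> {}" and Ks: "finite Ks" "Ks \<noteq> {}"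
    and R: "\<And>t z. t \<in> T \<Longrightarrow> z \<in> Z \<Longrightarrow> R t z = (\<Sum>k\<in>Ks. r k t z)"
    and lip: "\<And>k s t z. k \<in> Ks \<Longrightarrow> s \<in> T \<Longrightarrow> t \<in> T \<Longrightarrow> z \<in> Z \<Longrightarrow> \<bar>r k s z - r k t z\<bar> \<le> \<bar>a k s z - a k t z\<bar>"
  defines "c \<equiv> real (card Ks)"
  shows "EZ (\<lambda>z. Max ((\<lambda>t. F t + (EZ (R t) - R t z)) ` T))
    \<le> EZ (\<lambda>z. \<Sum>k\<in>Ks. 1 / c * ((Max ((\<lambda>t. F t + 2 * c * a k t z) ` T)
          + Max ((\<lambda>t. F t - 2 * c * a k t z) ` T)) / 2))"
proof -
  have c: "0 < c" using Ks by (simp add: c_def card_gt_0_iff)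
  let ?M = "\<lambda>G. Max (G ` T)"
  have MaxI: "?M G \<le> b" if "\<And>t. t \<in> T \<Longrightarrow> G t \<le> b" for G :: "'t \<Rightarrow> real" and b
    using T that by simp
  have MaxG: "G t \<le> ?M G" if "t \<in> T" for G :: "'t \<Rightarrow> real" and t
    using T that by simp
  have "EZ (\<lambda>z. ?M (\<lambda>t. F t + (EZ (R t) - R t z)))
      \<le> EZ (\<lambda>z. EZ (\<lambda>z'. ?M (\<lambda>t. F t + (R t z' - R t z))))"
  proof (rule EZ_mono, rule MaxI)
    fix z t assume "t \<in> T"
    have "F t + (EZ (R t) - R t z) = EZ (\<lambda>z'. F t + (R t z' - R t z))"
      by (simp only: distrib_left right_diff_distrib sum.distrib sum_subtractf EZ_const)
    also have "\<dots> \<le> EZ (\<lambda>z'. ?M (\<lambda>t. F t + (R t z' - R t z)))"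
    proof (rule EZ_mono)
      fix z'
      show "F t + (R t z' - R t z) \<le> ?M (\<lambda>t. F t + (R t z' - R t z))"
        by (rule MaxG[OF \<open>t \<in> T\<close>])
    qed
    finally show "F t + (EZ (R t) - R t z) \<le> \<dots>" .
  qed
  \<comment> \<open>\<open>F + (R z' - R z)\<close> is the average of \<open>F + 2 R z'\<close> and
    \<open>F - 2 R z\<close>; this is the source of the factor 2.\<close>
  also have "\<dots> \<le> EZ (\<lambda>z. EZ (\<lambda>z'. ?M (\<lambda>t. F t + 2 * R t z') / 2 + ?M (\<lambda>t. F t - 2 * R t z) / 2))"
  proof (rule EZ_mono, rule EZ_mono, rule MaxI)
    fix z z' t assume "t \<in> T"
    then show "F t + (R t z' - R t z) \<le> ?M (\<lambda>t. F t + 2 * R t z') / 2 + ?M (\<lambda>t. F t - 2 * R t z) / 2"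
      using MaxG[of t "\<lambda>t. F t + 2 * R t z'"] MaxG[of t "\<lambda>t. F t - 2 * R t z"] by simp
  qed
  also have "\<dots> = EZ (\<lambda>z. ?M (\<lambda>t. F t + 2 * R t z) / 2 + ?M (\<lambda>t. F t - 2 * R t z) / 2)"
    by (simp only: distrib_left sum.distrib EZ_const)
  also have "\<dots> \<le> EZ (\<lambda>z. \<Sum>k\<in>Ks. 1 / c * ((?M (\<lambda>t. F t + 2 * c * a k t z)
          + ?M (\<lambda>t. F t - 2 * c * a k t z)) / 2))"
  proof (rule EZ_mono)
    fix z assume z: "z \<in> Z"
    \<comment> \<open>The layers are separated by convexity as well: \<open>F + s * R\<close> is the
      average over \<open>k\<close> of \<open>F + s * c * r k\<close>. Contraction then meets one
      linear form at a time, at the price of the factor \<open>c\<close>.\<close>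
    have split: "?M (\<lambda>t. F t + s * R t z) \<le> (\<Sum>k\<in>Ks. 1 / c * ?M (\<lambda>t. F t + s * c * r k t z))" for s
    proof (rule MaxI)
      fix t assume t: "t \<in> T"
      have "F t + s * R t z = (\<Sum>k\<in>Ks. 1 / c * (F t + s * c * r k t z))"
        using c by (simp add: R[OF t z] distrib_left sum.distrib sum_distrib_left[symmetric] c_def)
      also have "\<dots> \<le> (\<Sum>k\<in>Ks. 1 / c * ?M (\<lambda>t. F t + s * c * r k t z))"
      proof (intro sum_mono mult_left_mono)
        fix k
        show "F t + s * c * r k t z \<le> ?M (\<lambda>t. F t + s * c * r k t z)" by (rule MaxG[OF t])
      qed (use c in simp)
      finally show "F t + s * R t z \<le> \<dots>" .
    qed
    have "?M (\<lambda>t. F t + 2 * R t z) / 2 + ?M (\<lambda>t. F t - 2 * R t z) / 2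
        \<le> (\<Sum>k\<in>Ks. 1 / c * ((?M (\<lambda>t. F t + 2 * c * r k t z) + ?M (\<lambda>t. F t - 2 * c * r k t z)) / 2))"
      using split[of 2] split[of "-2"]
      by (simp add: distrib_left add_divide_distrib sum.distrib sum_divide_distrib[symmetric])
    also have "\<dots> \<le> (\<Sum>k\<in>Ks. 1 / c * ((?M (\<lambda>t. F t + 2 * c * a k t z) + ?M (\<lambda>t. F t - 2 * c * a k t z)) / 2))"
    proof (intro sum_mono mult_left_mono divide_right_mono Max_contraction[OF T])
      fix k s t assume "k \<in> Ks" "s \<in> T" "t \<in> T"
      then have "2 * c * \<bar>r k s z - r k t z\<bar> \<le> 2 * c * \<bar>a k s z - a k t z\<bar>"
        using c lip z by simp
      then show "\<bar>2 * c * r k s z - 2 * c * r k t z\<bar> \<le> \<bar>2 * c * a k s z - 2 * c * a k t z\<bar>"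
        using c by (simp add: abs_mult flip: right_diff_distrib)
    qed (use c in auto)
    finally show "?M (\<lambda>t. F t + 2 * R t z) / 2 + ?M (\<lambda>t. F t - 2 * R t z) / 2 \<le> \<dots>" .
  qed
  finally show ?thesis .
qed

text \<open>No vector of random signs is introduced: each observation is symmetrized and contracted
  in turn, and its signed linear form is absorbed into the accumulated vector \<open>u\<close>. The
  generalization over \<open>u\<close> is what carries the induction. At the end Cauchy-Schwarz
  bounds the maximum by \<open>\<delta> * nrm I u\<close>.\<close>

lemma EL_Max_deviation:
  fixes T :: "('i \<Rightarrow> real) set" and w :: "'k \<Rightarrow> 'z \<Rightarrow> 'i \<Rightarrow> real"
  assumes T: "finite T" "T \<noteq> {}" and Ks: "finite Ks" "Ks \<noteq> {}"
    and norm: "\<And>t. t \<in> T \<Longrightarrow> nrm I t \<le> \<delta>" and \<delta>: "0 \<le> \<delta>"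
    and W: "\<And>k z. k \<in> Ks \<Longrightarrow> z \<in> Z \<Longrightarrow> ip I (w k z) (w k z) \<le> W"
    and R: "\<And>t z. t \<in> T \<Longrightarrow> z \<in> Z \<Longrightarrow> R t z = (\<Sum>k\<in>Ks. r k z (ip I t (w k z)))"
    and lip: "\<And>k z a b. k \<in> Ks \<Longrightarrow> z \<in> Z \<Longrightarrow> \<bar>r k z a - r k z b\<bar> \<le> \<bar>a - b\<bar>"
  defines "c \<equiv> real (card Ks)"
  shows "EL Z q n (\<lambda>zs. Max ((\<lambda>t. ip I t u + (\<Sum>z\<leftarrow>zs. EZ (R t) - R t z)) ` T))
    \<le> \<delta> * sqrt (ip I u u + n * (4 * c\<^sup>2 * W))"
proof (induction n arbitrary: u)
  case 0
  have "ip I t u \<le> \<delta> * nrm I u" if "t \<in> T" for t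
    using Cauchy_Schwarz_ip[of I t u] norm[OF that] nrm_nonneg[of I u] mult_right_mono[of "nrm I t" \<delta> "nrm I u"]
    by linarith
  then show ?case using T by (simp add: nrm_def)
next
  case (Suc n)
  have c: "0 < c" using Ks by (simp add: c_def card_gt_0_iff)
  obtain k0 where "k0 \<in> Ks" using Ks by auto
  moreover obtain z0 where "z0 \<in> Z" using Z_nonempty by auto
  ultimately have W0: "0 \<le> W" using W[of k0 z0] ip_nonneg[of I "w k0 z0"] by linarith
  have half: "EL Z q n (\<lambda>zs. G zs / 2) = EL Z q n G / 2" for G
    using EL_cmult[of n "1 / 2" G] by simp
  let ?S = "\<lambda>t zs. \<Sum>z\<leftarrow>zs. EZ (R t) - R t z"
  let ?C = "4 * c\<^sup>2 * W"
  have "EL Z q (Suc n) (\<lambda>zs. Max ((\<lambda>t. ip I t u + ?S t zs) ` T))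
      = EL Z q n (\<lambda>zs. EZ (\<lambda>z. Max ((\<lambda>t. (ip I t u + ?S t zs) + (EZ (R t) - R t z)) ` T)))"
    unfolding EL_EZ by (simp add: algebra_simps)
  also have "\<dots> \<le> EL Z q n (\<lambda>zs. EZ (\<lambda>z. \<Sum>k\<in>Ks. 1 / c *
      ((Max ((\<lambda>t. ip I t u + ?S t zs + 2 * c * ip I t (w k z)) ` T)
        + Max ((\<lambda>t. ip I t u + ?S t zs - 2 * c * ip I t (w k z)) ` T)) / 2)))"
    unfolding c_def
  proof (rule EL_mono)
    fix zs
    show "EZ (\<lambda>z. Max ((\<lambda>t. (ip I t u + ?S t zs) + (EZ (R t) - R t z)) ` T))
      \<le> EZ (\<lambda>z. \<Sum>k\<in>Ks. 1 / real (card Ks) *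
      ((Max ((\<lambda>t. ip I t u + ?S t zs + 2 * real (card Ks) * ip I t (w k z)) ` T)
        + Max ((\<lambda>t. ip I t u + ?S t zs - 2 * real (card Ks) * ip I t (w k z)) ` T)) / 2))"
      by (rule symmetrization_step[where r = "\<lambda>k t z. r k z (ip I t (w k z))", OF T Ks R lip])
  qed
  also have "\<dots> = EZ (\<lambda>z. \<Sum>k\<in>Ks. 1 / c *
      ((EL Z q n (\<lambda>zs. Max ((\<lambda>t. ip I t u + ?S t zs + 2 * c * ip I t (w k z)) ` T))
        + EL Z q n (\<lambda>zs. Max ((\<lambda>t. ip I t u + ?S t zs - 2 * c * ip I t (w k z)) ` T))) / 2))"
    unfolding EL_EZ by (simp only: EL_sum[OF Ks(1)] EL_cmult half EL_add)
  also have "\<dots> \<le> EZ (\<lambda>z. \<Sum>k\<in>Ks. 1 / c * (\<delta> * sqrt (ip I u u + real (Suc n) * ?C)))"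
  proof (intro EZ_mono sum_mono mult_left_mono)
    fix z k assume z: "z \<in> Z" and k: "k \<in> Ks"
    define x where "x s = ip I (\<lambda>i. u i + s * (2 * c) * w k z i) (\<lambda>i. u i + s * (2 * c) * w k z i) + n * ?C" for s
    have x: "0 \<le> x s" for s using W0 by (simp add: x_def ip_nonneg)
    have one: "EL Z q n (\<lambda>zs. Max ((\<lambda>t. ip I t u + ?S t zs + s * (2 * c) * ip I t (w k z)) ` T)) \<le> \<delta> * sqrt (x s)" for s
      using Suc.IH[of "\<lambda>i. u i + s * (2 * c) * w k z i"] unfolding ip_add_right x_def
      by (simp add: add_ac)
    \<comment> \<open>Averaging over the two signs cancels the cross terms, so the squared norm
      grows by at most \<open>4 * c^2 * W\<close> per observation.\<close>
    have "(x 1 + x (-1)) / 2 = ip I u u + 4 * c\<^sup>2 * ip I (w k z) (w k z) + n * ?C"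
      by (simp add: x_def ip_def sum.distrib[symmetric] sum_distrib_left power2_eq_square algebra_simps
          flip: sum_divide_distrib)
    also have "\<dots> \<le> ip I u u + real (Suc n) * ?C"
      using mult_left_mono[OF W[OF k z], of "4 * c\<^sup>2"] by (simp add: algebra_simps)
    finally have x2: "(x 1 + x (-1)) / 2 \<le> ip I u u + real (Suc n) * ?C" .
    have "(EL Z q n (\<lambda>zs. Max ((\<lambda>t. ip I t u + ?S t zs + 2 * c * ip I t (w k z)) ` T))
        + EL Z q n (\<lambda>zs. Max ((\<lambda>t. ip I t u + ?S t zs - 2 * c * ip I t (w k z)) ` T))) / 2
        \<le> \<delta> * ((sqrt (x 1) + sqrt (x (-1))) / 2)"
      using one[of 1] one[of "-1"] by (simp add: distrib_left)
    also have "\<dots> \<le> \<delta> * sqrt ((x 1 + x (-1)) / 2)"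
      by (intro mult_left_mono \<delta> sqrt_avg_le x)
    also have "\<dots> \<le> \<delta> * sqrt (ip I u u + real (Suc n) * ?C)"
      by (intro mult_left_mono \<delta> real_sqrt_le_mono x2)
    finally show "(EL Z q n (\<lambda>zs. Max ((\<lambda>t. ip I t u + ?S t zs + 2 * c * ip I t (w k z)) ` T))
        + EL Z q n (\<lambda>zs. Max ((\<lambda>t. ip I t u + ?S t zs - 2 * c * ip I t (w k z)) ` T))) / 2 \<le> \<dots>" .
  qed (use c in auto)
  also have "\<dots> = \<delta> * sqrt (ip I u u + real (Suc n) * ?C)"
    unfolding EZ_const using c by (simp add: c_def)
  finally show ?case .
qed

text \<open>Adding one observation raises the minimum by at most the increment at the previous minimizer,
  which is independent of that observation.\<close>
lemma EL_exp_Min: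
  fixes F :: "'t \<Rightarrow> real"
  assumes T: "finite T" "T \<noteq> {}"
    and S: "\<And>t z. t \<in> T \<Longrightarrow> z \<in> Z \<Longrightarrow> 0 \<le> S t z" "\<And>t z. t \<in> T \<Longrightarrow> z \<in> Z \<Longrightarrow> S t z \<le> U"
    and mean: "\<And>t. t \<in> T \<Longrightarrow> EZ (S t) \<le> r0" and l: "0 \<le> l"
  shows "EL Z q n (\<lambda>zs. exp (- l * Min ((\<lambda>t. F t + (\<Sum>z\<leftarrow>zs. S t z)) ` T)))
    \<le> exp (- l * EL Z q n (\<lambda>zs. Min ((\<lambda>t. F t + (\<Sum>z\<leftarrow>zs. S t z)) ` T)) + l\<^sup>2 * n * U * r0 / 2)"
proof (induction n arbitrary: F)
  case (Suc n)
  let ?m = "\<lambda>F zs. Min ((\<lambda>t. F t + (\<Sum>z\<leftarrow>zs. S t z)) ` T)"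
  define g where "g z = EL Z q n (?m (\<lambda>t. F t + S t z))" for z
  define g0 where "g0 = EL Z q n (?m F)"
  define w where "w z = g z - g0" for z
  have U: "0 \<le> U" using S T Z_nonempty by (meson ex_in_conv order_trans)
  have Minle: "?m G zs \<le> G t + (\<Sum>z\<leftarrow>zs. S t z)" if "t \<in> T" for G zs t
    using T that by (intro Min_le) auto
  have "\<exists>t\<in>T. ?m F zs = F t + (\<Sum>z\<leftarrow>zs. S t z)" for zs
    proof -
    have "?m F zs \<in> (\<lambda>t. F t + (\<Sum>z\<leftarrow>zs. S t z)) ` T"
      by (rule Min_in) (use T in auto)
    then show ?thesis by blast
  qed
  then obtain \<tau> where \<tau>: "\<And>zs. \<tau> zs \<in> T" "\<And>zs. ?m F zs = F (\<tau> zs) + (\<Sum>z\<leftarrow>zs. S (\<tau> zs) z)"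
    by metis
  have w0: "0 \<le> w z" if z: "z \<in> Z" for z
  proof -
    have "?m F zs \<le> ?m (\<lambda>t. F t + S t z) zs" for zs
    proof -
      have "?m F zs \<le> F t + S t z + (\<Sum>z\<leftarrow>zs. S t z)" if "t \<in> T" for t
        using Minle[OF that, of F zs] S(1)[OF that z] by simp
      then show ?thesis using T by simp
    qed
    then have "g0 \<le> g z" unfolding g0_def g_def by (intro EL_mono) auto
    then show ?thesis by (simp add: w_def)
  qed
  have w1: "w z \<le> EL Z q n (\<lambda>zs. S (\<tau> zs) z)" for z
  proof -
    have "g z \<le> EL Z q n (\<lambda>zs. ?m F zs + S (\<tau> zs) z)"
      unfolding g_def
    proof (rule EL_mono)
      fix zs
      show "?m (\<lambda>t. F t + S t z) zs \<le> ?m F zs + S (\<tau> zs) z"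
        using Minle[OF \<tau>(1)[of zs], of "\<lambda>t. F t + S t z" zs] unfolding \<tau>(2) by linarith
    qed
    then show ?thesis by (simp add: w_def g0_def EL_add)
  qed
  have wU: "w z \<le> U" if "z \<in> Z" for z
    using w1[of z] EL_mono[of n "\<lambda>zs. S (\<tau> zs) z" "\<lambda>_. U"] S(2) \<tau>(1) that by force
  have "EZ w \<le> EZ (\<lambda>z. EL Z q n (\<lambda>zs. S (\<tau> zs) z))"
    by (rule EZ_mono) (rule w1)
  also have "\<dots> \<le> EL Z q n (\<lambda>zs. r0)"
    unfolding EL_EZ[symmetric] by (rule EL_mono) (rule mean[OF \<tau>(1)])
  finally have Ew: "EZ w \<le> r0" by simp
  have exp_le: "exp (- x) \<le> 1 - x + x\<^sup>2 / 2" if "0 \<le> x" for x :: real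
  proof -
    define h where "h x = 1 - x + x\<^sup>2 / 2 - exp (- x)" for x :: real
    have "h 0 \<le> h x"
    proof (rule DERIV_nonneg_imp_nondecreasing[OF that])
      fix y :: real
      have "(h has_real_derivative - 1 + y + exp (- y)) (at y)"
        unfolding h_def by (auto intro!: derivative_eq_intros)
      moreover have "0 \<le> - 1 + y + exp (- y)" using exp_ge_add_one_self[of "- y"] by simp
      ultimately show "\<exists>d. (h has_real_derivative d) (at y) \<and> 0 \<le> d" by blast
    qed
    then show ?thesis by (simp add: h_def)
  qed
  \<comment> \<open>As \<open>0 \<le> w \<le> U\<close>, the square of \<open>w\<close> is at most
    \<open>U * w\<close>. Hence the second-order term is controlled by the mean \<open>r0\<close>
    and not by \<open>U^2\<close>.\<close>
  have "EZ (\<lambda>z. exp (- l * w z)) \<le> EZ (\<lambda>z. 1 - l * w z + l\<^sup>2 * U / 2 * w z)"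
  proof (rule EZ_mono)
    fix z assume z: "z \<in> Z"
    have "exp (- l * w z) \<le> 1 - l * w z + (l * w z)\<^sup>2 / 2"
      using exp_le[of "l * w z"] l w0[OF z] by simp
    also have "(l * w z)\<^sup>2 / 2 = l\<^sup>2 / 2 * (w z * w z)"
      by (simp add: power2_eq_square)
    also have "\<dots> \<le> l\<^sup>2 / 2 * (U * w z)"
      by (intro mult_left_mono mult_right_mono wU w0 z) auto
    finally show "exp (- l * w z) \<le> 1 - l * w z + l\<^sup>2 * U / 2 * w z" by (simp add: mult_ac)
  qed
  also have "\<dots> = 1 - l * EZ w + l\<^sup>2 * U / 2 * EZ w"
    by (simp add: distrib_left right_diff_distrib sum.distrib sum_subtractf q_sum sum_distrib_left mult_ac)
  also have "\<dots> \<le> 1 + (- l * EZ w + l\<^sup>2 * U * r0 / 2)"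
    using mult_left_mono[OF Ew, of "l\<^sup>2 * U / 2"] U by simp
  also have "\<dots> \<le> exp (- l * EZ w + l\<^sup>2 * U * r0 / 2)"
    by (rule exp_ge_add_one_self)
  finally have mgf: "EZ (\<lambda>z. exp (- l * w z)) \<le> exp (- l * EZ w + l\<^sup>2 * U * r0 / 2)" .
  have step: "EL Z q (Suc n) (\<lambda>zs. G (?m F zs)) = EZ (\<lambda>z. EL Z q n (\<lambda>zs. G (?m (\<lambda>t. F t + S t z) zs)))"
    for G :: "real \<Rightarrow> real"
    by (simp add: add.assoc)
  have "EL Z q (Suc n) (\<lambda>zs. exp (- l * ?m F zs))
      \<le> EZ (\<lambda>z. exp (- l * g z + l\<^sup>2 * n * U * r0 / 2))"
    unfolding step[of "\<lambda>x. exp (- l * x)"] g_def by (rule EZ_mono) (rule Suc.IH)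
  also have "\<dots> = EZ (\<lambda>z. exp (- l * g0 + l\<^sup>2 * n * U * r0 / 2) * exp (- l * w z))"
    by (simp add: w_def algebra_simps flip: exp_add)
  also have "\<dots> = exp (- l * g0 + l\<^sup>2 * n * U * r0 / 2) * EZ (\<lambda>z. exp (- l * w z))"
    unfolding sum_distrib_left by (intro sum.cong refl) (simp only: mult.left_commute)
  also have "\<dots> \<le> exp (- l * g0 + l\<^sup>2 * n * U * r0 / 2) * exp (- l * EZ w + l\<^sup>2 * U * r0 / 2)"
    by (intro mult_left_mono mgf) simp
  also have "\<dots> = exp (- l * (g0 + EZ w) + l\<^sup>2 * real (Suc n) * U * r0 / 2)"
    by (simp add: algebra_simps add_divide_distrib flip: exp_add)
  also have "g0 + EZ w = EZ g"
    by (simp add: w_def right_diff_distrib sum_subtractf sum_distrib_right[symmetric] q_sum)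
  also have "EZ g = EL Z q (Suc n) (?m F)"
    unfolding g_def by (rule step[of "\<lambda>x. x", symmetric])
  finally show ?case .
qed simp

text \<open>The minimum over \<open>T\<close> of the rescaled sums has expectation at least
  \<open>n * \<rho>\<close> minus the bound of \<open>EL_Max_deviation\<close>;
  \<open>EL_exp_Min\<close> then controls how far it falls below that expectation.\<close>

theorem uniform_lower_tail:
  fixes T :: "('i \<Rightarrow> real) set" and w :: "'k \<Rightarrow> 'z \<Rightarrow> 'i \<Rightarrow> real"
  assumes T: "finite T" and Ks: "finite Ks" "Ks \<noteq> {}"
    and norm: "\<And>t. t \<in> T \<Longrightarrow> nrm I t \<le> \<delta>" and \<delta>: "0 \<le> \<delta>"
    and W: "\<And>k z. k \<in> Ks \<Longrightarrow> z \<in> Z \<Longrightarrow> ip I (w k z) (w k z) \<le> W"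
    and R: "\<And>t z. R t z = (\<Sum>k\<in>Ks. r k z (ip I t (w k z)))"
    and r0: "\<And>k z. r k z 0 = 0"
    and lip: "\<And>k z a b. k \<in> Ks \<Longrightarrow> z \<in> Z \<Longrightarrow> \<bar>r k z a - r k z b\<bar> \<le> \<bar>a - b\<bar>"
    and pos: "\<And>t z. t \<in> T \<Longrightarrow> z \<in> Z \<Longrightarrow> 0 \<le> R t z"
    and bdd: "\<And>t z. t \<in> T \<Longrightarrow> z \<in> Z \<Longrightarrow> R t z \<le> U"
    and mean: "\<And>t. t \<in> T \<Longrightarrow> \<rho> \<le> EZ (R t)" and \<rho>: "0 < \<rho>" and x: "0 \<le> x" and n: "0 < n" and U: "0 < U"
  shows "EL Z q n (\<lambda>zs. ind (\<exists>t\<in>T. (\<Sum>z\<leftarrow>zs. R t z) < n * \<rho> - \<delta> * sqrt (n * (4 * (real (card Ks))\<^sup>2 * W)) - x))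
    \<le> exp (- x\<^sup>2 / (2 * n * U * \<rho>))"
proof (cases "T = {}")
  case True
  then show ?thesis by (simp add: ind_def)
next
  case False
  \<comment> \<open>The rescaling lowers every summand and brings all means to exactly
    \<open>\<rho>\<close>, so that \<open>EL_exp_Min\<close> applies with \<open>r0 = \<rho>\<close>
    instead of the largest mean over \<open>T\<close>.\<close>
  define S where "S t z = \<rho> / EZ (R t) * R t z" for t z
  have ER: "0 < EZ (R t)" if "t \<in> T" for t using mean[OF that] \<rho> by linarith
  have le1: "\<rho> / EZ (R t) \<le> 1" "0 \<le> \<rho> / EZ (R t)" if "t \<in> T" for t
    using mean[OF that] ER[OF that] \<rho> by auto
  have S0: "0 \<le> S t z" if "t \<in> T" "z \<in> Z" for t z
    unfolding S_def by (rule mult_nonneg_nonneg[OF le1(2)[OF that(1)] pos[OF that]])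
  have SR: "S t z \<le> R t z" if "t \<in> T" "z \<in> Z" for t z
    using mult_right_mono[OF le1(1)[OF that(1)] pos[OF that]] by (simp add: S_def)
  have SE: "EZ (S t) = \<rho>" if "t \<in> T" for t
  proof -
    have "EZ (S t) = \<rho> / EZ (R t) * EZ (R t)"
      unfolding S_def sum_distrib_left by (rule sum.cong) simp_all
    then show ?thesis using ER[OF that] by simp
  qed
  define m where "m zs = Min ((\<lambda>t. 0 + (\<Sum>z\<leftarrow>zs. S t z)) ` T)" for zs
  define B where "B = \<delta> * sqrt (n * (4 * (real (card Ks))\<^sup>2 * W))"
  have shrink: "k * g \<le> max 0 g" if "0 \<le> k" "k \<le> 1" for k g :: real
    using that mult_right_mono[of k 1 g] mult_nonneg_nonpos[of k g] by (cases "0 \<le> g") auto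
  \<comment> \<open>Rescaling by a factor in [0,1] can raise a negative deviation up to 0. The zero
    parameter, where the process vanishes, keeps 0 among the candidates of the maximum.\<close>
  let ?T = "insert (\<lambda>_. 0) T"
  have R0: "R (\<lambda>_. 0) = (\<lambda>_. 0)" by (simp add: fun_eq_iff R ip_def r0)
  have "n * \<rho> - EL Z q n m = EL Z q n (\<lambda>zs. n * \<rho> - m zs)"
    by (simp add: EL_diff)
  also have "\<dots> \<le> EL Z q n (\<lambda>zs. Max ((\<lambda>t. ip I t (\<lambda>_. 0) + (\<Sum>z\<leftarrow>zs. EZ (R t) - R t z)) ` ?T))"
  proof (rule EL_mono)
    fix zs assume zs: "zs \<in> lists_n Z n"
    let ?G = "\<lambda>t. ip I t (\<lambda>_. 0) + (\<Sum>z\<leftarrow>zs. EZ (R t) - R t z)"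
    have G: "?G t = n * EZ (R t) - (\<Sum>z\<leftarrow>zs. R t z)" for t
      using zs by (simp add: ip_def sum_list_subtractf sum_list_triv lists_n_def)
    have "m zs \<in> (\<lambda>t. 0 + (\<Sum>z\<leftarrow>zs. S t z)) ` T"
      unfolding m_def using T False by (intro Min_in) auto
    then obtain t where t: "t \<in> T" "m zs = (\<Sum>z\<leftarrow>zs. S t z)" by auto
    have "m zs = \<rho> / EZ (R t) * (\<Sum>z\<leftarrow>zs. R t z)"
      unfolding t S_def by (rule sum_list_const_mult)
    then have eq: "n * \<rho> - m zs = \<rho> / EZ (R t) * ?G t"
      unfolding G using ER[OF t(1)] by (simp add: field_simps)
    have "\<rho> / EZ (R t) * ?G t \<le> max 0 (?G t)"
      by (rule shrink[OF le1(2,1)[OF t(1)]])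
    also have "\<dots> \<le> Max (?G ` ?T)"
    proof -
      have G0: "?G (\<lambda>_. 0) = 0" unfolding G by (simp add: R0)
      have fT: "finite (?G ` ?T)" using T by simp
      have "?G (\<lambda>_. 0) \<le> Max (?G ` ?T)" by (rule Max_ge[OF fT imageI[OF insertI1]])
      moreover have "?G t \<le> Max (?G ` ?T)" by (rule Max_ge[OF fT imageI[OF insertI2[OF t(1)]]])
      ultimately show ?thesis unfolding G0 by (rule max.boundedI)
    qed
    finally show "n * \<rho> - m zs \<le> Max (?G ` ?T)" unfolding eq .
  qed
  also have "\<dots> \<le> \<delta> * sqrt (ip I (\<lambda>_. 0) (\<lambda>_. 0) + n * (4 * (real (card Ks))\<^sup>2 * W))"
    by (rule EL_Max_deviation[where r = r and w = w])
      (use T Ks norm \<delta> W lip in \<open>auto simp: R nrm_def ip_def\<close>)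
  finally have Em: "n * \<rho> - B \<le> EL Z q n m" by (simp add: B_def ip_def)
  \<comment> \<open>Minimizer of \<open>- l * x + l^2 * n * U * \<rho> / 2\<close>.\<close>
  define l where "l = x / (n * U * \<rho>)"
  have l: "0 \<le> l" using x U \<rho> by (simp add: l_def)
  have "EL Z q n (\<lambda>zs. ind (\<exists>t\<in>T. (\<Sum>z\<leftarrow>zs. R t z) < n * \<rho> - B - x))
      \<le> exp (- (- l * (n * \<rho> - B - x))) * EL Z q n (\<lambda>zs. exp (- l * m zs))"
  proof (rule EL_Markov_exp)
    fix zs assume zs: "zs \<in> lists_n Z n" and "\<exists>t\<in>T. (\<Sum>z\<leftarrow>zs. R t z) < n * \<rho> - B - x"
    then obtain t where t: "t \<in> T" "(\<Sum>z\<leftarrow>zs. R t z) < n * \<rho> - B - x" by auto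
    have "m zs \<le> (\<Sum>z\<leftarrow>zs. S t z)"
      unfolding m_def using T t(1) by (intro Min_le) auto
    also have "\<dots> \<le> (\<Sum>z\<leftarrow>zs. R t z)"
      by (rule sum_list_mono) (use SR[OF t(1)] zs in \<open>auto simp: lists_n_def\<close>)
    finally have "m zs \<le> n * \<rho> - B - x" using t(2) by linarith
    then show "- l * (n * \<rho> - B - x) \<le> - l * m zs" using l by (simp add: mult_left_mono)
  qed
  also have "\<dots> \<le> exp (- (- l * (n * \<rho> - B - x))) * exp (- l * EL Z q n m + l\<^sup>2 * n * U * \<rho> / 2)"
    unfolding m_def
  proof (intro mult_left_mono EL_exp_Min T False l)
    show "S t z \<le> U" if "t \<in> T" "z \<in> Z" for t z
      using SR[OF that] bdd[OF that] by linarith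
  qed (use S0 SE in auto)
  also have "\<dots> \<le> exp (- (- l * (n * \<rho> - B - x))) * exp (- l * (n * \<rho> - B) + l\<^sup>2 * n * U * \<rho> / 2)"
    using mult_left_mono[OF Em l] by simp
  also have "\<dots> = exp (- l * x + l\<^sup>2 * n * U * \<rho> / 2)"
    by (simp add: algebra_simps flip: exp_add)
  also have "- l * x + l\<^sup>2 * n * U * \<rho> / 2 = - x\<^sup>2 / (2 * n * U * \<rho>)"
    using U \<rho> n by (simp add: l_def field_simps power2_eq_square)
  finally show ?thesis by (simp add: B_def)
qed

end

section \<open>The smallest eigenvalue of a symmetric matrix\<close>

text \<open>Function types carry the product topology, so this is Tychonoff's theorem. Boxes pinned
  to 0 off a finite index set supply the compactness of balls of parameters.\<close>

lemma compact_box: "compact {v :: 'i \<Rightarrow> real. \<forall>i. lo i \<le> v i \<and> v i \<le> hi i}"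
proof -
  have "{v :: 'i \<Rightarrow> real. \<forall>i. lo i \<le> v i \<and> v i \<le> hi i} = (\<Pi>\<^sub>E i\<in>UNIV. {lo i..hi i})"
    by (auto simp: PiE_def Pi_def)
  moreover have "compactin (product_topology (\<lambda>i. euclidean) UNIV) (\<Pi>\<^sub>E i\<in>(UNIV :: 'i set). {lo i..hi i})"
    by (subst compactin_PiE) (simp add: compactin_euclidean_iff)
  ultimately show ?thesis
    by (simp add: euclidean_product_topology compactin_euclidean_iff)
qed

lemma abs_le_nrm:
  assumes "finite I" "i \<in> I"
  shows "\<bar>v i\<bar> \<le> nrm I v"
proof -
  have "(v i)\<^sup>2 \<le> ip I v v"
    using member_le_sum[OF assms(2), of "\<lambda>i. v i * v i"] assms(1) by (simp add: ip_def power2_eq_square)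
  then show ?thesis unfolding nrm_def by (metis real_sqrt_abs real_sqrt_le_mono)
qed

lemma continuous_on_ip [continuous_intros]:
  fixes f g :: "'a::topological_space \<Rightarrow> 'i \<Rightarrow> real"
  assumes "\<And>i. continuous_on S (\<lambda>x. f x i)" "\<And>i. continuous_on S (\<lambda>x. g x i)"
  shows "continuous_on S (\<lambda>x. ip I (f x) (g x))"
  unfolding ip_def by (intro continuous_intros assms)

lemma continuous_on_nrm [continuous_intros]:
  fixes f :: "'a::topological_space \<Rightarrow> 'i \<Rightarrow> real"
  assumes "\<And>i. continuous_on S (\<lambda>x. f x i)"
  shows "continuous_on S (\<lambda>x. nrm I (f x))"
  unfolding nrm_def by (intro continuous_intros assms)

definition supp_on :: "'i set \<Rightarrow> ('i \<Rightarrow> real) set" where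
  "supp_on I = {v. \<forall>i. i \<notin> I \<longrightarrow> v i = 0}"

lemma compact_norm_ball:
  assumes "finite I"
  shows "compact {v \<in> supp_on I. nrm I (\<lambda>i. v i - c i) \<le> r}"
proof -
  define B where "B = {v :: 'a \<Rightarrow> real. \<forall>i. (if i \<in> I then c i - r else 0) \<le> v i \<and> v i \<le> (if i \<in> I then c i + r else 0)}"
  have "{v \<in> supp_on I. nrm I (\<lambda>i. v i - c i) \<le> r} = B \<inter> {v. nrm I (\<lambda>i. v i - c i) \<le> r}"
  proof (intro set_eqI iffI)
    fix v assume v: "v \<in> {v \<in> supp_on I. nrm I (\<lambda>i. v i - c i) \<le> r}"
    then have "\<bar>v i - c i\<bar> \<le> r" if "i \<in> I" for i
      using abs_le_nrm[OF assms that, of "\<lambda>i. v i - c i"] by simp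
    with v show "v \<in> B \<inter> {v. nrm I (\<lambda>i. v i - c i) \<le> r}"
      by (force simp: B_def supp_on_def abs_le_iff)
  next
    fix v assume "v \<in> B \<inter> {v. nrm I (\<lambda>i. v i - c i) \<le> r}"
    moreover from this have "v i = 0" if "i \<notin> I" for i
      using that by (auto simp: B_def dest!: spec[of _ i])
    ultimately show "v \<in> {v \<in> supp_on I. nrm I (\<lambda>i. v i - c i) \<le> r}"
      by (auto simp: supp_on_def)
  qed
  moreover have "closed {v. nrm I (\<lambda>i. v i - c i) \<le> r}"
    by (intro closed_Collect_le continuous_intros continuous_on_product_coordinates)
  moreover have "compact B" unfolding B_def by (rule compact_box)
  ultimately show ?thesis by (simp add: compact_Int_closed)
qed

definition mv :: "'i set \<Rightarrow> ('i \<Rightarrow> 'i \<Rightarrow> real) \<Rightarrow> ('i \<Rightarrow> real) \<Rightarrow> 'i \<Rightarrow> real" where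
  "mv I M v i = (\<Sum>j\<in>I. M i j * v j)"

lemma mv_add: "mv I M (\<lambda>i. u i + t * v i) i = mv I M u i + t * mv I M v i"
  by (simp add: mv_def distrib_left sum.distrib sum_distrib_left mult_ac)

lemma ip_commute: "ip I u v = ip I v u"
  by (simp add: ip_def mult.commute)

lemma ip_add_left: "ip I (\<lambda>i. v i + c * w i) u = ip I v u + c * ip I w u"
  using ip_add_right[of I u v c w] by (simp add: ip_commute)

lemma ip_mv_sym:
  assumes sym: "\<And>i j. i \<in> I \<Longrightarrow> j \<in> I \<Longrightarrow> M i j = M j i"
  shows "ip I u (mv I M v) = ip I v (mv I M u)"
proof -
  have "ip I u (mv I M v) = (\<Sum>i\<in>I. \<Sum>j\<in>I. u i * M i j * v j)"
    by (simp add: ip_def mv_def sum_distrib_left mult_ac)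
  also have "\<dots> = (\<Sum>j\<in>I. \<Sum>i\<in>I. u i * M i j * v j)" by (rule sum.swap)
  also have "\<dots> = (\<Sum>j\<in>I. \<Sum>i\<in>I. v j * (M j i * u i))"
    by (intro sum.cong refl) (use sym in simp)
  also have "\<dots> = ip I v (mv I M u)"
    by (simp add: ip_def mv_def sum_distrib_left)
  finally show ?thesis .
qed

lemma eigvals_iff:
  "mu \<in> eigvals I M \<longleftrightarrow> (\<exists>v\<in>supp_on I. (\<exists>i\<in>I. v i \<noteq> 0) \<and> (\<forall>i\<in>I. mv I M v i = mu * v i))"
  by (auto simp: eigvals_def supp_on_def mv_def)

lemma ip_eq_0_iff: "finite I \<Longrightarrow> ip I v v = 0 \<longleftrightarrow> (\<forall>i\<in>I. v i = 0)"
  by (simp add: ip_def sum_nonneg_eq_0_iff)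

text \<open>First-order optimality without derivatives: for small \<open>t\<close> the linear term
  dominates and would change sign.\<close>

lemma linear_term_zero:
  fixes b c :: real
  assumes "\<And>t. 0 \<le> 2 * t * b + t\<^sup>2 * c"
  shows "b = 0"
proof (rule ccontr)
  assume b: "b \<noteq> 0"
  \<comment> \<open>Large enough that at \<open>t = - b / d\<close> the expression equals
    \<open>(b / d)^2 * (c - 2 * d)\<close>, which is negative.\<close>
  define d where "d = \<bar>c\<bar> + 1"
  have d: "0 < d" "c < 2 * d" by (auto simp: d_def)
  have "0 \<le> 2 * (- b / d) * b + (- b / d)\<^sup>2 * c" by (rule assms)
  also have "\<dots> = (b / d)\<^sup>2 * (c - 2 * d)"
    using d by (simp add: power2_eq_square field_simps)
  also have "\<dots> < 0" using b d by (intro mult_pos_neg) auto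
  finally show False by simp
qed

lemma ip_cong: "(\<And>i. i \<in> I \<Longrightarrow> u i = u' i) \<Longrightarrow> (\<And>i. i \<in> I \<Longrightarrow> v i = v' i) \<Longrightarrow> ip I u v = ip I u' v'"
  by (simp add: ip_def)

text \<open>The quadratic form attains a minimum on the compact unit sphere. At the minimizer the
  first-order condition makes \<open>M v - m v\<close> orthogonal to every direction, so it vanishes
  and the minimum is an eigenvalue.\<close>

lemma Rayleigh_eigenvalue:
  assumes fin: "finite I" "I \<noteq> {}" and sym: "\<And>i j. i \<in> I \<Longrightarrow> j \<in> I \<Longrightarrow> M i j = M j i"
  shows "\<exists>m\<in>eigvals I M. \<forall>v. m * ip I v v \<le> ip I v (mv I M v)"
proof -
  define S where "S = {v \<in> supp_on I. ip I v v = 1}"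
  define Q where "Q v = ip I v (mv I M v)" for v
  have contQ: "continuous_on A Q" for A
    unfolding Q_def mv_def by (intro continuous_intros continuous_on_subset[OF continuous_on_product_coordinates]) auto
  have S_eq: "S = {v \<in> supp_on I. nrm I (\<lambda>i. v i - 0) \<le> 1} \<inter> {v. ip I v v = 1}"
    by (auto simp: S_def nrm_def)
  have "closed {v. ip I v v = 1}"
    by (intro closed_Collect_eq continuous_intros continuous_on_product_coordinates)
  then have cS: "compact S" unfolding S_eq by (rule compact_Int_closed[OF compact_norm_ball[OF fin(1)]])
  have neS: "S \<noteq> {}"
  proof -
    obtain i where i: "i \<in> I" using fin by auto
    have "(\<lambda>j. if j = i then 1 else 0) \<in> S"
      using fin i by (auto simp: S_def supp_on_def ip_def if_distrib cong: if_cong)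
    then show ?thesis by blast
  qed
  obtain v0 where v0: "v0 \<in> S" "\<And>v. v \<in> S \<Longrightarrow> Q v0 \<le> Q v"
    using continuous_attains_inf[OF cS neS contQ] by blast
  define m where "m = Q v0"
  have bound: "m * ip I v v \<le> Q v" for v
  proof (cases "ip I v v = 0")
    case True
    then have "\<forall>i\<in>I. v i = 0" using fin by (simp add: ip_eq_0_iff)
    then have "Q v = 0" by (simp add: Q_def ip_def)
    with True show ?thesis by simp
  next
    case False
    define r where "r = nrm I v"
    have r: "0 < r" "r\<^sup>2 = ip I v v" using False ip_nonneg[of I v] by (simp_all add: r_def nrm_def)
    define v' where "v' i = (if i \<in> I then v i / r else 0)" for i
    have "ip I v' v' = ip I v v / r\<^sup>2"
      by (simp add: ip_def v'_def power2_eq_square sum_divide_distrib)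
    then have "v' \<in> S" using r False by (simp add: S_def supp_on_def v'_def)
    then have "m \<le> Q v'" unfolding m_def by (rule v0)
    also have "Q v' = Q v / r\<^sup>2"
      by (simp add: Q_def ip_def mv_def v'_def power2_eq_square sum_divide_distrib sum_distrib_left)
    finally show ?thesis using r False ip_nonneg[of I v] by (simp add: pos_le_divide_eq)
  qed
  define e where "e i = mv I M v0 i - m * v0 i" for i
  have e: "ip I w e = 0" for w
  proof -
    have ipe: "ip I w e = ip I w (mv I M v0) - m * ip I w v0"
      by (simp add: e_def ip_def right_diff_distrib sum_subtractf sum_distrib_left mult_ac)
    show ?thesis
    proof (rule linear_term_zero)
      fix t
      have "mv I M (\<lambda>i. v0 i + t * w i) = (\<lambda>i. mv I M v0 i + t * mv I M w i)"
        by (rule ext) (rule mv_add)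
      then have "Q (\<lambda>i. v0 i + t * w i)
          = Q v0 + t * ip I v0 (mv I M w) + t * ip I w (mv I M v0) + t\<^sup>2 * Q w"
        by (simp add: Q_def ip_add_left ip_add_right power2_eq_square algebra_simps)
      also have "ip I v0 (mv I M w) = ip I w (mv I M v0)" by (rule ip_mv_sym[OF sym])
      finally have q: "Q (\<lambda>i. v0 i + t * w i) = m + 2 * t * ip I w (mv I M v0) + t\<^sup>2 * Q w"
        by (simp add: m_def)
      have n: "ip I (\<lambda>i. v0 i + t * w i) (\<lambda>i. v0 i + t * w i) = 1 + 2 * t * ip I w v0 + t\<^sup>2 * ip I w w"
        using v0(1) by (simp add: S_def ip_add_left ip_add_right ip_commute[of I v0 w] power2_eq_square algebra_simps)
      show "0 \<le> 2 * t * ip I w e + t\<^sup>2 * (Q w - m * ip I w w)"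
        using bound[of "\<lambda>i. v0 i + t * w i"] unfolding q n ipe by (simp add: algebra_simps)
    qed
  qed
  have "\<forall>i\<in>I. e i = 0" using e[of e] fin by (simp add: ip_eq_0_iff)
  moreover have "\<exists>i\<in>I. v0 i \<noteq> 0" using v0(1) fin ip_eq_0_iff[of I v0] by (auto simp: S_def)
  ultimately have "m \<in> eigvals I M"
    unfolding eigvals_iff using v0(1) by (intro bexI[of _ v0]) (auto simp: e_def S_def)
  with bound show ?thesis by (auto simp: Q_def)
qed

text \<open>Unit eigenvectors for distinct eigenvalues are orthonormal, and Bessel's inequality
  bounds the size of an orthonormal family by the dimension.\<close>
lemma finite_eigvals:
  assumes fin: "finite I" and sym: "\<And>i j. i \<in> I \<Longrightarrow> j \<in> I \<Longrightarrow> M i j = M j i"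
  shows "finite (eigvals I M)"
proof (rule ccontr)
  assume "infinite (eigvals I M)"
  then obtain F where F: "finite F" "card F = Suc (card I)" "F \<subseteq> eigvals I M"
    using infinite_arbitrarily_large by blast
  have "\<forall>mu\<in>F. \<exists>v. ip I v v = 1 \<and> (\<forall>i\<in>I. mv I M v i = mu * v i)"
  proof
    fix mu assume "mu \<in> F"
    then obtain v where v: "\<exists>i\<in>I. v i \<noteq> 0" "\<forall>i\<in>I. mv I M v i = mu * v i"
      using F(3) unfolding subset_eq eigvals_iff by blast
    have pos: "0 < ip I v v" using v(1) fin ip_nonneg[of I v] ip_eq_0_iff[of I v] by fastforce
    define r where "r = nrm I v"
    have r: "0 < r" "r\<^sup>2 = ip I v v" using pos by (simp_all add: r_def nrm_def)
    have "ip I (\<lambda>i. v i / r) (\<lambda>i. v i / r) = ip I v v / r\<^sup>2"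
      by (simp add: ip_def power2_eq_square sum_divide_distrib)
    moreover have "mv I M (\<lambda>i. v i / r) i = mv I M v i / r" for i
      by (simp add: mv_def sum_divide_distrib)
    ultimately show "\<exists>v. ip I v v = 1 \<and> (\<forall>i\<in>I. mv I M v i = mu * v i)"
      using r v(2) pos by (intro exI[of _ "\<lambda>i. v i / r"]) simp
  qed
  then obtain u where u1: "\<And>mu. mu \<in> F \<Longrightarrow> ip I (u mu) (u mu) = 1"
    and u2: "\<And>mu i. mu \<in> F \<Longrightarrow> i \<in> I \<Longrightarrow> mv I M (u mu) i = mu * u mu i"
    by metis
  have orth: "ip I (u a) (u b) = 0" if "a \<in> F" "b \<in> F" "a \<noteq> b" for a b
  proof -
    have "b * ip I (u a) (u b) = ip I (u a) (mv I M (u b))"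
      by (simp add: ip_def u2 that sum_distrib_left mult_ac)
    also have "\<dots> = ip I (u b) (mv I M (u a))" by (rule ip_mv_sym[OF sym])
    also have "\<dots> = a * ip I (u a) (u b)"
      by (simp add: ip_def u2 that sum_distrib_left mult_ac)
    finally show ?thesis using that(3) by simp
  qed
  have Bessel: "(\<Sum>a\<in>F. (u a i)\<^sup>2) \<le> 1" if i: "i \<in> I" for i
  proof -
    \<comment> \<open>The orthogonal projection of the coordinate vector \<open>d\<close>,
      introduced below, onto the span of the family.\<close>
    define y where "y j = (\<Sum>a\<in>F. u a i * u a j)" for j
    have yy: "ip I y y = (\<Sum>a\<in>F. (u a i)\<^sup>2)"
    proof -
      have "ip I y y = (\<Sum>j\<in>I. \<Sum>a\<in>F. \<Sum>b\<in>F. u a i * u b i * (u a j * u b j))"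
        by (simp add: ip_def y_def sum_product mult_ac)
      also have "\<dots> = (\<Sum>a\<in>F. \<Sum>j\<in>I. \<Sum>b\<in>F. u a i * u b i * (u a j * u b j))"
        by (rule sum.swap)
      also have "\<dots> = (\<Sum>a\<in>F. \<Sum>b\<in>F. \<Sum>j\<in>I. u a i * u b i * (u a j * u b j))"
        by (intro sum.cong refl) (rule sum.swap)
      also have "\<dots> = (\<Sum>a\<in>F. \<Sum>b\<in>F. u a i * u b i * ip I (u a) (u b))"
        by (simp add: ip_def sum_distrib_left)
      also have "\<dots> = (\<Sum>a\<in>F. \<Sum>b\<in>F. if b = a then u a i * u b i else 0)"
        by (intro sum.cong refl) (use u1 orth in auto)
      also have "\<dots> = (\<Sum>a\<in>F. (u a i)\<^sup>2)"
        using F(1) by (simp add: power2_eq_square)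
      finally show ?thesis .
    qed
    have yi: "y i = (\<Sum>a\<in>F. (u a i)\<^sup>2)" by (simp add: y_def power2_eq_square)
    define d where "d = (\<lambda>j. if j = i then 1 else 0 :: real)"
    have dy: "ip I d y = y i" "ip I d d = 1"
      using fin i by (simp_all add: ip_def d_def if_distrib[of "\<lambda>x. x * _"] cong: if_cong)
    have "0 \<le> ip I (\<lambda>j. d j + (-1) * y j) (\<lambda>j. d j + (-1) * y j)" by (rule ip_nonneg)
    also have "\<dots> = 1 - 2 * y i + ip I y y"
      unfolding ip_add_left ip_add_right by (simp add: dy ip_commute[of I y d])
    finally show ?thesis using yy yi by simp
  qed
  have "real (card F) = (\<Sum>a\<in>F. ip I (u a) (u a))" by (simp add: u1)
  also have "\<dots> = (\<Sum>i\<in>I. \<Sum>a\<in>F. (u a i)\<^sup>2)"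
    unfolding ip_def by (subst sum.swap) (simp add: power2_eq_square)
  also have "\<dots> \<le> (\<Sum>i\<in>I. 1)" by (rule sum_mono) (rule Bessel)
  finally show False using F(2) by simp
qed

text \<open>By finiteness \<open>Min\<close> is a true minimum, hence at most the eigenvalue of
  \<open>Rayleigh_eigenvalue\<close>, which bounds the form from below.\<close>

lemma lambda_min_le:
  assumes fin: "finite I" "I \<noteq> {}" and sym: "\<And>i j. i \<in> I \<Longrightarrow> j \<in> I \<Longrightarrow> M i j = M j i"
  shows "lambda_min I M * ip I v v \<le> ip I v (mv I M v)"
proof -
  obtain m where m: "m \<in> eigvals I M" "\<And>v. m * ip I v v \<le> ip I v (mv I M v)"
    using Rayleigh_eigenvalue[of I M] fin sym by blast
  have "finite (eigvals I M)" using fin(1) sym by (rule finite_eigvals)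
  then have "lambda_min I M \<le> m"
    unfolding lambda_min_def using m(1) by (rule Min_le)
  then have "lambda_min I M * ip I v v \<le> m * ip I v v"
    by (rule mult_right_mono) (rule ip_nonneg)
  also have "\<dots> \<le> ip I v (mv I M v)" by (rule m(2))
  finally show ?thesis .
qed

lemma lambda_min_nonneg:
  assumes fin: "finite I" "I \<noteq> {}" and sym: "\<And>i j. i \<in> I \<Longrightarrow> j \<in> I \<Longrightarrow> M i j = M j i"
    and psd: "\<And>v. 0 \<le> ip I v (mv I M v)"
  shows "0 \<le> lambda_min I M"
proof -
  have "eigvals I M \<noteq> {}" using Rayleigh_eigenvalue[of I M] fin sym by blast
  moreover have "finite (eigvals I M)" using fin(1) sym by (rule finite_eigvals)
  ultimately have "lambda_min I M \<in> eigvals I M"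
    unfolding lambda_min_def by (simp add: Min_in)
  then obtain v where v: "\<exists>i\<in>I. v i \<noteq> 0" "\<forall>i\<in>I. mv I M v i = lambda_min I M * v i"
    by (auto simp: eigvals_iff)
  have pos: "0 < ip I v v" using v(1) fin ip_nonneg[of I v] ip_eq_0_iff[of I v] by fastforce
  have "ip I v (mv I M v) = ip I v (\<lambda>i. lambda_min I M * v i)"
    by (rule ip_cong) (use v in auto)
  also have "\<dots> = lambda_min I M * ip I v v"
    by (simp add: ip_def sum_distrib_left mult_ac)
  finally show ?thesis using psd[of v] pos by (simp add: zero_le_mult_iff)
qed

section \<open>Localizing minimizers of convex functions\<close>

text \<open>On the ray from \<open>c\<close> through a point outside the ball, the objective rises
  between the radii \<open>(1 - s) * \<delta>\<close> and \<open>\<delta>\<close>. By convexity it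
  stays above its value at the inner radius from there on, so every outside point is beaten by a
  point of the ball. A minimizer over the compact ball is therefore global.\<close>

lemma minimizers_in_ball:
  fixes G :: "('i \<Rightarrow> real) \<Rightarrow> real"
  assumes fin: "finite I" and c: "c \<in> supp_on I" and \<delta>: "0 < \<delta>" and s: "0 < s" "s < 1"
    and cont: "continuous_on UNIV G"
    and conv: "\<And>u. convex_on UNIV (\<lambda>t. G (\<lambda>i. c i + t * u i))"
    and sphere: "\<And>u. u \<in> supp_on I \<Longrightarrow> nrm I u = \<delta> \<Longrightarrow> G (\<lambda>i. c i + (1 - s) * u i) < G (\<lambda>i. c i + u i)"
  shows "\<exists>x\<in>supp_on I. \<forall>y\<in>supp_on I. G x \<le> G y"
    and "\<And>x. x \<in> supp_on I \<Longrightarrow> (\<And>y. y \<in> supp_on I \<Longrightarrow> G x \<le> G y) \<Longrightarrow> nrm I (\<lambda>i. x i - c i) \<le> \<delta>"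
proof -
  define B where "B = {v \<in> supp_on I. nrm I (\<lambda>i. v i - c i) \<le> \<delta>}"
  have out: "\<exists>y\<in>B. G y < G x" if x: "x \<in> supp_on I" "\<delta> < nrm I (\<lambda>i. x i - c i)" for x
  proof -
    define u where "u i = x i - c i" for i
    define r where "r = nrm I u"
    define f where "f t = G (\<lambda>i. c i + t * u i)" for t
    have r: "\<delta> < r" using x by (simp add: r_def u_def[abs_def])
    define a where "a = \<delta> / r"
    have a: "0 < a" "a < 1" using r \<delta> by (auto simp: a_def)
    define b where "b = (1 - s) * a"
    have b: "0 < b" "b < a" using a s by (auto simp: b_def algebra_simps)
    have u: "u \<in> supp_on I" using x(1) c by (auto simp: u_def supp_on_def)
    have "nrm I (\<lambda>i. a * u i) = \<delta>"
      unfolding nrm_scale using a r \<delta> by (simp add: a_def r_def[symmetric])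
    then have "G (\<lambda>i. c i + (1 - s) * (a * u i)) < G (\<lambda>i. c i + a * u i)"
      by (intro sphere) (use u in \<open>auto simp: supp_on_def\<close>)
    then have ba: "f b < f a" by (simp add: f_def b_def mult.assoc)
    \<comment> \<open>The weight that writes \<open>a\<close> as a convex combination of
      \<open>b\<close> and 1.\<close>
    define l where "l = (a - b) / (1 - b)"
    have l01: "0 < l" "l \<le> 1" using a b by (auto simp: l_def)
    have "l * (1 - b) = a - b" using a b by (simp add: l_def)
    with l01 have l: "0 < l" "l \<le> 1" "a = (1 - l) * b + l * 1" by (auto simp: algebra_simps)
    have "f a \<le> (1 - l) * f b + l * f 1"
      using convex_onD[OF conv[of u], of l b 1] l unfolding f_def by simp
    then have "f b < f 1"
    proof -
      assume h: "f a \<le> (1 - l) * f b + l * f 1"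
      have "l * (f 1 - f b) > 0" using h ba by (simp add: algebra_simps)
      then show ?thesis using l by (simp add: zero_less_mult_iff)
    qed
    moreover have "f 1 = G x" by (simp add: f_def u_def)
    ultimately have "G (\<lambda>i. c i + b * u i) < G x" by (simp add: f_def)
    moreover have "(\<lambda>i. c i + b * u i) \<in> B"
    proof -
      have "nrm I (\<lambda>i. b * u i) = b * r" using b by (simp add: nrm_scale r_def)
      also have "\<dots> \<le> a * r" using b r \<delta> by (intro mult_right_mono) auto
      also have "\<dots> = \<delta>" using r \<delta> by (simp add: a_def)
      finally show ?thesis using u c by (auto simp: B_def supp_on_def)
    qed
    ultimately show ?thesis by blast
  qed
  have cB: "compact B" unfolding B_def by (rule compact_norm_ball[OF fin])
  have "c \<in> B" using c \<delta> by (simp add: B_def nrm_def ip_def)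
  then have neB: "B \<noteq> {}" by blast
  obtain x0 where x0: "x0 \<in> B" "\<And>y. y \<in> B \<Longrightarrow> G x0 \<le> G y"
    using continuous_attains_inf[OF cB neB continuous_on_subset[OF cont subset_UNIV]] by blast
  have "G x0 \<le> G y" if y: "y \<in> supp_on I" for y
  proof (cases "y \<in> B")
    case True
    then show ?thesis by (rule x0)
  next
    case False
    with y have "\<delta> < nrm I (\<lambda>i. y i - c i)" by (simp add: B_def)
    then obtain z where "z \<in> B" "G z < G y" using out[OF y] by blast
    with x0(2)[of z] show ?thesis by simp
  qed
  with x0 show "\<exists>x\<in>supp_on I. \<forall>y\<in>supp_on I. G x \<le> G y" by (auto simp: B_def)
  show "nrm I (\<lambda>i. x i - c i) \<le> \<delta>" if x: "x \<in> supp_on I" "\<And>y. y \<in> supp_on I \<Longrightarrow> G x \<le> G y" for x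
  proof (rule ccontr)
    assume "\<not> nrm I (\<lambda>i. x i - c i) \<le> \<delta>"
    then have "\<delta> < nrm I (\<lambda>i. x i - c i)" by simp
    then obtain y where "y \<in> B" "G y < G x" using out[OF x(1)] by blast
    with x(2)[of y] show False by (simp add: B_def)
  qed
qed

section \<open>Lower tails over infinite parameter sets and the sphere condition\<close>

context fin_pmf
begin

text \<open>There are finitely many samples of size \<open>n\<close>. Choosing one violating
  parameter for each bad sample gives a finite subset of \<open>T\<close> with the same
  event.\<close>

corollary uniform_lower_tail_infinite:
  fixes T :: "('i \<Rightarrow> real) set" and w :: "'k \<Rightarrow> 'z \<Rightarrow> 'i \<Rightarrow> real"
  assumes Ks: "finite Ks" "Ks \<noteq> {}"
    and norm: "\<And>t. t \<in> T \<Longrightarrow> nrm I t \<le> \<delta>" and \<delta>: "0 \<le> \<delta>"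
    and W: "\<And>k z. k \<in> Ks \<Longrightarrow> z \<in> Z \<Longrightarrow> ip I (w k z) (w k z) \<le> W"
    and R: "\<And>t z. R t z = (\<Sum>k\<in>Ks. r k z (ip I t (w k z)))"
    and r0: "\<And>k z. r k z 0 = 0"
    and lip: "\<And>k z a b. k \<in> Ks \<Longrightarrow> z \<in> Z \<Longrightarrow> \<bar>r k z a - r k z b\<bar> \<le> \<bar>a - b\<bar>"
    and pos: "\<And>t z. t \<in> T \<Longrightarrow> z \<in> Z \<Longrightarrow> 0 \<le> R t z"
    and bdd: "\<And>t z. t \<in> T \<Longrightarrow> z \<in> Z \<Longrightarrow> R t z \<le> U"
    and mean: "\<And>t. t \<in> T \<Longrightarrow> \<rho> \<le> EZ (R t)" and \<rho>: "0 < \<rho>" and x: "0 \<le> x" and n: "0 < n" and U: "0 < U"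
  shows "EL Z q n (\<lambda>zs. ind (\<exists>t\<in>T. (\<Sum>z\<leftarrow>zs. R t z) < n * \<rho> - \<delta> * sqrt (n * (4 * (real (card Ks))\<^sup>2 * W)) - x))
    \<le> exp (- x\<^sup>2 / (2 * n * U * \<rho>))"
proof -
  define P where "P t zs \<longleftrightarrow> (\<Sum>z\<leftarrow>zs. R t z) < n * \<rho> - \<delta> * sqrt (n * (4 * (real (card Ks))\<^sup>2 * W)) - x" for t zs
  define f where "f zs = (SOME t. t \<in> T \<and> P t zs)" for zs
  define T' where "T' = f ` {zs \<in> lists_n Z n. \<exists>t\<in>T. P t zs}"
  have f: "f zs \<in> T \<and> P (f zs) zs" if "\<exists>t\<in>T. P t zs" for zs
    unfolding f_def by (rule someI_ex[of "\<lambda>t. t \<in> T \<and> P t zs"]) (use that in blast)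
  have T': "finite T'" "T' \<subseteq> T"
    using f by (auto simp: T'_def finite_lists_n finZ)
  have "EL Z q n (\<lambda>zs. ind (\<exists>t\<in>T. P t zs)) = EL Z q n (\<lambda>zs. ind (\<exists>t\<in>T'. P t zs))"
  proof (rule EL_cong)
    fix zs assume "zs \<in> lists_n Z n"
    then have "(\<exists>t\<in>T. P t zs) \<longleftrightarrow> (\<exists>t\<in>T'. P t zs)"
      using f T'(2) by (auto simp: T'_def)
    then show "ind (\<exists>t\<in>T. P t zs) = ind (\<exists>t\<in>T'. P t zs)" by simp
  qed
  also have "\<dots> \<le> exp (- x\<^sup>2 / (2 * real n * U * \<rho>))"
    unfolding P_def
    by (rule uniform_lower_tail[where w = w and r = r, OF T'(1) Ks norm[OF subsetD[OF T'(2)]] \<delta> W R r0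
        lip pos[OF subsetD[OF T'(2)]] bdd[OF subsetD[OF T'(2)]] mean[OF subsetD[OF T'(2)]] \<rho> x n U])
  finally show ?thesis by (simp add: P_def)
qed

text \<open>The loss difference between the radii \<open>(1 - s) * \<delta>\<close> and \<open>\<delta>\<close> splits into a linear term, controlled
  coordinatewise by Hoeffding's inequality, and a Bregman-type remainder.\<close>
lemma sphere_condition_prob:
  fixes \<theta> :: "'i \<Rightarrow> real" and loss :: "('i \<Rightarrow> real) \<Rightarrow> 'z \<Rightarrow> real" and G :: "'z \<Rightarrow> 'i \<Rightarrow> real"
  assumes I: "finite I" "I \<noteq> {}"
    and mgf: "\<And>i l. i \<in> I \<Longrightarrow> EZ (\<lambda>z. exp (l * G z i)) \<le> exp (l\<^sup>2 * c\<^sup>2 / 8)"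
    and u: "0 < u" and c: "0 < c" and n: "0 < n" and \<delta>: "0 < \<delta>" and s: "0 < s"
  defines "R D z \<equiv> loss (\<lambda>i. \<theta> i + D i) z - loss (\<lambda>i. \<theta> i + (1 - s) * D i) z - s * ip I D (G z)"
  shows "EL Z q n (\<lambda>zs. ind (\<exists>D\<in>supp_on I. nrm I D = \<delta> \<and>
        \<not> (\<Sum>z\<leftarrow>zs. loss (\<lambda>i. \<theta> i + (1 - s) * D i) z) < (\<Sum>z\<leftarrow>zs. loss (\<lambda>i. \<theta> i + D i) z)))
    \<le> 2 * real (card I) * exp (- 2 * u\<^sup>2 / (n * c\<^sup>2))
      + EL Z q n (\<lambda>zs. ind (\<exists>D\<in>{D\<in>supp_on I. nrm I D = \<delta>}. (\<Sum>z\<leftarrow>zs. R D z) < s * sqrt (card I) * u * \<delta>))"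
proof -
  let ?bad = "\<lambda>zs. \<exists>D\<in>supp_on I. nrm I D = \<delta> \<and>
        \<not> (\<Sum>z\<leftarrow>zs. loss (\<lambda>i. \<theta> i + (1 - s) * D i) z) < (\<Sum>z\<leftarrow>zs. loss (\<lambda>i. \<theta> i + D i) z)"
  let ?rem = "\<lambda>zs. \<exists>D\<in>{D\<in>supp_on I. nrm I D = \<delta>}. (\<Sum>z\<leftarrow>zs. R D z) < s * sqrt (card I) * u * \<delta>"
  have "EL Z q n (\<lambda>zs. ind (?bad zs))
      \<le> EL Z q n (\<lambda>zs. (\<Sum>i\<in>I. ind (u \<le> \<bar>\<Sum>z\<leftarrow>zs. G z i\<bar>)) + ind (?rem zs))"
  proof (rule EL_mono)
    fix zs
    have nonneg: "0 \<le> ind b" "ind b \<le> 1" for b by (auto simp: ind_def)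
    show "ind (?bad zs) \<le> (\<Sum>i\<in>I. ind (u \<le> \<bar>\<Sum>z\<leftarrow>zs. G z i\<bar>)) + ind (?rem zs)"
    proof (cases "(\<exists>i\<in>I. u \<le> \<bar>\<Sum>z\<leftarrow>zs. G z i\<bar>) \<or> ?rem zs")
      case True
      then show ?thesis
      proof
        assume "\<exists>i\<in>I. u \<le> \<bar>\<Sum>z\<leftarrow>zs. G z i\<bar>"
        then obtain i where i: "i \<in> I" "u \<le> \<bar>\<Sum>z\<leftarrow>zs. G z i\<bar>" by blast
        have "ind (u \<le> \<bar>\<Sum>z\<leftarrow>zs. G z i\<bar>) \<le> (\<Sum>i\<in>I. ind (u \<le> \<bar>\<Sum>z\<leftarrow>zs. G z i\<bar>))"
          by (rule member_le_sum[OF i(1)]) (use I nonneg in auto)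
        then show ?thesis using i(2) nonneg[of "?bad zs"] nonneg[of "?rem zs"] by (simp add: ind_def)
      next
        assume "?rem zs"
        then have "ind (?rem zs) = 1" by (simp add: ind_def)
        moreover have "0 \<le> (\<Sum>i\<in>I. ind (u \<le> \<bar>\<Sum>z\<leftarrow>zs. G z i\<bar>))" by (intro sum_nonneg nonneg)
        ultimately show ?thesis using nonneg[of "?bad zs"] by linarith
      qed
    next
      case False
      have "\<not> ?bad zs"
      proof
        assume "?bad zs"
        then obtain D where D: "D \<in> supp_on I" "nrm I D = \<delta>"
          and le: "(\<Sum>z\<leftarrow>zs. loss (\<lambda>i. \<theta> i + D i) z) \<le> (\<Sum>z\<leftarrow>zs. loss (\<lambda>i. \<theta> i + (1 - s) * D i) z)"
          by (auto simp: not_less)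
        define S where "S i = (\<Sum>z\<leftarrow>zs. G z i)" for i
        have "(\<Sum>z\<leftarrow>ys. s * ip I D (G z)) = s * ip I D (\<lambda>i. \<Sum>z\<leftarrow>ys. G z i)" for ys
          by (induction ys) (simp_all add: ip_def distrib_left sum.distrib)
        then have ipS: "(\<Sum>z\<leftarrow>zs. s * ip I D (G z)) = s * ip I D S"
          by (simp add: S_def[abs_def])
        have "ip I S S < (\<Sum>i\<in>I. u\<^sup>2)"
          unfolding ip_def
        proof (rule sum_strict_mono[OF I])
          fix i assume "i \<in> I"
          then have "\<bar>S i\<bar> < u" using False by (auto simp: S_def not_le)
          then show "S i * S i < u\<^sup>2"
            using u power_strict_mono[of "\<bar>S i\<bar>" u 2] by (simp add: power2_eq_square)
        qed
        then have "nrm I S < sqrt (card I * u\<^sup>2)" by (simp add: nrm_def)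
        also have "\<dots> = sqrt (card I) * u" using u by (simp add: real_sqrt_mult)
        finally have "\<delta> * nrm I S < \<delta> * (sqrt (card I) * u)" using \<delta> by simp
        with Cauchy_Schwarz_ip[of I D S] D(2) have "\<bar>ip I D S\<bar> < \<delta> * (sqrt (card I) * u)" by simp
        then have "- (sqrt (card I) * u * \<delta>) < ip I D S" by (simp add: abs_less_iff mult_ac)
        then have "s * (- (sqrt (card I) * u * \<delta>)) < s * ip I D S"
          using s by (rule mult_strict_left_mono)
        moreover have "s * sqrt (card I) * u * \<delta> \<le> (\<Sum>z\<leftarrow>zs. R D z)"
          using False D by (auto simp: not_less)
        moreover have "(\<Sum>z\<leftarrow>zs. R D z) = (\<Sum>z\<leftarrow>zs. loss (\<lambda>i. \<theta> i + D i) z)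
            - (\<Sum>z\<leftarrow>zs. loss (\<lambda>i. \<theta> i + (1 - s) * D i) z) - s * ip I D S"
          unfolding R_def sum_list_subtractf ipS ..
        ultimately show False using le by (simp add: mult.assoc)
      qed
      then have "ind (?bad zs) = 0" by (simp only: ind_def if_False)
      moreover have "0 \<le> (\<Sum>i\<in>I. ind (u \<le> \<bar>\<Sum>z\<leftarrow>zs. G z i\<bar>))" by (intro sum_nonneg nonneg)
      ultimately show ?thesis using nonneg[of "?rem zs"] by linarith
    qed
  qed
  also have "\<dots> = (\<Sum>i\<in>I. EL Z q n (\<lambda>zs. ind (u \<le> \<bar>\<Sum>z\<leftarrow>zs. G z i\<bar>))) + EL Z q n (\<lambda>zs. ind (?rem zs))"
    by (simp add: EL_add EL_sum I)
  also have "(\<Sum>i\<in>I. EL Z q n (\<lambda>zs. ind (u \<le> \<bar>\<Sum>z\<leftarrow>zs. G z i\<bar>))) \<le> (\<Sum>i\<in>I. 2 * exp (- 2 * u\<^sup>2 / (n * c\<^sup>2)))"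
    by (rule sum_mono, rule EL_Hoeffding) (use mgf u c n in auto)
  finally show ?thesis by (simp add: mult_ac)
qed

end

text \<open>Two applications of the mean value theorem: \<open>g 1 - g (1 - s) = s * g' t\<close>
  with \<open>t > 1 - s\<close>, and \<open>g' t - g' 0 = t * g'' r\<close>. The resulting factor
  \<open>1 - s\<close> replaces the 1/2 of a Taylor expansion from 0 to 1.\<close>

lemma second_order_gap:
  fixes g g' g'' :: "real \<Rightarrow> real"
  assumes g: "\<And>t. (g has_real_derivative g' t) (at t)"
    and g': "\<And>t. (g' has_real_derivative g'' t) (at t)"
    and m: "\<And>t. 0 \<le> t \<Longrightarrow> t \<le> 1 \<Longrightarrow> m \<le> g'' t" "0 \<le> m" and s: "0 < s" "s < 1"
  shows "s * (1 - s) * m \<le> g 1 - g (1 - s) - s * g' 0"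
proof -
  obtain t where t: "1 - s < t" "t < 1" "g 1 - g (1 - s) = (1 - (1 - s)) * g' t"
    using MVT2[of "1 - s" 1 g g'] g s by auto
  obtain r where r: "0 < r" "r < t" "g' t - g' 0 = (t - 0) * g'' r"
    using MVT2[of 0 t g' g''] g' t s by auto
  have "(1 - s) * m \<le> t * g'' r"
    using t r s m by (intro mult_mono) auto
  then have "s * ((1 - s) * m) \<le> s * (g' t - g' 0)" using s r by simp
  then show ?thesis unfolding t(3) by (simp add: algebra_simps)
qed

section \<open>The logistic loss\<close>

definition softplus :: "real \<Rightarrow> real" where "softplus x = ln (1 + exp x)"
definition sigmoid :: "real \<Rightarrow> real" where "sigmoid x = exp x / (1 + exp x)"

lemma one_plus_exp_pos: "0 < 1 + exp (x::real)"
  by (simp add: add_pos_pos)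

lemma sigmoid_bounds: "0 \<le> sigmoid x" "sigmoid x \<le> 1"
  using one_plus_exp_pos[of x] by (auto simp: sigmoid_def)

lemma softplus_deriv [derivative_intros]:
  "(f has_real_derivative d) (at x) \<Longrightarrow> ((\<lambda>x. softplus (f x)) has_real_derivative sigmoid (f x) * d) (at x)"
  unfolding softplus_def sigmoid_def
  by (auto intro!: derivative_eq_intros simp: one_plus_exp_pos)

lemma sigmoid_deriv [derivative_intros]:
  "(f has_real_derivative d) (at x) \<Longrightarrow>
    ((\<lambda>x. sigmoid (f x)) has_real_derivative sigmoid (f x) * (1 - sigmoid (f x)) * d) (at x)"
proof -
  have eq: "sigmoid y * (1 - sigmoid y) = exp y / (1 + exp y)\<^sup>2" for y
    using one_plus_exp_pos[of y] by (simp add: sigmoid_def field_simps power2_eq_square)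
  have "(sigmoid has_real_derivative sigmoid y * (1 - sigmoid y)) (at y)" for y
    unfolding eq unfolding sigmoid_def[abs_def] using one_plus_exp_pos[of y]
    by (auto intro!: derivative_eq_intros simp: field_simps power2_eq_square)
  from DERIV_chain2[OF this] show "(f has_real_derivative d) (at x) \<Longrightarrow>
    ((\<lambda>x. sigmoid (f x)) has_real_derivative sigmoid (f x) * (1 - sigmoid (f x)) * d) (at x)" .
qed

lemma sigmoid_prime_bounds: "0 \<le> sigmoid x * (1 - sigmoid x)" "sigmoid x * (1 - sigmoid x) \<le> 1 / 4"
proof -
  show "0 \<le> sigmoid x * (1 - sigmoid x)" using sigmoid_bounds[of x] by simp
  have "0 \<le> (sigmoid x - 1 / 2)\<^sup>2" by simp
  then show "sigmoid x * (1 - sigmoid x) \<le> 1 / 4" by (simp add: power2_eq_square algebra_simps)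
qed

lemma softplus_convex: "convex_on UNIV softplus"
proof (rule f''_ge0_imp_convex)
  show "(softplus has_real_derivative sigmoid x * 1) (at x)" for x
    by (rule softplus_deriv) (rule DERIV_ident)
  show "((\<lambda>x. sigmoid x * 1) has_real_derivative sigmoid x * (1 - sigmoid x) * 1) (at x)" for x
    using sigmoid_deriv[OF DERIV_ident, of x] by simp
qed (use sigmoid_prime_bounds in auto)

lemma softplus_tangent: "softplus y - sigmoid y * a \<le> softplus (y - a)"
proof -
  have "sigmoid y * ((y - a) - y) \<le> softplus (y - a) - softplus y"
    by (rule convex_on_imp_above_tangent[OF softplus_convex])
      (use softplus_deriv[OF DERIV_ident, of y] in auto)
  then show ?thesis by simp
qed

text \<open>With \<open>\<phi> x = softplus (- x)\<close> this is \<open>\<phi> (b + a) - \<phi> (b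
  + (1 - s) * a) - s * \<phi>' b * a\<close>; for \<open>s = 1\<close> it is the usual Bregman
  divergence of \<open>\<phi>\<close>.\<close>

definition bregman :: "real \<Rightarrow> real \<Rightarrow> real \<Rightarrow> real" where
  "bregman s b a = softplus (- b - a) - softplus (- b - (1 - s) * a) + s * sigmoid (- b) * a"

lemma bregman_0 [simp]: "bregman s b 0 = 0"
  by (simp add: bregman_def)

text \<open>A chord bound at the intermediate point shows that the value is at least
  \<open>s\<close> times the usual Bregman divergence, which the tangent bound makes
  nonnegative.\<close>

lemma bregman_nonneg:
  assumes "0 < s" "s < 1"
  shows "0 \<le> bregman s b a"
proof -
  have "softplus (- b - (1 - s) * a) = softplus ((1 - s) *\<^sub>R (- b - a) + s *\<^sub>R (- b))"
    by (simp add: algebra_simps)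
  also have "\<dots> \<le> (1 - s) * softplus (- b - a) + s * softplus (- b)"
    using convex_onD[OF softplus_convex, of s "- b - a" "- b"] assms by simp
  finally have 1: "softplus (- b - (1 - s) * a) \<le> (1 - s) * softplus (- b - a) + s * softplus (- b)" .
  have "s * (softplus (- b) - sigmoid (- b) * a) \<le> s * softplus (- b - a)"
    using softplus_tangent[of "- b" a] assms by (intro mult_left_mono) auto
  with 1 show ?thesis by (simp add: bregman_def algebra_simps)
qed

text \<open>The derivative in the last argument is a convex combination, with weights
  \<open>1 - s\<close> and \<open>s\<close>, of differences of sigmoid values, each of modulus at
  most 1.\<close>

lemma bregman_lipschitz:
  assumes "0 < s" "s < 1"
  shows "\<bar>bregman s b x - bregman s b y\<bar> \<le> \<bar>x - y\<bar>"
proof -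
  define f' where "f' a = (1 - s) * (sigmoid (- b - (1 - s) * a) - sigmoid (- b - a)) + s * (sigmoid (- b) - sigmoid (- b - a))" for a
  have "norm (bregman s b x - bregman s b y) \<le> 1 * norm (x - y)"
  proof (rule field_differentiable_bound[of UNIV _ f'])
    show "(bregman s b has_field_derivative f' a) (at a within UNIV)" for a
      unfolding bregman_def f'_def by (auto intro!: derivative_eq_intros simp: algebra_simps)
    show "norm (f' a) \<le> 1" for a
    proof -
      have d: "\<bar>sigmoid u - sigmoid v\<bar> \<le> 1" for u v
        using sigmoid_bounds[of u] sigmoid_bounds[of v] by auto
      have "\<bar>f' a\<bar> \<le> \<bar>(1 - s) * (sigmoid (- b - (1 - s) * a) - sigmoid (- b - a))\<bar> + \<bar>s * (sigmoid (- b) - sigmoid (- b - a))\<bar>"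
        unfolding f'_def by (rule abs_triangle_ineq)
      also have "\<dots> \<le> (1 - s) * 1 + s * 1"
        using assms unfolding abs_mult by (intro add_mono mult_mono d) auto
      finally show ?thesis by simp
    qed
  qed auto
  then show ?thesis by simp
qed

section \<open>The single-dyad model\<close>

text \<open>A real \<open>INF\<close> is a lower bound only for a family bounded below; positive
  semidefiniteness provides the bound 0.\<close>

lemma INF_lambda_min_le:
  assumes I: "finite I" "I \<noteq> {}"
    and sym: "\<And>\<theta> i j. i \<in> I \<Longrightarrow> j \<in> I \<Longrightarrow> M \<theta> i j = M \<theta> j i"
    and psd: "\<And>\<theta> v. 0 \<le> ip I v (mv I (M \<theta>) v)"
    and \<theta>: "\<theta> \<in> B"
  shows "(INF \<theta>\<in>B. lambda_min I (M \<theta>)) * ip I v v \<le> ip I v (mv I (M \<theta>) v)"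
proof -
  have "bdd_below ((\<lambda>\<theta>. lambda_min I (M \<theta>)) ` B)"
    by (rule bdd_belowI2[of _ 0]) (rule lambda_min_nonneg[OF I sym psd])
  then have "(INF \<theta>\<in>B. lambda_min I (M \<theta>)) \<le> lambda_min I (M \<theta>)"
    using \<theta> by (rule cINF_lower)
  then have "(INF \<theta>\<in>B. lambda_min I (M \<theta>)) * ip I v v \<le> lambda_min I (M \<theta>) * ip I v v"
    by (rule mult_right_mono) (rule ip_nonneg)
  also have "\<dots> \<le> ip I v (mv I (M \<theta>) v)"
    by (rule lambda_min_le[OF I sym])
  finally show ?thesis .
qed

lemma ip_mv_rank_one_sum:
  assumes "\<And>i j. i \<in> I \<Longrightarrow> j \<in> I \<Longrightarrow> M i j = (\<Sum>x\<in>X. c x * w x i * w x j)"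
  shows "ip I v (mv I M v) = (\<Sum>x\<in>X. c x * (ip I v (w x))\<^sup>2)"
proof -
  have "ip I v (mv I M v) = (\<Sum>i\<in>I. \<Sum>j\<in>I. \<Sum>x\<in>X. c x * (v i * w x i) * (v j * w x j))"
    by (simp add: ip_def mv_def assms sum_distrib_left sum_distrib_right mult_ac)
  also have "\<dots> = (\<Sum>i\<in>I. \<Sum>x\<in>X. \<Sum>j\<in>I. c x * (v i * w x i) * (v j * w x j))"
    by (rule sum.cong[OF refl]) (rule sum.swap)
  also have "\<dots> = (\<Sum>x\<in>X. \<Sum>i\<in>I. \<Sum>j\<in>I. c x * (v i * w x i) * (v j * w x j))"
    by (rule sum.swap)
  also have "\<dots> = (\<Sum>x\<in>X. c x * (ip I v (w x))\<^sup>2)"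
    by (simp add: ip_def power2_eq_square sum_product sum_distrib_left mult_ac)
  finally show ?thesis .
qed

lemma norm2_eq_nrm: "norm2 K H v = nrm (Lfam K H) v"
  by (simp add: norm2_def nrm_def ip_def power2_eq_square)

lemma Theta_eq_supp_on: "Theta K H = supp_on (Lfam K H)"
  by (simp add: Theta_def supp_on_def)

definition flip :: "nat \<Rightarrow> (nat \<Rightarrow> bool) \<Rightarrow> nat \<Rightarrow> bool" where
  "flip k z = z(k := \<not> z k)"

lemma flip_flip [simp]: "flip k (flip k z) = z"
  by (simp add: flip_def)

lemma flip_neq: "flip k z \<noteq> z"
  by (auto simp: flip_def fun_eq_iff)

lemma agree_off_iff: "(\<forall>j. j \<noteq> k \<longrightarrow> z' j = z j) \<longleftrightarrow> z' = z \<or> z' = flip k z"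
  by (auto simp: flip_def fun_eq_iff)

text \<open>When flipping layer \<open>k\<close> would leave \<open>Zset K\<close>, the conditional distribution is degenerate
  and contributes the zero vector.\<close>
definition wvec :: "nat \<Rightarrow> nat \<Rightarrow> (nat \<Rightarrow> bool) \<Rightarrow> nat set \<Rightarrow> real" where
  "wvec K k z L = (if flip k z \<in> Zset K then tvec z L - tvec (flip k z) L else 0)"

lemma wvec_abs_le: "\<bar>wvec K k z L\<bar> \<le> 1"
  by (auto simp: wvec_def tvec_def ind_def)

lemma wvec_flip: "z \<in> Zset K \<Longrightarrow> flip k z \<in> Zset K \<Longrightarrow> wvec K k (flip k z) L = - wvec K k z L"
  by (simp add: wvec_def)

lemma wvec_notin: "k \<notin> L \<Longrightarrow> wvec K k z L = 0"
  by (auto simp: wvec_def tvec_def flip_def ind_def)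

lemma finite_Zset: "finite (Zset K)"
proof (rule finite_subset)
  show "Zset K \<subseteq> (\<lambda>S k. k \<in> S) ` Pow {1..K}"
  proof
    fix z assume "z \<in> Zset K"
    then have "z = (\<lambda>k. k \<in> {k. z k})" "{k. z k} \<in> Pow {1..K}" by (auto simp: Zset_def)
    then show "z \<in> (\<lambda>S k. k \<in> S) ` Pow {1..K}" by blast
  qed
qed simp

lemma finite_Lfam: "finite (Lfam K H)"
  by (rule finite_subset[of _ "Pow {1..K}"]) (auto simp: Lfam_def)

lemma exp_jensen:
  assumes "finite S" "S \<noteq> {}"
  shows "exp (\<Sum>k\<in>S. x k) \<le> (\<Sum>k\<in>S. 1 / card S * exp (real (card S) * x k))"
proof -
  have c: "0 < real (card S)" using assms by (simp add: card_gt_0_iff)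
  have "exp (\<Sum>k\<in>S. (1 / card S) *\<^sub>R (real (card S) * x k)) \<le> (\<Sum>k\<in>S. 1 / card S * exp (real (card S) * x k))"
    by (rule convex_on_sum[OF assms convex_on_exp[of 1, simplified]]) (use c in \<open>auto simp: sum_constant_scale\<close>)
  then show ?thesis using c by simp
qed

locale dyad_model =
  fixes K H :: nat
  assumes K: "1 \<le> K" and H: "1 \<le> H" "H \<le> K"
begin

abbreviation "I \<equiv> Lfam K H"
abbreviation "ZK \<equiv> Zset K"
abbreviation "Q \<equiv> Qd K H"

lemma I_fin: "finite I" by (rule finite_Lfam)

lemma one_in_I: "{1} \<in> I"
  using K H by (auto simp: Lfam_def)

lemma I_ne: "I \<noteq> {}"
  using one_in_I by blast

lemma ZK_ne: "ZK \<noteq> {}"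
proof -
  have "(\<lambda>k. k = 1) \<in> ZK" using K by (auto simp: Zset_def)
  then show ?thesis by blast
qed

definition part :: "(nat set \<Rightarrow> real) \<Rightarrow> real" where
  "part \<theta> = (\<Sum>z\<in>ZK. exp (ip I \<theta> (tvec z)))"

lemma part_pos: "0 < part \<theta>"
  unfolding part_def by (rule sum_pos[OF finite_Zset ZK_ne]) simp

lemma Q_eq: "z \<in> ZK \<Longrightarrow> Q \<theta> z = exp (ip I \<theta> (tvec z)) / part \<theta>"
  by (simp add: Qd_def ind_def ip_def part_def)

lemma Q_pos: "z \<in> ZK \<Longrightarrow> 0 < Q \<theta> z"
  by (simp add: Q_eq part_pos)

lemma Q_fin_pmf: "fin_pmf ZK (Q \<theta>)"
proof
  show "finite ZK" by (rule finite_Zset)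
  show "0 \<le> Q \<theta> z" if "z \<in> ZK" for z using Q_pos[OF that] by (rule less_imp_le)
  have "(\<Sum>z\<in>ZK. Q \<theta> z) = (\<Sum>z\<in>ZK. exp (ip I \<theta> (tvec z)) / part \<theta>)"
    by (rule sum.cong) (simp_all add: Q_eq)
  also have "\<dots> = part \<theta> / part \<theta>" by (simp only: sum_divide_distrib[symmetric] part_def[symmetric])
  finally show "(\<Sum>z\<in>ZK. Q \<theta> z) = 1" using part_pos[of \<theta>] by simp
qed

lemma tvec_01: "0 \<le> tvec z L" "tvec z L \<le> 1" "tvec z L * tvec z L = tvec z L"
  by (auto simp: tvec_def ind_def)

lemma Q_mean_bounds: "0 \<le> (\<Sum>z\<in>ZK. Q \<theta> z * tvec z L)" "(\<Sum>z\<in>ZK. Q \<theta> z * tvec z L) \<le> 1"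
proof -
  interpret fin_pmf ZK "Q \<theta>" by (rule Q_fin_pmf)
  show "0 \<le> (\<Sum>z\<in>ZK. Q \<theta> z * tvec z L)" by (intro sum_nonneg mult_nonneg_nonneg q_nonneg tvec_01)
  show "(\<Sum>z\<in>ZK. Q \<theta> z * tvec z L) \<le> 1" using EZ_mono[of "\<lambda>z. tvec z L" "\<lambda>_. 1"] tvec_01 q_sum by simp
qed

subsection \<open>Likelihood\<close>

definition nll :: "(nat set \<Rightarrow> real) \<Rightarrow> (nat \<Rightarrow> bool) \<Rightarrow> real" where
  "nll \<theta> z = - ln (Q \<theta> z)"

lemma nll_eq: "z \<in> ZK \<Longrightarrow> nll \<theta> z = ln (part \<theta>) - ip I \<theta> (tvec z)"
  using part_pos[of \<theta>] by (simp add: nll_def Q_eq ln_div)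

text \<open>The variance of \<open>ip I D (tvec z)\<close>. The matrix is a difference of two
  rank-one sums; the product of means is one over the one-point index set
  \<open>{()}\<close>.\<close>

lemma Imat_quadratic:
  "ip I D (mv I (Imat K H \<theta>) D)
    = (\<Sum>z\<in>ZK. Q \<theta> z * (ip I D (tvec z))\<^sup>2) - (\<Sum>z\<in>ZK. Q \<theta> z * ip I D (tvec z))\<^sup>2"
proof -
  define m where "m L = (\<Sum>z\<in>ZK. Q \<theta> z * tvec z L)" for L
  have "ip I D (mv I (Imat K H \<theta>) D)
      = ip I D (mv I (\<lambda>L L'. \<Sum>z\<in>ZK. Q \<theta> z * tvec z L * tvec z L') D) - ip I D (mv I (\<lambda>L L'. \<Sum>x\<in>{()}. 1 * m L * m L') D)"
    by (simp add: ip_def mv_def Imat_def m_def left_diff_distrib right_diff_distrib sum_subtractf)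
  also have "\<dots> = (\<Sum>z\<in>ZK. Q \<theta> z * (ip I D (tvec z))\<^sup>2) - (\<Sum>x\<in>{()}. 1 * (ip I D m)\<^sup>2)"
    by (intro arg_cong2[where f = "(-)"] ip_mv_rank_one_sum) auto
  also have "ip I D m = (\<Sum>z\<in>ZK. Q \<theta> z * ip I D (tvec z))"
    unfolding ip_def m_def sum_distrib_left by (subst sum.swap) (simp add: mult_ac)
  finally show ?thesis by simp
qed

lemma Imat_sym: "Imat K H \<theta> L L' = Imat K H \<theta> L' L"
  by (simp add: Imat_def mult_ac)

lemma Imat_psd: "0 \<le> ip I D (mv I (Imat K H \<theta>) D)"
proof -
  interpret fin_pmf ZK "Q \<theta>" by (rule Q_fin_pmf)
  define a where "a z = ip I D (tvec z)" for z
  define m where "m = EZ a"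
  have "0 \<le> EZ (\<lambda>z. (a z - m)\<^sup>2)" by (intro sum_nonneg mult_nonneg_nonneg q_nonneg) auto
  also have "\<dots> = EZ (\<lambda>z. (a z)\<^sup>2) - 2 * m * EZ a + m\<^sup>2 * (\<Sum>z\<in>ZK. Q \<theta> z)"
    by (simp add: power2_eq_square algebra_simps sum.distrib sum_subtractf sum_distrib_left)
  also have "\<dots> = EZ (\<lambda>z. (a z)\<^sup>2) - (EZ a)\<^sup>2"
    using q_sum by (simp add: m_def power2_eq_square)
  finally show ?thesis unfolding Imat_quadratic a_def .
qed

lemma ip_line: "ip I (\<lambda>L. c L + t * D L) v = ip I c v + t * ip I D v"
  by (rule ip_add_left)

text \<open>\<open>S j\<close> is the \<open>j\<close>-th derivative of the partition function along
  the line, so the first two derivatives of its logarithm are the mean and the variance of the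
  linear form.\<close>

lemma log_part_line:
  shows "((\<lambda>t. ln (part (\<lambda>L. c L + t * D L))) has_real_derivative
      (\<Sum>z\<in>ZK. Q (\<lambda>L. c L + t * D L) z * ip I D (tvec z))) (at t)" (is ?first)
    and "((\<lambda>t. \<Sum>z\<in>ZK. Q (\<lambda>L. c L + t * D L) z * ip I D (tvec z)) has_real_derivative
      ip I D (mv I (Imat K H (\<lambda>L. c L + t * D L)) D)) (at t)" (is ?second)
proof -
  define S where "S j t = (\<Sum>z\<in>ZK. (ip I D (tvec z)) ^ j * exp (ip I c (tvec z) + t * ip I D (tvec z)))" for j t
  have dS: "(S j has_real_derivative S (Suc j) t) (at t)" for j t
    unfolding S_def by (auto intro!: derivative_eq_intros sum.cong)
  have part: "part (\<lambda>L. c L + t * D L) = S 0 t" for t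
    by (simp add: part_def S_def ip_line)
  have S0: "0 < S 0 t" for t using part_pos part by metis
  have QS: "(\<Sum>z\<in>ZK. Q (\<lambda>L. c L + t * D L) z * (ip I D (tvec z)) ^ j) = S j t / S 0 t" for j t
    unfolding S_def[of j] sum_divide_distrib by (rule sum.cong) (simp_all add: Q_eq part ip_line)
  have m1: "(\<Sum>z\<in>ZK. Q (\<lambda>L. c L + t * D L) z * ip I D (tvec z)) = S 1 t / S 0 t" for t
    using QS[of t 1] by simp
  show ?first
    unfolding m1 part using S0 dS[of 0] by (auto intro!: derivative_eq_intros)
  have "((\<lambda>t. S 1 t / S 0 t) has_real_derivative (S 2 t * S 0 t - S 1 t * S 1 t) / (S 0 t * S 0 t)) (at t)"
    using DERIV_divide[OF dS[of 1 t] dS[of 0 t]] S0[of t] by (simp add: numeral_2_eq_2)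
  also have "(S 2 t * S 0 t - S 1 t * S 1 t) / (S 0 t * S 0 t) = ip I D (mv I (Imat K H (\<lambda>L. c L + t * D L)) D)"
    unfolding Imat_quadratic QS m1 using S0[of t] by (simp add: power2_eq_square diff_divide_distrib)
  finally show ?second unfolding m1 .
qed

lemma xi_le:
  assumes "\<theta> \<in> ball2 K H \<theta>s \<epsilon>"
  shows "xi K H \<theta>s \<epsilon> * ip I D D \<le> ip I D (mv I (Imat K H \<theta>) D)"
  unfolding xi_def
  by (rule INF_lambda_min_le[OF I_fin I_ne Imat_sym Imat_psd assms])

definition unitvec :: "nat set \<Rightarrow> real" where "unitvec L = ind (L = {1})"

lemma ip_unitvec: "ip I unitvec v = v {1}"
  using one_in_I I_fin by (simp add: ip_def unitvec_def ind_def if_distrib[of "\<lambda>x. x * _"] cong: if_cong)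

lemma center_in_ball: "\<theta>s \<in> Theta K H \<Longrightarrow> 0 \<le> \<epsilon> \<Longrightarrow> \<theta>s \<in> ball2 K H \<theta>s \<epsilon>"
  by (simp add: ball2_def norm2_def)

text \<open>Tested in the direction of the statistic \<open>{1}\<close>, the quadratic form is a
  Bernoulli variance. The bound later turns a small radius into a small \<tau>.\<close>

lemma xi_le_quarter:
  assumes "\<theta>s \<in> Theta K H" "0 \<le> \<epsilon>"
  shows "xi K H \<theta>s \<epsilon> \<le> 1 / 4"
proof -
  define m where "m = (\<Sum>z\<in>ZK. Q \<theta>s z * tvec z {1})"
  have "xi K H \<theta>s \<epsilon> * ip I unitvec unitvec \<le> ip I unitvec (mv I (Imat K H \<theta>s) unitvec)"
    by (rule xi_le[OF center_in_ball[OF assms]])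
  also have "\<dots> = m - m\<^sup>2"
    unfolding Imat_quadratic ip_unitvec by (simp add: m_def power2_eq_square tvec_01)
  also have "\<dots> \<le> 1 / 4"
    using zero_le_power2[of "m - 1 / 2"] by (simp add: power2_eq_square algebra_simps)
  finally show ?thesis by (simp add: ip_unitvec) (simp add: unitvec_def ind_def)
qed

lemma score_mgf:
  "(\<Sum>z\<in>ZK. Q \<theta> z * exp (l * ((\<Sum>z\<in>ZK. Q \<theta> z * tvec z L) - tvec z L))) \<le> exp (l\<^sup>2 * 1\<^sup>2 / 8)"
proof -
  interpret fin_pmf ZK "Q \<theta>" by (rule Q_fin_pmf)
  define m where "m = EZ (\<lambda>z. tvec z L)"
  \<comment> \<open>As \<open>tvec\<close> takes only the values 0 and 1, the exponential is an
    affine function of it.\<close>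
  have "EZ (\<lambda>z. exp (l * (m - tvec z L))) = EZ (\<lambda>z. exp (l * m) + tvec z L * (exp (- l * (1 - m)) - exp (l * m)))"
    by (rule sum.cong) (auto simp: tvec_def ind_def algebra_simps)
  also have "\<dots> = exp (l * m) * (\<Sum>z\<in>ZK. Q \<theta> z) + m * (exp (- l * (1 - m)) - exp (l * m))"
    by (simp add: distrib_left sum.distrib m_def sum_distrib_left sum_distrib_right mult_ac)
  also have "\<dots> = m * exp (- l * (1 - m)) + (1 - m) * exp (- l * (- m))"
    unfolding q_sum by (simp add: algebra_simps)
  also have "\<dots> \<le> exp ((- l)\<^sup>2 / 8)"
    by (rule Bernoulli_mgf) (use Q_mean_bounds[of \<theta> L] in \<open>auto simp: m_def\<close>)
  finally show ?thesis by (simp add: m_def)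
qed

subsection \<open>Pseudolikelihood\<close>

definition npl :: "(nat set \<Rightarrow> real) \<Rightarrow> (nat \<Rightarrow> bool) \<Rightarrow> real" where
  "npl \<theta> z = - (\<Sum>k\<in>{1..K}. ln (Qcond K H \<theta> z k))"

text \<open>Only \<open>z\<close> and \<open>flip k z\<close> agree with \<open>z\<close> off layer
  \<open>k\<close>, so the conditional law is logistic. It is degenerate when the flip leaves
  \<open>ZK\<close>, as when \<open>k\<close> is the only active layer.\<close>

lemma Qcond_eq:
  assumes z: "z \<in> ZK"
  shows "Qcond K H \<theta> z k = (if flip k z \<in> ZK then 1 / (1 + exp (- ip I \<theta> (wvec K k z))) else 1)"
proof -
  have "(\<Sum>z'\<in>ZK. ind (\<forall>j. j \<noteq> k \<longrightarrow> z' j = z j) * Q \<theta> z') = (\<Sum>z'\<in>ZK \<inter> {z, flip k z}. Q \<theta> z')"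
    unfolding agree_off_iff by (rule sum.mono_neutral_cong_right) (auto simp: finite_Zset ind_def)
  also have "\<dots> = Q \<theta> z + (if flip k z \<in> ZK then Q \<theta> (flip k z) else 0)"
    using z flip_neq[of k z] by (auto simp: Int_insert_right)
  finally have den: "(\<Sum>z'\<in>ZK. ind (\<forall>j. j \<noteq> k \<longrightarrow> z' j = z j) * Q \<theta> z') = \<dots>" .
  show ?thesis
  proof (cases "flip k z \<in> ZK")
    case True
    have w: "ip I \<theta> (wvec K k z) = ip I \<theta> (tvec z) - ip I \<theta> (tvec (flip k z))"
      using True by (simp add: ip_def wvec_def right_diff_distrib sum_subtractf)
    have "Q \<theta> (flip k z) = Q \<theta> z * exp (- ip I \<theta> (wvec K k z))"
      unfolding w using z True by (simp add: Q_eq flip: exp_add)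
    then have "Q \<theta> z + Q \<theta> (flip k z) = Q \<theta> z * (1 + exp (- ip I \<theta> (wvec K k z)))"
      by (simp add: distrib_left)
    then show ?thesis
      unfolding Qcond_def den using True Q_pos[OF z, of \<theta>] by simp
  next
    case False
    then show ?thesis unfolding Qcond_def den using Q_pos[OF z, of \<theta>] by simp
  qed
qed

text \<open>In the degenerate case \<open>wvec\<close> is zero and \<open>softplus 0 = ln 2\<close>,
  which the added \<open>ln 2\<close> cancels. One formula thus serves all layers, and the
  correction does not depend on the parameter.\<close>

lemma ln_Qcond:
  assumes "z \<in> ZK"
  shows "ln (Qcond K H \<theta> z k) = (if flip k z \<in> ZK then 0 else ln 2) - softplus (- ip I \<theta> (wvec K k z))"
  unfolding Qcond_eq[OF assms]
  by (auto simp: softplus_def ln_div add_pos_pos wvec_def ip_def)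

definition npl_const :: "(nat \<Rightarrow> bool) \<Rightarrow> real" where
  "npl_const z = (\<Sum>k\<in>{1..K}. if flip k z \<in> ZK then 0 else ln 2)"

lemma npl_eq:
  "z \<in> ZK \<Longrightarrow> npl \<theta> z = (\<Sum>k\<in>{1..K}. softplus (- ip I \<theta> (wvec K k z))) - npl_const z"
  by (simp add: npl_def ln_Qcond npl_const_def sum_subtractf)

lemma partial2_npl:
  assumes z: "z \<in> ZK" and L: "L \<in> I" "L' \<in> I"
  shows "partial2 (\<lambda>\<eta>. \<Sum>k\<in>{1..K}. ln (Qcond K H \<eta> z k)) \<theta> L L'
    = - (\<Sum>k\<in>{1..K}. sigmoid (- ip I \<theta> (wvec K k z)) * (1 - sigmoid (- ip I \<theta> (wvec K k z))) * wvec K k z L * wvec K k z L')"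
proof -
  define b where "b k = ip I \<theta> (wvec K k z)" for k
  have F: "(\<Sum>k\<in>{1..K}. ln (Qcond K H (\<lambda>M. \<theta> M + t * ind (M = L) + s * ind (M = L')) z k))
      = npl_const z - (\<Sum>k\<in>{1..K}. softplus (- (b k + t * wvec K k z L + s * wvec K k z L')))" for t s
  proof -
    have e: "ip I (\<lambda>M. ind (M = L)) v = v L" if "L \<in> I" for v L
      using that I_fin by (simp add: ip_def ind_def if_distrib[of "\<lambda>x. x * _"] cong: if_cong)
    show ?thesis
      unfolding ln_Qcond[OF z] ip_add_left e[OF L(1)] e[OF L(2)]
      by (simp add: npl_const_def b_def sum_subtractf)
  qed
  have d1: "deriv (\<lambda>t. npl_const z - (\<Sum>k\<in>{1..K}. softplus (- (b k + t * wvec K k z L + s * wvec K k z L')))) 0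
      = (\<Sum>k\<in>{1..K}. sigmoid (- (b k + s * wvec K k z L')) * wvec K k z L)" for s
    by (rule DERIV_imp_deriv) (auto intro!: derivative_eq_intros simp: sum_negf)
  show ?thesis
    unfolding partial2_def F d1
    by (rule DERIV_imp_deriv) (auto intro!: derivative_eq_intros sum.cong simp: b_def sum_negf[symmetric])
qed

definition curv :: "(nat set \<Rightarrow> real) \<Rightarrow> (nat \<Rightarrow> bool) \<Rightarrow> nat \<Rightarrow> real" where
  "curv \<theta> z k = sigmoid (- ip I \<theta> (wvec K k z)) * (1 - sigmoid (- ip I \<theta> (wvec K k z)))"

text \<open>In this form, a nonnegatively weighted sum of rank-one matrices over pairs of
  configuration and layer, symmetry, semidefiniteness and the quadratic form can be read
  off.\<close>

lemma Itil_eq: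
  assumes "L \<in> I" "L' \<in> I"
  shows "Itil K H \<theta>s \<theta> L L' = (\<Sum>x\<in>ZK \<times> {1..K}. Q \<theta>s (fst x) * curv \<theta> (fst x) (snd x)
      * wvec K (snd x) (fst x) L * wvec K (snd x) (fst x) L')"
proof -
  have "Itil K H \<theta>s \<theta> L L' = (\<Sum>z\<in>ZK. \<Sum>k\<in>{1..K}. Q \<theta>s z * curv \<theta> z k * wvec K k z L * wvec K k z L')"
    unfolding Itil_def
  proof (rule sum.cong[OF refl])
    fix z assume "z \<in> ZK"
    then have "- partial2 (\<lambda>\<eta>. \<Sum>k\<in>{1..K}. ln (Qcond K H \<eta> z k)) \<theta> L L'
        = (\<Sum>k\<in>{1..K}. curv \<theta> z k * wvec K k z L * wvec K k z L')"
      by (simp only: partial2_npl[OF _ assms] curv_def minus_minus)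
    then show "Q \<theta>s z * - partial2 (\<lambda>\<eta>. \<Sum>k\<in>{1..K}. ln (Qcond K H \<eta> z k)) \<theta> L L'
        = (\<Sum>k\<in>{1..K}. Q \<theta>s z * curv \<theta> z k * wvec K k z L * wvec K k z L')"
      by (simp only: sum_distrib_left mult.assoc)
  qed
  then show ?thesis by (simp add: sum.cartesian_product case_prod_unfold)
qed

lemma Itil_quadratic:
  "ip I D (mv I (Itil K H \<theta>s \<theta>) D)
    = (\<Sum>z\<in>ZK. Q \<theta>s z * (\<Sum>k\<in>{1..K}. curv \<theta> z k * (ip I D (wvec K k z))\<^sup>2))"
proof -
  have "ip I D (mv I (Itil K H \<theta>s \<theta>) D)
    = (\<Sum>x\<in>ZK \<times> {1..K}. (Q \<theta>s (fst x) * curv \<theta> (fst x) (snd x)) * (ip I D (wvec K (snd x) (fst x)))\<^sup>2)"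
    by (rule ip_mv_rank_one_sum) (rule Itil_eq)
  then show ?thesis by (simp add: sum.cartesian_product case_prod_unfold sum_distrib_left mult_ac)
qed

lemma Itil_sym: "L \<in> I \<Longrightarrow> L' \<in> I \<Longrightarrow> Itil K H \<theta>s \<theta> L L' = Itil K H \<theta>s \<theta> L' L"
  by (simp add: Itil_eq mult_ac)

lemma curv_nonneg: "0 \<le> curv \<theta> z k"
  unfolding curv_def by (rule sigmoid_prime_bounds)

lemma Itil_psd: "0 \<le> ip I D (mv I (Itil K H \<theta>s \<theta>) D)"
  unfolding Itil_quadratic
  by (intro sum_nonneg mult_nonneg_nonneg curv_nonneg zero_le_power2 less_imp_le[OF Q_pos])

lemma xitil_le:
  assumes "\<theta> \<in> ball2 K H \<theta>s \<epsilon>"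
  shows "xitil K H \<theta>s \<epsilon> * ip I D D \<le> ip I D (mv I (Itil K H \<theta>s \<theta>) D)"
  unfolding xitil_def
  by (rule INF_lambda_min_le[OF I_fin I_ne Itil_sym Itil_psd assms])

text \<open>In the direction of \<open>{1}\<close> only layer 1 has a nonzero \<open>wvec\<close>,
  and its curvature is at most 1/4.\<close>

lemma xitil_le_quarter:
  assumes "\<theta>s \<in> Theta K H" "0 \<le> \<epsilon>"
  shows "xitil K H \<theta>s \<epsilon> \<le> 1 / 4"
proof -
  interpret fin_pmf ZK "Q \<theta>s" by (rule Q_fin_pmf)
  have "xitil K H \<theta>s \<epsilon> * ip I unitvec unitvec \<le> ip I unitvec (mv I (Itil K H \<theta>s \<theta>s) unitvec)"
    by (rule xitil_le[OF center_in_ball[OF assms]])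
  also have "\<dots> = EZ (\<lambda>z. \<Sum>k\<in>{1..K}. curv \<theta>s z k * (wvec K k z {1})\<^sup>2)"
    unfolding Itil_quadratic ip_unitvec ..
  also have "\<dots> \<le> EZ (\<lambda>z. \<Sum>k\<in>{1..K}. if k = 1 then 1 / 4 else 0)"
  proof (intro EZ_mono sum_mono)
    fix z k
    have "(wvec K k z {1})\<^sup>2 \<le> 1" using wvec_abs_le[of K k z "{1}"] by (simp add: abs_square_le_1)
    then have "curv \<theta>s z k * (wvec K k z {1})\<^sup>2 \<le> 1 / 4 * 1"
      using sigmoid_prime_bounds[of "- ip I \<theta>s (wvec K k z)"] by (intro mult_mono) (auto simp: curv_def)
    then show "curv \<theta>s z k * (wvec K k z {1})\<^sup>2 \<le> (if k = 1 then 1 / 4 else 0)"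
      by (auto simp: wvec_notin)
  qed
  also have "\<dots> = 1 / 4" using K q_sum by (simp add: sum_divide_distrib[symmetric])
  finally show ?thesis by (simp add: ip_unitvec) (simp add: unitvec_def ind_def)
qed

text \<open>Coordinate \<open>L\<close> of the gradient of
  \<open>softplus (- ip I \<theta> (wvec K k z))\<close>.\<close>

definition pscore :: "(nat set \<Rightarrow> real) \<Rightarrow> nat \<Rightarrow> (nat \<Rightarrow> bool) \<Rightarrow> nat set \<Rightarrow> real" where
  "pscore \<theta> k z L = - sigmoid (- ip I \<theta> (wvec K k z)) * wvec K k z L"

text \<open>On a pair \<open>z\<close>, \<open>flip k z\<close> with weights \<open>a\<close>,
  \<open>b\<close> the score takes the values \<open>- w * b / (a + b)\<close> and
  \<open>w * a / (a + b)\<close>: it is a centred two-point variable scaled by \<open>w\<close> with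
  \<open>\<bar>w\<bar> \<le> 1\<close>. Configurations whose flip leaves \<open>ZK\<close> have
  score 0.\<close>

lemma pscore_mgf_single:
  "(\<Sum>z\<in>ZK. Q \<theta> z * exp (l * pscore \<theta> k z L)) \<le> exp (l\<^sup>2 / 8)"
proof -
  interpret fin_pmf ZK "Q \<theta>" by (rule Q_fin_pmf)
  define Zp where "Zp = {z \<in> ZK. flip k z \<in> ZK}"
  define h where "h z = Q \<theta> z * exp (l * pscore \<theta> k z L)" for z
  define e where "e = exp (l\<^sup>2 / 8)"
  have e1: "1 \<le> e" by (simp add: e_def)
  have reindex: "sum f Zp = (\<Sum>z\<in>Zp. f (flip k z))" for f :: "(nat \<Rightarrow> bool) \<Rightarrow> real"
    by (rule sum.reindex_bij_witness[of _ "flip k" "flip k"]) (auto simp: Zp_def)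
  have pair: "h z + h (flip k z) \<le> (Q \<theta> z + Q \<theta> (flip k z)) * e" if zp: "z \<in> Zp" for z
  proof -
    define a where "a = Q \<theta> z"
    define b where "b = Q \<theta> (flip k z)"
    define w where "w = wvec K k z L"
    have z: "z \<in> ZK" "flip k z \<in> ZK" using zp by (auto simp: Zp_def)
    have ab: "0 < a" "0 < b" using Q_pos z by (auto simp: a_def b_def)
    have ipw: "ip I \<theta> (wvec K k z) = ip I \<theta> (tvec z) - ip I \<theta> (tvec (flip k z))"
      using z by (simp add: ip_def wvec_def right_diff_distrib sum_subtractf)
    have ipf: "ip I \<theta> (wvec K k (flip k z)) = - ip I \<theta> (wvec K k z)"
      using z by (simp add: ip_def wvec_flip sum_negf)
    have ba: "b = a * exp (- ip I \<theta> (wvec K k z))"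
      unfolding ipw a_def b_def using z by (simp add: Q_eq flip: exp_add)
    have s1: "sigmoid (- ip I \<theta> (wvec K k z)) = b / (a + b)"
    proof -
      have "a + b = a * (1 + exp (- ip I \<theta> (wvec K k z)))" by (simp add: ba distrib_left)
      then show ?thesis unfolding sigmoid_def using ab by (simp add: ba)
    qed
    have s2: "sigmoid (ip I \<theta> (wvec K k z)) = a / (a + b)"
    proof -
      have ab': "a = b * exp (ip I \<theta> (wvec K k z))" by (simp add: ba exp_minus)
      then have "a + b = b * (1 + exp (ip I \<theta> (wvec K k z)))" by (simp add: distrib_left)
      then show ?thesis unfolding sigmoid_def using ab by (simp add: ab')
    qed
    have "h z + h (flip k z) = a * exp (- l * w * (b / (a + b))) + b * exp (- l * w * (- a / (a + b)))"
      using z by (simp add: h_def pscore_def a_def[symmetric] b_def[symmetric] w_def[symmetric] wvec_flip ipf s1 s2 mult_ac)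
    also have "\<dots> \<le> (a + b) * exp ((- l * w)\<^sup>2 / 8)"
      by (rule Bernoulli_mgf_weights) (use ab in auto)
    also have "\<dots> \<le> (a + b) * e"
    proof -
      have "w\<^sup>2 \<le> 1" using wvec_abs_le[of K k z L] by (simp add: w_def abs_square_le_1)
      then have "l\<^sup>2 * w\<^sup>2 \<le> l\<^sup>2 * 1" by (intro mult_left_mono) auto
      then show ?thesis using ab by (intro mult_left_mono) (auto simp: e_def power_mult_distrib)
    qed
    finally show ?thesis by (simp add: a_def b_def)
  qed
  \<comment> \<open>\<open>flip k\<close> is an involution of \<open>Zp\<close>, so summing over
    pairs counts every configuration twice.\<close>
  have "2 * sum h Zp = (\<Sum>z\<in>Zp. h z + h (flip k z))"
    using reindex[of h] by (simp add: sum.distrib)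
  also have "\<dots> \<le> (\<Sum>z\<in>Zp. (Q \<theta> z + Q \<theta> (flip k z)) * e)" by (rule sum_mono) (rule pair)
  also have "\<dots> = 2 * (sum (Q \<theta>) Zp * e)"
    using reindex[of "Q \<theta>"] by (simp add: sum_distrib_right[symmetric] sum.distrib)
  finally have Zp: "sum h Zp \<le> sum (Q \<theta>) Zp * e" by simp
  have "sum h (ZK - Zp) = sum (Q \<theta>) (ZK - Zp) * 1"
    by (simp, rule sum.cong) (auto simp: h_def pscore_def wvec_def Zp_def)
  also have "\<dots> \<le> sum (Q \<theta>) (ZK - Zp) * e"
    by (intro mult_left_mono e1 sum_nonneg q_nonneg) auto
  finally have "sum h (ZK - Zp) + sum h Zp \<le> (sum (Q \<theta>) (ZK - Zp) + sum (Q \<theta>) Zp) * e"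
    using Zp by (simp add: distrib_right)
  also have "sum (Q \<theta>) (ZK - Zp) + sum (Q \<theta>) Zp = 1"
    using sum.subset_diff[of Zp ZK "Q \<theta>"] q_sum finite_Zset by (auto simp: Zp_def)
  also have "sum h (ZK - Zp) + sum h Zp = sum h ZK"
    using sum.subset_diff[of Zp ZK h] finite_Zset by (auto simp: Zp_def)
  finally show ?thesis by (simp add: h_def e_def)
qed

text \<open>The layers of a dyad are dependent, so Jensen's inequality replaces factorization. This
  costs the factor \<open>K^2\<close> in the exponent, which reappears in the pseudolikelihood
  radius.\<close>

lemma pscore_mgf:
  "(\<Sum>z\<in>ZK. Q \<theta> z * exp (l * (\<Sum>k\<in>{1..K}. pscore \<theta> k z L))) \<le> exp (l\<^sup>2 * (real K)\<^sup>2 / 8)"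
proof -
  interpret fin_pmf ZK "Q \<theta>" by (rule Q_fin_pmf)
  have Kne: "{1..K} \<noteq> {}" "0 < real K" using K by auto
  have "EZ (\<lambda>z. exp (l * (\<Sum>k\<in>{1..K}. pscore \<theta> k z L)))
      \<le> EZ (\<lambda>z. \<Sum>k\<in>{1..K}. 1 / real K * exp (real K * l * pscore \<theta> k z L))"
    using exp_jensen[OF finite_atLeastAtMost Kne(1), of "\<lambda>k. l * pscore \<theta> k _ L"]
    by (intro EZ_mono) (simp add: sum_distrib_left mult_ac)
  also have "\<dots> = (\<Sum>k\<in>{1..K}. 1 / real K * EZ (\<lambda>z. exp (real K * l * pscore \<theta> k z L)))"
    unfolding sum_distrib_left by (subst sum.swap) (simp add: mult_ac)
  also have "\<dots> \<le> (\<Sum>k\<in>{1..K}. 1 / real K * exp ((real K * l)\<^sup>2 / 8))"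
    by (intro sum_mono mult_left_mono pscore_mgf_single) simp
  also have "\<dots> = exp (l\<^sup>2 * (real K)\<^sup>2 / 8)"
    using Kne by (simp add: power_mult_distrib mult.commute)
  finally show ?thesis .
qed

end

lemma convex_on_sum_list:
  assumes "\<And>z. z \<in> set zs \<Longrightarrow> convex_on UNIV (\<lambda>t. f z (t::real))"
  shows "convex_on UNIV (\<lambda>t. \<Sum>z\<leftarrow>zs. f z t)"
  using assms
proof (induction zs)
  case Nil
  show ?case by (simp add: convex_on_def)
qed (auto intro!: convex_on_add)

lemma continuous_on_sum_list:
  fixes f :: "'z \<Rightarrow> 'a::topological_space \<Rightarrow> real"
  assumes "\<And>z. z \<in> set zs \<Longrightarrow> continuous_on S (f z)"
  shows "continuous_on S (\<lambda>x. \<Sum>z\<leftarrow>zs. f z x)"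
  using assms by (induction zs) (auto intro!: continuous_intros)

lemma argmax_Theta_cong:
  assumes "\<And>\<theta>. \<theta> \<in> Theta K H \<Longrightarrow> F \<theta> = a - G \<theta>"
  shows "argmax_Theta K H F = {\<theta> \<in> supp_on (Lfam K H). \<forall>\<theta>'\<in>supp_on (Lfam K H). G \<theta> \<le> G \<theta>'}"
  using assms by (auto simp: argmax_Theta_def Theta_eq_supp_on)

section \<open>Radius comparison and minimizers for the two single-dyad losses\<close>

context dyad_model
begin

lemma card_I_pos: "0 < real (card I)"
  using I_fin I_ne by (simp add: card_gt_0_iff)

lemma line_in_ball:
  assumes "\<theta>s \<in> Theta K H" "D \<in> supp_on I" "nrm I D \<le> \<epsilon>" "0 \<le> t" "t \<le> 1"
  shows "(\<lambda>L. \<theta>s L + t * D L) \<in> ball2 K H \<theta>s \<epsilon>"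
proof -
  have "t * nrm I D \<le> 1 * nrm I D" using assms nrm_nonneg[of I D] by (intro mult_right_mono) auto
  then show ?thesis using assms
    by (auto simp: ball2_def norm2_eq_nrm nrm_scale Theta_def supp_on_def)
qed

lemma log_part_gap:
  assumes ball: "\<And>t. 0 \<le> t \<Longrightarrow> t \<le> 1 \<Longrightarrow> (\<lambda>L. c L + t * D L) \<in> ball2 K H \<theta>s \<epsilon>"
    and xi: "0 \<le> xi K H \<theta>s \<epsilon>" and s: "0 < s" "s < 1"
  shows "s * (1 - s) * (xi K H \<theta>s \<epsilon> * ip I D D)
    \<le> ln (part (\<lambda>L. c L + D L)) - ln (part (\<lambda>L. c L + (1 - s) * D L)) - s * (\<Sum>z\<in>ZK. Q c z * ip I D (tvec z))"
  using second_order_gap[OF log_part_line[of c D], of "xi K H \<theta>s \<epsilon> * ip I D D" s]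
    xi_le[OF ball] xi s ip_nonneg[of I D] by simp

text \<open>The loss is the log-partition function minus a linear form, and the data-dependent
  linear parts cancel in \<open>R\<close>, leaving a deterministic remainder. The balance 9/10 stays
  below \<open>1 - s = 19/20\<close>, so only the score can fail.\<close>

lemma nll_localization:
  assumes \<theta>s: "\<theta>s \<in> Theta K H" and xi: "0 < xi K H \<theta>s \<epsilon>" and \<delta>: "0 < \<delta>" "\<delta> \<le> \<epsilon>"
    and n: "0 < n" and u: "0 < u"
    and bal: "sqrt (card I) * u \<le> 9 / 10 * n * (xi K H \<theta>s \<epsilon> * \<delta>)"
  shows "EL ZK (Q \<theta>s) n (\<lambda>zs. ind (\<exists>D\<in>supp_on I. nrm I D = \<delta> \<and>
        \<not> (\<Sum>z\<leftarrow>zs. nll (\<lambda>L. \<theta>s L + (1 - 1 / 20) * D L) z) < (\<Sum>z\<leftarrow>zs. nll (\<lambda>L. \<theta>s L + D L) z)))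
    \<le> 2 * real (card I) * exp (- 2 * u\<^sup>2 / n)"
proof -
  interpret fin_pmf ZK "Q \<theta>s" by (rule Q_fin_pmf)
  define s :: real where "s = 1 / 20"
  have s: "0 < s" "s < 1" by (auto simp: s_def)
  define m where "m L = EZ (\<lambda>z. tvec z L)" for L
  define G where "G z L = m L - tvec z L" for z L
  define R where "R D z = nll (\<lambda>L. \<theta>s L + D L) z - nll (\<lambda>L. \<theta>s L + (1 - s) * D L) z - s * ip I D (G z)" for D z
  have R: "s * (1 - s) * (xi K H \<theta>s \<epsilon> * \<delta>\<^sup>2) \<le> R D z"
    if D: "D \<in> supp_on I" "nrm I D = \<delta>" and z: "z \<in> ZK" for D z
  proof -
    have ipm: "ip I D m = EZ (\<lambda>z. ip I D (tvec z))"
      unfolding ip_def m_def sum_distrib_left by (subst sum.swap) (simp add: mult_ac)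
    have e1: "ip I (\<lambda>L. \<theta>s L + D L) (tvec z) = ip I \<theta>s (tvec z) + ip I D (tvec z)"
      using ip_add_left[of I \<theta>s 1 D "tvec z"] by simp
    have ipG: "ip I D (G z) = ip I D m - ip I D (tvec z)"
      by (simp add: ip_def G_def right_diff_distrib sum_subtractf)
    have "R D z = ln (part (\<lambda>L. \<theta>s L + D L)) - ln (part (\<lambda>L. \<theta>s L + (1 - s) * D L)) - s * ip I D m"
      unfolding R_def nll_eq[OF z] e1 ip_add_left ipG by (simp add: algebra_simps)
    moreover have "s * (1 - s) * (xi K H \<theta>s \<epsilon> * ip I D D) \<le> \<dots>"
      unfolding ipm by (rule log_part_gap[OF line_in_ball[OF \<theta>s D(1)] less_imp_le[OF xi] s]) (use D \<delta> in auto)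
    ultimately show ?thesis using D(2) nrm_sq[of I D] by simp
  qed
  have zero: "EL ZK (Q \<theta>s) n (\<lambda>zs. ind (\<exists>D\<in>{D\<in>supp_on I. nrm I D = \<delta>}. (\<Sum>z\<leftarrow>zs. R D z) < s * sqrt (card I) * u * \<delta>))
      \<le> EL ZK (Q \<theta>s) n (\<lambda>zs. 0)"
  proof (rule EL_mono)
    fix zs assume zs: "zs \<in> lists_n ZK n"
    have "s * sqrt (card I) * u * \<delta> \<le> (\<Sum>z\<leftarrow>zs. R D z)" if D: "D \<in> supp_on I" "nrm I D = \<delta>" for D
    proof -
      have "s * \<delta> * (sqrt (card I) * u) \<le> s * \<delta> * (9 / 10 * n * (xi K H \<theta>s \<epsilon> * \<delta>))"
        using s \<delta> bal by (intro mult_left_mono) auto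
      also have "\<dots> \<le> n * (s * (1 - s) * (xi K H \<theta>s \<epsilon> * \<delta>\<^sup>2))"
        using xi \<delta> by (simp add: s_def power2_eq_square)
      also have "\<dots> = (\<Sum>z\<leftarrow>zs. s * (1 - s) * (xi K H \<theta>s \<epsilon> * \<delta>\<^sup>2))"
        using zs by (simp add: sum_list_triv lists_n_def)
      also have "\<dots> \<le> (\<Sum>z\<leftarrow>zs. R D z)"
        by (rule sum_list_mono) (use zs R[OF D] in \<open>auto simp: lists_n_def\<close>)
      finally show ?thesis by (simp add: mult_ac)
    qed
    then show "ind (\<exists>D\<in>{D\<in>supp_on I. nrm I D = \<delta>}. (\<Sum>z\<leftarrow>zs. R D z) < s * sqrt (card I) * u * \<delta>) \<le> 0"
      by (auto simp: ind_def not_less)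
  qed
  have "EL ZK (Q \<theta>s) n (\<lambda>zs. ind (\<exists>D\<in>supp_on I. nrm I D = \<delta> \<and>
        \<not> (\<Sum>z\<leftarrow>zs. nll (\<lambda>L. \<theta>s L + (1 - s) * D L) z) < (\<Sum>z\<leftarrow>zs. nll (\<lambda>L. \<theta>s L + D L) z)))
    \<le> 2 * real (card I) * exp (- 2 * u\<^sup>2 / (real n * 1\<^sup>2))
      + EL ZK (Q \<theta>s) n (\<lambda>zs. ind (\<exists>D\<in>{D\<in>supp_on I. nrm I D = \<delta>}. (\<Sum>z\<leftarrow>zs. R D z) < s * sqrt (card I) * u * \<delta>))"
    unfolding R_def
    by (rule sphere_condition_prob[OF I_fin I_ne _ u _ n \<delta>(1) s(1)])
      (use score_mgf[of \<theta>s] in \<open>auto simp: G_def m_def\<close>)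
  with zero show ?thesis by (simp add: s_def)
qed

text \<open>\<open>second_order_gap\<close> is applied to the expected loss along the line. Its
  second derivative is the quadratic form of \<open>Itil\<close>, with the expectation fixed at the
  true parameter and the curvature taken at the moving point.\<close>

lemma npl_gap:
  assumes \<theta>s: "\<theta>s \<in> Theta K H" and xi: "0 \<le> xitil K H \<theta>s \<epsilon>"
    and D: "D \<in> supp_on I" "nrm I D \<le> \<epsilon>" and s: "0 < s" "s < 1"
  shows "s * (1 - s) * (xitil K H \<theta>s \<epsilon> * ip I D D)
    \<le> (\<Sum>z\<in>ZK. Q \<theta>s z * (\<Sum>k\<in>{1..K}. bregman s (ip I \<theta>s (wvec K k z)) (ip I D (wvec K k z))))"
proof -
  define b where "b z k = ip I \<theta>s (wvec K k z)" for z k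
  define a where "a z k = ip I D (wvec K k z)" for z k
  define g where "g t = (\<Sum>z\<in>ZK. Q \<theta>s z * (\<Sum>k\<in>{1..K}. softplus (- b z k - t * a z k)))" for t
  define g' where "g' t = (\<Sum>z\<in>ZK. Q \<theta>s z * (\<Sum>k\<in>{1..K}. sigmoid (- b z k - t * a z k) * (- a z k)))" for t
  define g'' where "g'' t = (\<Sum>z\<in>ZK. Q \<theta>s z * (\<Sum>k\<in>{1..K}.
      sigmoid (- b z k - t * a z k) * (1 - sigmoid (- b z k - t * a z k)) * (- a z k) * (- a z k)))" for t
  have d: "(g has_real_derivative g' t) (at t)" for t
    unfolding g_def g'_def by (auto intro!: derivative_eq_intros sum.cong)
  have d': "(g' has_real_derivative g'' t) (at t)" for t
    unfolding g'_def g''_def by (auto intro!: derivative_eq_intros sum.cong)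
  have "xitil K H \<theta>s \<epsilon> * ip I D D \<le> g'' t" if "0 \<le> t" "t \<le> 1" for t
  proof -
    have "g'' t = ip I D (mv I (Itil K H \<theta>s (\<lambda>L. \<theta>s L + t * D L)) D)"
      unfolding Itil_quadratic g''_def curv_def ip_add_left a_def b_def
      by (simp add: power2_eq_square mult_ac)
    then show ?thesis using xitil_le[OF line_in_ball[OF \<theta>s D that]] by simp
  qed
  then have "s * (1 - s) * (xitil K H \<theta>s \<epsilon> * ip I D D) \<le> g 1 - g (1 - s) - s * g' 0"
    by (intro second_order_gap[OF d d']) (use s mult_nonneg_nonneg[OF xi ip_nonneg[of I D]] in auto)
  also have "\<dots> = (\<Sum>z\<in>ZK. Q \<theta>s z * (\<Sum>k\<in>{1..K}. bregman s (b z k) (a z k)))"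
    unfolding g_def g'_def bregman_def
    by (simp add: sum_subtractf sum.distrib sum_negf sum_distrib_left distrib_left right_diff_distrib mult_ac)
  finally show ?thesis by (simp add: a_def b_def)
qed

lemma ip_wvec_le: "ip I (wvec K k z) (wvec K k z) \<le> card I"
proof -
  have "ip I (wvec K k z) (wvec K k z) \<le> (\<Sum>L\<in>I. 1)"
    unfolding ip_def
  proof (rule sum_mono)
    fix L
    show "wvec K k z L * wvec K k z L \<le> 1"
      using wvec_abs_le[of K k z L] by (simp add: abs_square_le_1 flip: power2_eq_square)
  qed
  then show ?thesis by simp
qed

text \<open>With \<open>X = xitil K H \<theta>s \<epsilon> * \<delta>\<close>, the drift is
  \<open>s * (19/20) * n * X * \<delta>\<close> and the score costs at most
  \<open>s * (9/10) * n * X * \<delta>\<close>. Of the slack \<open>n * X * \<delta> / 400\<close>,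
  one half absorbs the expected deviation, by \<open>large\<close>, and the other half is the
  fluctuation level \<open>x\<close>.\<close>

lemma npl_localization:
  assumes \<theta>s: "\<theta>s \<in> Theta K H" and xi: "0 < xitil K H \<theta>s \<epsilon>" and \<delta>: "0 < \<delta>" "\<delta> \<le> \<epsilon>"
    and n: "0 < n" and u: "0 < u"
    and bal: "sqrt (card I) * u \<le> 9 / 10 * n * (xitil K H \<theta>s \<epsilon> * \<delta>)"
    and large: "2 * K * sqrt (n * card I) \<le> n * (xitil K H \<theta>s \<epsilon> * \<delta>) / 800"
  shows "EL ZK (Q \<theta>s) n (\<lambda>zs. ind (\<exists>D\<in>supp_on I. nrm I D = \<delta> \<and>
        \<not> (\<Sum>z\<leftarrow>zs. npl (\<lambda>L. \<theta>s L + (1 - 1 / 20) * D L) z) < (\<Sum>z\<leftarrow>zs. npl (\<lambda>L. \<theta>s L + D L) z)))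
    \<le> 2 * real (card I) * exp (- 2 * u\<^sup>2 / (n * (real K)\<^sup>2))
      + exp (- (n * (xitil K H \<theta>s \<epsilon> * \<delta>)) / (60800 * K * sqrt (card I)))"
proof -
  interpret fin_pmf ZK "Q \<theta>s" by (rule Q_fin_pmf)
  define s :: real where "s = 1 / 20"
  have s: "0 < s" "s < 1" by (auto simp: s_def)
  define X where "X = xitil K H \<theta>s \<epsilon> * \<delta>"
  have X: "0 < X" using xi \<delta> by (simp add: X_def)
  have Kpos: "0 < real K" using K by simp
  define p where "p = real (card I)"
  have p: "0 < p" using card_I_pos by (simp add: p_def)
  define T where "T = {D \<in> supp_on I. nrm I D = \<delta>}"
  define G where "G z L = (\<Sum>k\<in>{1..K}. pscore \<theta>s k z L)" for z L
  define R where "R D z = npl (\<lambda>L. \<theta>s L + D L) z - npl (\<lambda>L. \<theta>s L + (1 - s) * D L) z - s * ip I D (G z)" for D z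
  define B where "B D z = (\<Sum>k\<in>{1..K}. bregman s (ip I \<theta>s (wvec K k z)) (ip I D (wvec K k z)))" for D z
  define \<rho> where "\<rho> = s * (1 - s) * (X * \<delta>)"
  define U where "U = K * (\<delta> * sqrt p)"
  define x where "x = n * X * \<delta> / 800"
  have RB: "R D z = B D z" if z: "z \<in> ZK" for D z
  proof -
    have ipG: "ip I D (G z) = (\<Sum>k\<in>{1..K}. - sigmoid (- ip I \<theta>s (wvec K k z)) * ip I D (wvec K k z))"
      unfolding ip_def[of I D] G_def pscore_def sum_distrib_left by (subst sum.swap) (simp add: mult_ac)
    show ?thesis
      unfolding R_def B_def bregman_def npl_eq[OF z] ip_add_left ipG
      using ip_add_left[of I \<theta>s 1 D]
      by (simp add: sum_subtractf sum.distrib sum_negf sum_distrib_left mult_ac)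
  qed
  have tail: "EL ZK (Q \<theta>s) n (\<lambda>zs. ind (\<exists>D\<in>T. (\<Sum>z\<leftarrow>zs. B D z) < n * \<rho> - \<delta> * sqrt (n * (4 * (real (card {1..K}))\<^sup>2 * p)) - x))
      \<le> exp (- x\<^sup>2 / (2 * real n * U * \<rho>))"
  proof (rule uniform_lower_tail_infinite[where w = "wvec K" and I = I
        and r = "\<lambda>k z. bregman s (ip I \<theta>s (wvec K k z))"])
    show "ip I (wvec K k z) (wvec K k z) \<le> p" for k z unfolding p_def by (rule ip_wvec_le)
    show "B D z = (\<Sum>k\<in>{1..K}. bregman s (ip I \<theta>s (wvec K k z)) (ip I D (wvec K k z)))" for D z
      by (rule B_def)
    show "\<bar>bregman s b a - bregman s b a'\<bar> \<le> \<bar>a - a'\<bar>" for b a a' by (rule bregman_lipschitz[OF s])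
    show "0 \<le> B D z" for D z unfolding B_def by (intro sum_nonneg bregman_nonneg s)
    show "B D z \<le> U" if "D \<in> T" for D z
    proof -
      have "B D z \<le> (\<Sum>k\<in>{1..K}. \<delta> * sqrt p)"
        unfolding B_def
      proof (rule sum_mono)
        fix k
        have "bregman s (ip I \<theta>s (wvec K k z)) (ip I D (wvec K k z)) \<le> \<bar>ip I D (wvec K k z)\<bar>"
          using bregman_lipschitz[OF s, of "ip I \<theta>s (wvec K k z)" "ip I D (wvec K k z)" 0] by simp
        also have "\<dots> \<le> nrm I D * nrm I (wvec K k z)" by (rule Cauchy_Schwarz_ip)
        also have "\<dots> \<le> \<delta> * sqrt p"
          using that \<delta> ip_wvec_le[of k z] by (intro mult_mono) (auto simp: T_def nrm_def p_def ip_nonneg)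
        finally show "bregman s (ip I \<theta>s (wvec K k z)) (ip I D (wvec K k z)) \<le> \<dots>" .
      qed
      then show ?thesis by (simp add: U_def)
    qed
    show "\<rho> \<le> EZ (B D)" if D: "D \<in> T" for D
    proof -
      have "s * (1 - s) * (xitil K H \<theta>s \<epsilon> * ip I D D) \<le> EZ (B D)"
        unfolding B_def by (rule npl_gap[OF \<theta>s less_imp_le[OF xi] _ _ s]) (use D \<delta> in \<open>auto simp: T_def\<close>)
      moreover have "ip I D D = \<delta> * \<delta>" using D nrm_sq[of I D] by (simp add: T_def power2_eq_square)
      ultimately show ?thesis by (simp add: \<rho>_def X_def mult_ac)
    qed
    show "0 < \<rho>" using s X \<delta> by (simp add: \<rho>_def)
    show "0 \<le> x" using X \<delta> by (simp add: x_def)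
    show "0 < U" using Kpos \<delta> p by (simp add: U_def)
  qed (use n K \<delta> in \<open>auto simp: T_def\<close>)
  \<comment> \<open>60800 is 2 * 800^2 * 19/400, where 19/400 is \<open>s * (1 - s)\<close>.\<close>
  have expo: "- x\<^sup>2 / (2 * real n * U * \<rho>) = - (n * X) / (60800 * K * sqrt p)"
    using n X \<delta> Kpos p by (simp add: x_def U_def \<rho>_def s_def power2_eq_square field_simps)
  have thr: "s * sqrt (card I) * u * \<delta> \<le> n * \<rho> - \<delta> * sqrt (n * (4 * (real (card {1..K}))\<^sup>2 * p)) - x"
  proof -
    have "sqrt (n * (4 * (real (card {1..K}))\<^sup>2 * p)) = 2 * K * sqrt (n * p)"
    proof -
      have "n * (4 * (real (card {1..K}))\<^sup>2 * p) = (2 * real K)\<^sup>2 * (n * p)"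
        by (simp add: power2_eq_square)
      then show ?thesis by (simp add: real_sqrt_mult)
    qed
    then have 1: "\<delta> * sqrt (n * (4 * (real (card {1..K}))\<^sup>2 * p)) \<le> \<delta> * (n * X / 800)"
      using large \<delta> by (simp add: X_def p_def)
    have 2: "s * \<delta> * (sqrt (card I) * u) \<le> s * \<delta> * (9 / 10 * n * X)"
      using s \<delta> bal by (intro mult_left_mono) (auto simp: X_def)
    show ?thesis using 1 2 by (simp add: \<rho>_def x_def s_def algebra_simps)
  qed
  have rem: "EL ZK (Q \<theta>s) n (\<lambda>zs. ind (\<exists>D\<in>T. (\<Sum>z\<leftarrow>zs. R D z) < s * sqrt (card I) * u * \<delta>))
      \<le> EL ZK (Q \<theta>s) n (\<lambda>zs. ind (\<exists>D\<in>T. (\<Sum>z\<leftarrow>zs. B D z) < n * \<rho> - \<delta> * sqrt (n * (4 * (real (card {1..K}))\<^sup>2 * p)) - x))"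
  proof (rule EL_mono)
    fix zs assume zs: "zs \<in> lists_n ZK n"
    have eq: "map (R D) zs = map (B D) zs" for D
      by (rule map_cong[OF refl]) (use zs RB in \<open>auto simp: lists_n_def\<close>)
    show "ind (\<exists>D\<in>T. (\<Sum>z\<leftarrow>zs. R D z) < s * sqrt (card I) * u * \<delta>)
      \<le> ind (\<exists>D\<in>T. (\<Sum>z\<leftarrow>zs. B D z) < n * \<rho> - \<delta> * sqrt (n * (4 * (real (card {1..K}))\<^sup>2 * p)) - x)"
      unfolding eq by (rule ind_mono) (use thr less_le_trans in blast)
  qed
  have "EL ZK (Q \<theta>s) n (\<lambda>zs. ind (\<exists>D\<in>supp_on I. nrm I D = \<delta> \<and>
        \<not> (\<Sum>z\<leftarrow>zs. npl (\<lambda>L. \<theta>s L + (1 - s) * D L) z) < (\<Sum>z\<leftarrow>zs. npl (\<lambda>L. \<theta>s L + D L) z)))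
    \<le> 2 * real (card I) * exp (- 2 * u\<^sup>2 / (n * (real K)\<^sup>2))
      + EL ZK (Q \<theta>s) n (\<lambda>zs. ind (\<exists>D\<in>T. (\<Sum>z\<leftarrow>zs. R D z) < s * sqrt (card I) * u * \<delta>))"
    unfolding R_def T_def
    by (rule sphere_condition_prob[OF I_fin I_ne _ u _ n \<delta>(1) s(1)])
      (use pscore_mgf[of \<theta>s] Kpos in \<open>auto simp: G_def\<close>)
  also note rem
  also note tail[unfolded expo]
  finally show ?thesis by (simp add: s_def X_def p_def)
qed

lemma nll_line_convex:
  assumes z: "z \<in> ZK"
  shows "convex_on UNIV (\<lambda>t. nll (\<lambda>L. c L + t * D L) z)"
  unfolding nll_eq[OF z] ip_add_left
proof (rule f''_ge0_imp_convex)
  show "((\<lambda>t. ln (part (\<lambda>L. c L + t * D L)) - (ip I c (tvec z) + t * ip I D (tvec z))) has_real_derivative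
      (\<Sum>z\<in>ZK. Q (\<lambda>L. c L + t * D L) z * ip I D (tvec z)) - ip I D (tvec z)) (at t)" for t
    by (rule DERIV_diff[OF log_part_line(1)]) (auto intro!: derivative_eq_intros)
  show "((\<lambda>t. (\<Sum>z\<in>ZK. Q (\<lambda>L. c L + t * D L) z * ip I D (tvec z)) - ip I D (tvec z)) has_real_derivative
      ip I D (mv I (Imat K H (\<lambda>L. c L + t * D L)) D)) (at t)" for t
    using DERIV_diff[OF log_part_line(2) DERIV_const] by simp
qed (auto intro: Imat_psd)

lemma npl_line_convex:
  assumes z: "z \<in> ZK"
  shows "convex_on UNIV (\<lambda>t. npl (\<lambda>L. c L + t * D L) z)"
  unfolding npl_eq[OF z] ip_add_left
proof (rule f''_ge0_imp_convex)
  let ?x = "\<lambda>t k. - (ip I c (wvec K k z) + t * ip I D (wvec K k z))"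
  show "((\<lambda>t. (\<Sum>k\<in>{1..K}. softplus (?x t k)) - npl_const z) has_real_derivative
      (\<Sum>k\<in>{1..K}. sigmoid (?x t k) * - ip I D (wvec K k z))) (at t)" for t
    by (auto intro!: derivative_eq_intros sum.cong)
  show "((\<lambda>t. \<Sum>k\<in>{1..K}. sigmoid (?x t k) * - ip I D (wvec K k z)) has_real_derivative
      (\<Sum>k\<in>{1..K}. sigmoid (?x t k) * (1 - sigmoid (?x t k)) * - ip I D (wvec K k z) * - ip I D (wvec K k z))) (at t)" for t
    by (auto intro!: derivative_eq_intros sum.cong)
  show "0 \<le> (\<Sum>k\<in>{1..K}. sigmoid (?x t k) * (1 - sigmoid (?x t k)) * - ip I D (wvec K k z) * - ip I D (wvec K k z))" for t
  proof (rule sum_nonneg)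
    fix k
    have "0 \<le> sigmoid (?x t k) * (1 - sigmoid (?x t k)) * (ip I D (wvec K k z) * ip I D (wvec K k z))"
      by (rule mult_nonneg_nonneg[OF sigmoid_prime_bounds(1)]) simp
    then show "0 \<le> sigmoid (?x t k) * (1 - sigmoid (?x t k)) * - ip I D (wvec K k z) * - ip I D (wvec K k z)"
      by (simp only: mult_minus_right mult_minus_left minus_minus mult.assoc)
  qed
qed auto

lemma nll_continuous:
  assumes z: "z \<in> ZK"
  shows "continuous_on UNIV (\<lambda>\<theta>. nll \<theta> z)"
  unfolding nll_eq[OF z] part_def
  by (intro continuous_intros continuous_on_product_coordinates)
    (use part_pos in \<open>auto simp: part_def less_imp_neq[THEN not_sym]\<close>)

lemma npl_continuous:
  assumes z: "z \<in> ZK"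
  shows "continuous_on UNIV (\<lambda>\<theta>. npl \<theta> z)"
  unfolding npl_eq[OF z] softplus_def
  by (intro continuous_intros continuous_on_product_coordinates)
    (auto simp: one_plus_exp_pos less_imp_neq[THEN not_sym])

lemma npl_argmax:
  assumes \<theta>s: "\<theta>s \<in> Theta K H" and \<delta>: "0 < \<delta>" and zs: "set zs \<subseteq> ZK"
    and F: "\<And>\<theta>. \<theta> \<in> Theta K H \<Longrightarrow> F \<theta> = a - (\<Sum>z\<leftarrow>zs. npl \<theta> z)"
    and sphere: "\<not> (\<exists>D\<in>supp_on I. nrm I D = \<delta> \<and>
        \<not> (\<Sum>z\<leftarrow>zs. npl (\<lambda>L. \<theta>s L + (1 - 1 / 20) * D L) z) < (\<Sum>z\<leftarrow>zs. npl (\<lambda>L. \<theta>s L + D L) z))"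
  shows "argmax_Theta K H F \<noteq> {} \<and> (\<forall>\<theta>\<in>argmax_Theta K H F. norm2 K H (\<lambda>L. \<theta> L - \<theta>s L) \<le> \<delta>)"
proof -
  define G where "G \<theta> = (\<Sum>z\<leftarrow>zs. npl \<theta> z)" for \<theta>
  have cont: "continuous_on UNIV G"
    unfolding G_def by (rule continuous_on_sum_list[where f = "\<lambda>z \<theta>. npl \<theta> z"]) (use zs npl_continuous in auto)
  have conv: "convex_on UNIV (\<lambda>t. G (\<lambda>L. \<theta>s L + t * D L))" for D
    unfolding G_def
    by (rule convex_on_sum_list[where f = "\<lambda>z t. npl (\<lambda>L. \<theta>s L + t * D L) z"]) (use zs npl_line_convex in auto)
  have sp: "G (\<lambda>L. \<theta>s L + (1 - 1 / 20) * D L) < G (\<lambda>L. \<theta>s L + D L)" if "D \<in> supp_on I" "nrm I D = \<delta>" for D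
    using sphere that unfolding G_def by blast
  have \<theta>s': "\<theta>s \<in> supp_on I" using \<theta>s by (simp add: Theta_eq_supp_on)
  note m = minimizers_in_ball[OF I_fin \<theta>s' \<delta> _ _ cont conv sp]
  have am: "argmax_Theta K H F = {\<theta> \<in> supp_on I. \<forall>\<theta>'\<in>supp_on I. G \<theta> \<le> G \<theta>'}"
    by (rule argmax_Theta_cong[where a = a]) (simp add: F G_def)
  have "\<exists>x\<in>supp_on I. \<forall>y\<in>supp_on I. G x \<le> G y" by (rule m(1)) auto
  moreover have "nrm I (\<lambda>L. \<theta> L - \<theta>s L) \<le> \<delta>" if "\<theta> \<in> supp_on I" "\<forall>\<theta>'\<in>supp_on I. G \<theta> \<le> G \<theta>'" for \<theta>
    by (rule m(2)) (use that in auto)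
  ultimately show ?thesis unfolding am norm2_eq_nrm by blast
qed

text \<open>Uniqueness rests on localization: all minimizers lie in the ball, hence so does the
  segment between two of them, and there the Hessian of a non-empty sample is at least
  \<open>length zs\<close> times \<open>xi\<close>, whatever the data. The curvature of
  \<open>npl\<close> depends on the sample and allows no such argument.\<close>

lemma nll_argmax:
  assumes \<theta>s: "\<theta>s \<in> Theta K H" and \<delta>: "0 < \<delta>" "\<delta> \<le> \<epsilon>" and xi: "0 < xi K H \<theta>s \<epsilon>"
    and zs: "set zs \<subseteq> ZK" "zs \<noteq> []"
    and F: "\<And>\<theta>. \<theta> \<in> Theta K H \<Longrightarrow> F \<theta> = a - (\<Sum>z\<leftarrow>zs. nll \<theta> z)"
    and sphere: "\<not> (\<exists>D\<in>supp_on I. nrm I D = \<delta> \<and>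
        \<not> (\<Sum>z\<leftarrow>zs. nll (\<lambda>L. \<theta>s L + (1 - 1 / 20) * D L) z) < (\<Sum>z\<leftarrow>zs. nll (\<lambda>L. \<theta>s L + D L) z))"
  shows "\<exists>\<theta>h. argmax_Theta K H F = {\<theta>h} \<and> norm2 K H (\<lambda>L. \<theta>h L - \<theta>s L) \<le> \<delta>"
proof -
  define G where "G \<theta> = (\<Sum>z\<leftarrow>zs. nll \<theta> z)" for \<theta>
  have cont: "continuous_on UNIV G"
    unfolding G_def by (rule continuous_on_sum_list[where f = "\<lambda>z \<theta>. nll \<theta> z"]) (use zs nll_continuous in auto)
  have conv: "convex_on UNIV (\<lambda>t. G (\<lambda>L. \<theta>s L + t * D L))" for D
    unfolding G_def
    by (rule convex_on_sum_list[where f = "\<lambda>z t. nll (\<lambda>L. \<theta>s L + t * D L) z"]) (use zs nll_line_convex in auto)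
  have sp: "G (\<lambda>L. \<theta>s L + (1 - 1 / 20) * D L) < G (\<lambda>L. \<theta>s L + D L)" if "D \<in> supp_on I" "nrm I D = \<delta>" for D
    using sphere that unfolding G_def by blast
  have \<theta>s': "\<theta>s \<in> supp_on I" using \<theta>s by (simp add: Theta_eq_supp_on)
  note m = minimizers_in_ball[OF I_fin \<theta>s' \<delta>(1) _ _ cont conv sp]
  have am: "argmax_Theta K H F = {\<theta> \<in> supp_on I. \<forall>\<theta>'\<in>supp_on I. G \<theta> \<le> G \<theta>'}"
    by (rule argmax_Theta_cong[where a = a]) (simp add: F G_def)
  have "\<exists>x\<in>supp_on I. \<forall>y\<in>supp_on I. G x \<le> G y" by (rule m(1)) auto
  then obtain x where x: "x \<in> supp_on I" "\<And>y. y \<in> supp_on I \<Longrightarrow> G x \<le> G y" by blast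
  have near: "nrm I (\<lambda>L. \<theta> L - \<theta>s L) \<le> \<delta>" if "\<theta> \<in> supp_on I" "\<And>\<theta>'. \<theta>' \<in> supp_on I \<Longrightarrow> G \<theta> \<le> G \<theta>'" for \<theta>
    by (rule m(2)) (use that in auto)
  have "y = x" if y: "y \<in> supp_on I" "\<And>\<theta>'. \<theta>' \<in> supp_on I \<Longrightarrow> G y \<le> G \<theta>'" for y
  proof (rule ccontr)
    assume "y \<noteq> x"
    define D where "D L = y L - x L" for L
    have D: "D \<in> supp_on I" using x y by (auto simp: D_def supp_on_def)
    have "ip I D D \<noteq> 0"
    proof
      assume "ip I D D = 0"
      then have "\<forall>L\<in>I. y L = x L" using I_fin by (simp add: ip_eq_0_iff D_def)
      then have "y = x" using x y by (auto simp: supp_on_def fun_eq_iff)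
      with \<open>y \<noteq> x\<close> show False by simp
    qed
    then have Dpos: "0 < ip I D D" using ip_nonneg[of I D] by simp
    define n where "n = real (length zs)"
    have n: "0 < n" using zs by (simp add: n_def)
    define \<sigma> where "\<sigma> = (\<Sum>z\<leftarrow>zs. ip I x (tvec z))"
    define \<tau> where "\<tau> = (\<Sum>z\<leftarrow>zs. ip I D (tvec z))"
    define g where "g t = n * ln (part (\<lambda>L. x L + t * D L)) - \<sigma> - t * \<tau>" for t
    define g' where "g' t = n * (\<Sum>z\<in>ZK. Q (\<lambda>L. x L + t * D L) z * ip I D (tvec z)) - \<tau>" for t
    have Gg: "G (\<lambda>L. x L + t * D L) = g t" for t
    proof -
      have "G (\<lambda>L. x L + t * D L) = (\<Sum>z\<leftarrow>zs. ln (part (\<lambda>L. x L + t * D L)) - ip I x (tvec z) - t * ip I D (tvec z))"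
        unfolding G_def
        by (rule arg_cong[where f = sum_list], rule map_cong[OF refl]) (use zs in \<open>auto simp: nll_eq ip_add_left\<close>)
      then show ?thesis
        by (simp add: g_def sum_list_subtractf sum_list_triv sum_list_const_mult n_def \<sigma>_def \<tau>_def)
    qed
    have g0: "g 0 \<le> g t" for t
    proof -
      have "(\<lambda>L. x L + t * D L) \<in> supp_on I" using x D by (auto simp: supp_on_def)
      then have "G x \<le> G (\<lambda>L. x L + t * D L)" by (rule x(2))
      moreover have "G x = G (\<lambda>L. x L + 0 * D L)" by simp
      ultimately show ?thesis unfolding Gg by simp
    qed
    have "G y \<le> G x" by (rule y(2)[OF x(1)])
    moreover have "G y = G (\<lambda>L. x L + 1 * D L)" by (simp add: D_def)
    moreover have "G x = G (\<lambda>L. x L + 0 * D L)" by simp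
    ultimately have g10: "g 1 \<le> g 0" unfolding Gg by simp
    have dg: "(g has_real_derivative g' t) (at t)" for t
    proof -
      have "((\<lambda>t. t * \<tau>) has_real_derivative \<tau>) (at t)" by (auto intro!: derivative_eq_intros)
      from DERIV_diff[OF DERIV_diff[OF DERIV_cmult[OF log_part_line(1)] DERIV_const] this]
      show ?thesis unfolding g_def g'_def by simp
    qed
    have dg': "(g' has_real_derivative n * ip I D (mv I (Imat K H (\<lambda>L. x L + t * D L)) D)) (at t)" for t
      unfolding g'_def using DERIV_diff[OF DERIV_cmult[OF log_part_line(2), of n] DERIV_const] by simp
    have ball: "(\<lambda>L. x L + t * D L) \<in> ball2 K H \<theta>s \<epsilon>" if t: "0 \<le> t" "t \<le> 1" for t
    proof -
      define ex where "ex = (\<lambda>L. x L - \<theta>s L)"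
      define ey where "ey = (\<lambda>L. y L - \<theta>s L)"
      have e: "nrm I ex \<le> \<delta>" "nrm I ey \<le> \<delta>"
        unfolding ex_def ey_def by (rule near; use x y in auto)+
      define v where "v = (\<lambda>L. (1 - t) * ex L + t * ey L)"
      \<comment> \<open>Convexity of the ball: one factor \<open>v\<close> is expanded and
        Cauchy-Schwarz is applied to each part.\<close>
      have "ip I v v = (1 - t) * ip I ex v + t * ip I ey v"
        by (simp add: v_def ip_def sum.distrib distrib_right sum_distrib_left mult_ac)
      also have "\<dots> \<le> (1 - t) * (\<delta> * nrm I v) + t * (\<delta> * nrm I v)"
      proof (intro add_mono mult_left_mono)
        show "ip I ex v \<le> \<delta> * nrm I v"
          using Cauchy_Schwarz_ip[of I ex v] mult_right_mono[OF e(1) nrm_nonneg[of I v]] by linarith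
        show "ip I ey v \<le> \<delta> * nrm I v"
          using Cauchy_Schwarz_ip[of I ey v] mult_right_mono[OF e(2) nrm_nonneg[of I v]] by linarith
      qed (use t in auto)
      also have "\<dots> = \<delta> * nrm I v" by (simp add: algebra_simps)
      finally have "nrm I v * nrm I v \<le> \<delta> * nrm I v" using nrm_sq[of I v] by (simp add: power2_eq_square)
      then have "nrm I v \<le> \<delta>"
        using nrm_nonneg[of I v] \<delta> by (cases "nrm I v = 0") (auto simp: mult_le_cancel_right)
      moreover have "v = (\<lambda>L. x L + t * D L - \<theta>s L)" by (simp add: v_def ex_def ey_def D_def algebra_simps)
      ultimately have "nrm I (\<lambda>L. x L + t * D L - \<theta>s L) \<le> \<epsilon>" using \<delta> by simp
      then show ?thesis using x D by (auto simp: ball2_def norm2_eq_nrm Theta_eq_supp_on supp_on_def)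
    qed
    define m where "m = n * (xi K H \<theta>s \<epsilon> * ip I D D)"
    have mpos: "0 < m" using n xi Dpos by (simp add: m_def)
    \<comment> \<open>Since \<open>g 1 \<le> g 0 \<le> g (1 / 2)\<close>, a positive gap forces
      \<open>g' 0 < 0\<close>, against minimality at 0.\<close>
    have "1 / 2 * (1 - 1 / 2) * m \<le> g 1 - g (1 - 1 / 2) - 1 / 2 * g' 0"
    proof (rule second_order_gap[OF dg dg'])
      show "m \<le> n * ip I D (mv I (Imat K H (\<lambda>L. x L + t * D L)) D)" if "0 \<le> t" "t \<le> 1" for t
        unfolding m_def using n xi_le[OF ball[OF that]] by (intro mult_left_mono) auto
    qed (use mpos in auto)
    then have "g' 0 < 0" using g10 g0[of "1 / 2"] mpos by simp
    then obtain d where "0 < d" "\<And>h. 0 < h \<Longrightarrow> h < d \<Longrightarrow> g (0 + h) < g 0"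
      using DERIV_neg_dec_right[OF dg[of 0]] by blast
    then have "g (0 + d / 2) < g 0" by simp
    with g0[of "0 + d / 2"] show False by simp
  qed
  with x have "argmax_Theta K H F = {x}" unfolding am by blast
  moreover have "norm2 K H (\<lambda>L. x L - \<theta>s L) \<le> \<delta>" unfolding norm2_eq_nrm by (rule near[OF x])
  ultimately show ?thesis by blast
qed

end

section \<open>Averaging over the number of activated dyads\<close>

text \<open>Below \<open>2/5\<close> of its mean the sample size is ruled out by Chebyshev's inequality alone; between \<open>2/5\<close> and
  \<open>4/5\<close> Chebyshev's inequality is combined with a small conditional error probability; above \<open>4/5\<close> the latter
  suffices.\<close>
lemma sample_size_average:
  fixes g :: "'y \<Rightarrow> real" and M :: "'y \<Rightarrow> nat" and \<beta> :: "nat \<Rightarrow> real" and m D p \<tau> :: real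
  assumes S: "finite S" "\<And>y. y \<in> S \<Longrightarrow> 0 \<le> g y" "(\<Sum>y\<in>S. g y) = 1"
    and V: "(\<Sum>y\<in>S. g y * (M y - m)\<^sup>2) \<le> m + 2 * D"
    and m: "1 \<le> m" "m \<le> (real N)\<^sup>2" and D: "0 \<le> D"
    and N: "2560000 \<le> ln (real N)" and p: "0 \<le> p" "p \<le> real N"
    and \<tau>: "0 < \<tau>" "\<tau> \<le> 1 / 1000000" "\<tau>\<^sup>2 = 3 * ln (real N) * (1 + D) / m"
    and \<beta>1: "\<And>n. \<beta> n \<le> 1"
    and \<beta>: "\<And>n. 0 < n \<Longrightarrow> 2560000 \<le> real n * \<tau>\<^sup>2 \<Longrightarrow>
      \<beta> n \<le> 2 * p * exp (- 81 / 50 * (n * \<tau>\<^sup>2)) + exp (- (n * \<tau>) / 60800)"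
  shows "(\<Sum>y\<in>S. g y * \<beta> (M y)) \<le> 3 / m"
proof -
  define l where "l = ln (real N)"
  have l: "2560000 \<le> l" using N by (simp add: l_def)
  have N0: "0 < real N" using l by (cases "N = 0") (auto simp: l_def)
  have Nl: "real N = exp l" using N0 by (simp add: l_def)
  \<comment> \<open>Since \<open>3 * l \<ge> 1\<close>, the quotient \<open>D / m\<close> is at most
    \<open>\<tau>^2\<close>.\<close>
  have D1: "2 * D / m \<le> 1 / 100"
  proof -
    have "D / m * 1 \<le> (1 + D) / m * (3 * l)"
      using m D l by (intro mult_mono divide_right_mono) auto
    also have "\<dots> = \<tau>\<^sup>2" unfolding \<tau>(3) l_def by simp
    also have "\<dots> \<le> (1 / 1000000)\<^sup>2" using \<tau> by (intro power_mono) auto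
    also have "\<dots> \<le> 1 / 200" by (simp add: power2_eq_square)
    finally have "2 * (D / m) \<le> 1 / 100" by linarith
    then show ?thesis by (simp only: times_divide_eq_right)
  qed
  have small: "exp (- x) \<le> 1 / x" if "0 < x" for x :: real
  proof -
    have "x \<le> exp x" using exp_ge_add_one_self[of x] by linarith
    then show ?thesis using that by (simp add: exp_minus field_simps)
  qed
  \<comment> \<open>243/50 is 3 * 81/50, because \<open>n \<ge> c * m\<close> gives
    \<open>n * \<tau>^2 \<ge> 3 * c * l\<close>, and the extra \<open>l\<close> is the union bound
    \<open>p \<le> N\<close>. In the second term, dividing by the tiny \<open>\<tau>\<close> makes
    \<open>n * \<tau>\<close> at least 1200000 \<open>l\<close>, far above 3 * 60800
    \<open>l\<close>.\<close>
  have bound: "\<beta> n \<le> 2 * exp (l - 243 / 50 * c * l) + exp (- 3 * l)" if n: "c * m \<le> real n" and c: "2 / 5 \<le> c" for n c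
  proof -
    have mt: "m * \<tau>\<^sup>2 = 3 * l * (1 + D)" using \<tau>(3) m by (simp add: l_def)
    have nm: "0 < real n" using n c m mult_pos_pos[of c m] by linarith
    have mt3: "3 * l \<le> m * \<tau>\<^sup>2" unfolding mt using l D by (simp add: distrib_left)
    have "c * (3 * l) \<le> c * (m * \<tau>\<^sup>2)" using mt3 c by (intro mult_left_mono) auto
    also have "\<dots> \<le> n * \<tau>\<^sup>2" using mult_right_mono[OF n, of "\<tau>\<^sup>2"] by (simp add: mult_ac)
    finally have nt: "c * (3 * l) \<le> n * \<tau>\<^sup>2" .
    have "2 / 5 * (3 * l) \<le> c * (3 * l)" using c l by (intro mult_right_mono) auto
    then have cl: "6 / 5 * l \<le> n * \<tau>\<^sup>2" using nt by linarith
    then have big: "2560000 \<le> n * \<tau>\<^sup>2" using l by linarith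
    have b: "\<beta> n \<le> 2 * p * exp (- 81 / 50 * (n * \<tau>\<^sup>2)) + exp (- (n * \<tau>) / 60800)"
      by (rule \<beta>[OF _ big]) (use nm in simp)
    have "6 / 5 * l \<le> (n * \<tau>) * \<tau>" using cl by (simp add: power2_eq_square mult_ac)
    also have "\<dots> \<le> (n * \<tau>) * (1 / 1000000)" using nm \<tau> by (intro mult_left_mono) auto
    finally have e2: "- (n * \<tau>) / 60800 \<le> - 3 * l" using l by simp
    have "2 * p * exp (- 81 / 50 * (n * \<tau>\<^sup>2)) \<le> 2 * exp l * exp (- 243 / 50 * c * l)"
      using p nt unfolding Nl by (intro mult_mono) auto
    also have "\<dots> = 2 * exp (l - 243 / 50 * c * l)" by (simp add: mult.assoc flip: exp_add)
    finally show ?thesis using b e2 by (smt (verit) exp_le_cancel_iff)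
  qed
  \<comment> \<open>The cut 2/5 meets two demands: \<open>1 / (1 - 2/5)^2 = 25/9\<close> is below 3,
    and 243/50 * 2/5 = 1.944 exceeds 1, so \<open>b1\<close> is small. At 4/5 the exponent is 1 -
    3.888, enough to make \<open>b2\<close> small against \<open>1 / N^2\<close>, hence against
    \<open>1 / m\<close>.\<close>
  define b1 where "b1 = 2 * exp (l - 243 / 50 * (2 / 5) * l) + exp (- 3 * l)"
  define b2 where "b2 = 2 * exp (l - 243 / 50 * (4 / 5) * l) + exp (- 3 * l)"
  have b1: "0 \<le> b1" "b1 \<le> 1 / 1000"
  proof -
    have "b1 \<le> 2 * exp (- (9 / 10 * l)) + exp (- (9 / 10 * l))"
      unfolding b1_def using l by (intro add_mono mult_left_mono) auto
    also have "\<dots> = 3 * exp (- (9 / 10 * l))" by simp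
    also have "\<dots> \<le> 3 * (1 / (9 / 10 * l))" using l by (intro mult_left_mono small) auto
    also have "\<dots> \<le> 1 / 1000" using l by (simp add: field_simps)
    finally show "b1 \<le> 1 / 1000" .
  qed (simp add: b1_def)
  have b2_nonneg: "0 \<le> b2" by (simp add: b2_def)
  have b2: "b2 \<le> 1 / 1000 / m"
  proof -
    have "b2 \<le> 2 * exp (- 2 * l + - (1 / 2 * l)) + exp (- 2 * l + - (1 / 2 * l))"
      unfolding b2_def using l by (intro add_mono mult_left_mono) auto
    also have "\<dots> = exp (- 2 * l) * (3 * exp (- (1 / 2 * l)))" by (simp only: exp_add)
    also have "\<dots> \<le> exp (- 2 * l) * (3 * (1 / (1 / 2 * l)))" using l by (intro mult_left_mono small) auto
    also have "\<dots> \<le> exp (- 2 * l) * (1 / 1000)" using l by (intro mult_left_mono) (auto simp: field_simps)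
    also have "exp (- 2 * l) = 1 / (real N)\<^sup>2"
      unfolding Nl by (simp add: exp_minus power2_eq_square field_simps flip: exp_add)
    also have "1 / (real N)\<^sup>2 * (1 / 1000) \<le> 1 / m * (1 / 1000)"
      using m by (intro mult_right_mono frac_le) auto
    finally show ?thesis by simp
  qed
  have cheb: "(if M y < c * m then 1 else 0 :: real) \<le> (M y - m)\<^sup>2 / ((1 - c) * m)\<^sup>2" if c: "c < 1" for y c
  proof (cases "M y < c * m")
    case True
    then have "(1 - c) * m \<le> m - M y" by (simp add: algebra_simps)
    then have "((1 - c) * m)\<^sup>2 \<le> (m - M y)\<^sup>2" using c m by (intro power_mono) auto
    then show ?thesis using True c m by (simp add: power2_commute)
  qed simp
  have pw: "\<beta> (M y) \<le> (25 / 9 + 25 * b1) * ((M y - m)\<^sup>2 / m\<^sup>2) + b2" for y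
  proof -
    have "\<beta> (M y) \<le> (if M y < 2 / 5 * m then 1 else 0) + b1 * (if M y < 4 / 5 * m then 1 else 0) + b2"
    proof -
      consider "M y < 2 / 5 * m" | "2 / 5 * m \<le> M y" "M y < 4 / 5 * m" | "4 / 5 * m \<le> M y" by linarith
      then show ?thesis
      proof cases
        case 1
        then show ?thesis using 1 \<beta>1[of "M y"] b1 b2_nonneg m by auto
      next
        case 2
        then show ?thesis using 2 bound[OF 2(1)] b2_nonneg by (simp add: b1_def)
      next
        case 3
        then show ?thesis using bound[OF 3] m by (simp add: b2_def)
      qed
    qed
    also have "\<dots> \<le> (M y - m)\<^sup>2 / ((1 - 2 / 5) * m)\<^sup>2 + b1 * ((M y - m)\<^sup>2 / ((1 - 4 / 5) * m)\<^sup>2) + b2"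
      using cheb[of "2 / 5" y] cheb[of "4 / 5" y] b1 by (intro add_mono mult_left_mono) auto
    also have "\<dots> = (25 / 9 + 25 * b1) * ((M y - m)\<^sup>2 / m\<^sup>2) + b2"
      using m by (simp add: power_mult_distrib power2_eq_square field_simps)
    finally show ?thesis .
  qed
  have "(\<Sum>y\<in>S. g y * \<beta> (M y)) \<le> (\<Sum>y\<in>S. g y * ((25 / 9 + 25 * b1) * ((M y - m)\<^sup>2 / m\<^sup>2) + b2))"
    by (intro sum_mono mult_left_mono pw S)
  also have "\<dots> = (25 / 9 + 25 * b1) / m\<^sup>2 * (\<Sum>y\<in>S. g y * (M y - m)\<^sup>2) + b2 * (\<Sum>y\<in>S. g y)"
  proof -
    have "w * (c * (x / k) + d) = c / k * (w * x) + d * w" for w c x k d :: real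
      by (simp add: distrib_left mult_ac)
    then show ?thesis by (simp only: sum.distrib sum_distrib_left)
  qed
  also have "\<dots> \<le> (25 / 9 + 25 * b1) / m\<^sup>2 * (m + 2 * D) + b2 * 1"
    unfolding S(3) using b1 b2_nonneg by (intro add_mono mult_left_mono V) auto
  also have "(25 / 9 + 25 * b1) / m\<^sup>2 * (m + 2 * D) = (25 / 9 + 25 * b1) * (1 + 2 * D / m) / m"
    using m by (simp add: field_simps power2_eq_square)
  \<comment> \<open>The numerator is about 2.832, so the margin below 3 is small.\<close>
  also have "\<dots> + b2 * 1 \<le> (25 / 9 + 25 * (1 / 1000)) * (1 + 1 / 100) / m + 1 / 1000 / m"
    using b1 b2 b2_nonneg D1 m D by (intro add_mono divide_right_mono mult_mono) auto
  also have "\<dots> \<le> 3 / m" using m by (simp add: field_simps)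
  finally show ?thesis .
qed

section \<open>The network model\<close>

lemma sum_PiE_dflt_insert:
  assumes A: "finite A" "a \<notin> A" and B: "\<And>x. x \<in> insert a A \<Longrightarrow> finite (B x)"
  shows "(\<Sum>x\<in>PiE_dflt (insert a A) dflt B. F x) = (\<Sum>z\<in>B a. \<Sum>x\<in>PiE_dflt A dflt B. F (x(a := z)))"
proof -
  have "(\<Sum>x\<in>PiE_dflt (insert a A) dflt B. F x) = (\<Sum>w\<in>B a \<times> PiE_dflt A dflt B. F ((snd w)(a := fst w)))"
    by (rule sum.reindex_bij_witness[of _ "\<lambda>w. (snd w)(a := fst w)" "\<lambda>x. (x a, x(a := dflt))"])
      (use A in \<open>auto simp: PiE_dflt_def fun_eq_iff\<close>)
  then show ?thesis by (simp add: sum.cartesian_product case_prod_unfold)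
qed

lemma sum_prod_PiE_dflt:
  fixes f :: "'d \<Rightarrow> 'z \<Rightarrow> real"
  assumes "finite A" and "\<And>x. x \<in> A \<Longrightarrow> finite (B x)"
  shows "(\<Sum>x\<in>PiE_dflt A dflt B. \<Prod>d\<in>A. f d (x d)) = (\<Prod>d\<in>A. \<Sum>z\<in>B d. f d z)"
  using assms
proof (induction A rule: finite_induct)
  case empty
  have "PiE_dflt {} dflt B = {\<lambda>_. dflt}" by (auto simp: PiE_dflt_def)
  then show ?case by simp
next
  case (insert a A)
  have "(\<Sum>x\<in>PiE_dflt (insert a A) dflt B. \<Prod>d\<in>insert a A. f d (x d))
      = (\<Sum>z\<in>B a. \<Sum>x\<in>PiE_dflt A dflt B. \<Prod>d\<in>insert a A. f d ((x(a := z)) d))"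
    by (rule sum_PiE_dflt_insert) (use insert in auto)
  also have "\<dots> = (\<Sum>z\<in>B a. \<Sum>x\<in>PiE_dflt A dflt B. f a z * (\<Prod>d\<in>A. f d (x d)))"
  proof (intro sum.cong refl)
    fix z x
    have "(\<Prod>d\<in>A. f d ((x(a := z)) d)) = (\<Prod>d\<in>A. f d (x d))"
      by (rule prod.cong) (use insert in auto)
    then show "(\<Prod>d\<in>insert a A. f d ((x(a := z)) d)) = f a z * (\<Prod>d\<in>A. f d (x d))"
      using insert by simp
  qed
  also have "\<dots> = (\<Sum>z\<in>B a. f a z) * (\<Prod>d\<in>A. \<Sum>z\<in>B d. f d z)"
    using insert by (simp add: sum_product[symmetric] sum_distrib_left[symmetric] sum_distrib_right)
  finally show ?case using insert by simp
qed

text \<open>Product weights on functions over a finite set become independent draws once an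
  enumeration of the set is fixed.\<close>

lemma sum_PiE_dflt_EL:
  fixes ds :: "'d list"
  assumes "distinct ds" "finite Z"
  shows "(\<Sum>x\<in>PiE_dflt (set ds) dflt (\<lambda>_. Z). (\<Prod>d\<in>set ds. q (x d)) * F (map x ds)) = EL Z q (length ds) F"
  using assms(1)
proof (induction ds arbitrary: F)
  case Nil
  have "PiE_dflt ({} :: 'd set) dflt (\<lambda>_. Z) = {\<lambda>_. dflt}" by (auto simp: PiE_dflt_def)
  then show ?case by simp
next
  case (Cons a ds)
  have "(\<Sum>x\<in>PiE_dflt (set (a # ds)) dflt (\<lambda>_. Z). (\<Prod>d\<in>set (a # ds). q (x d)) * F (map x (a # ds)))
      = (\<Sum>z\<in>Z. \<Sum>x\<in>PiE_dflt (set ds) dflt (\<lambda>_. Z).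
          (\<Prod>d\<in>insert a (set ds). q ((x(a := z)) d)) * F (map (x(a := z)) (a # ds)))"
    unfolding list.set by (rule sum_PiE_dflt_insert) (use Cons.prems assms(2) in auto)
  also have "\<dots> = (\<Sum>z\<in>Z. \<Sum>x\<in>PiE_dflt (set ds) dflt (\<lambda>_. Z). q z * ((\<Prod>d\<in>set ds. q (x d)) * F (z # map x ds)))"
  proof (intro sum.cong refl)
    fix z x
    have "(\<Prod>d\<in>set ds. q ((x(a := z)) d)) = (\<Prod>d\<in>set ds. q (x d))"
      by (rule prod.cong) (use Cons.prems in auto)
    moreover have "map (x(a := z)) (a # ds) = z # map x ds"
      using Cons.prems by auto
    ultimately show "(\<Prod>d\<in>insert a (set ds). q ((x(a := z)) d)) * F (map (x(a := z)) (a # ds))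
        = q z * ((\<Prod>d\<in>set ds. q (x d)) * F (z # map x ds))"
      using Cons.prems by simp
  qed
  also have "\<dots> = EL Z q (length (a # ds)) F"
    using Cons.IH[of "\<lambda>zs. F (_ # zs)"] Cons.prems by (simp add: sum_distrib_left[symmetric])
  finally show ?case .
qed

lemma finite_dyads: "finite (dyads N)"
  by (rule finite_subset[of _ "{1..N} \<times> {1..N}"]) (auto simp: dyads_def)

lemma card_dyads_le: "card (dyads N) \<le> N\<^sup>2"
proof -
  have "card (dyads N) \<le> card ({1..N} \<times> {1..N})"
    by (rule card_mono) (auto simp: dyads_def)
  then show ?thesis by (simp add: power2_eq_square)
qed

lemma finite_YY: "finite (YY N)"
proof (rule finite_subset)
  show "YY N \<subseteq> (\<lambda>S d. d \<in> S) ` Pow (dyads N)"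
  proof
    fix y assume "y \<in> YY N"
    then have "y = (\<lambda>d. d \<in> {d. y d})" "{d. y d} \<in> Pow (dyads N)" by (auto simp: YY_def)
    then show "y \<in> (\<lambda>S d. d \<in> S) ` Pow (dyads N)" by blast
  qed
qed (simp add: finite_dyads)

definition active :: "nat \<Rightarrow> (nat \<times> nat \<Rightarrow> bool) \<Rightarrow> (nat \<times> nat) set" where
  "active N y = {d \<in> dyads N. y d}"

lemma finite_active: "finite (active N y)"
  by (simp add: active_def finite_dyads)

text \<open>For \<open>y\<close> in \<open>YY N\<close>, the networks with \<open>hmod = 1\<close>.
  As a dependent product with default value the set lets sums factor over dyads.\<close>

definition concordant :: "nat \<Rightarrow> nat \<Rightarrow> (nat \<times> nat \<Rightarrow> bool) \<Rightarrow> (nat \<times> nat \<Rightarrow> nat \<Rightarrow> bool) set" where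
  "concordant N K y = PiE_dflt (active N y) (\<lambda>_. False) (\<lambda>_. Zset K)"

lemma concordant_iff:
  "x \<in> concordant N K y \<longleftrightarrow>
    (\<forall>d. (d \<in> active N y \<longrightarrow> x d \<in> Zset K) \<and> (d \<notin> active N y \<longrightarrow> x d = (\<lambda>_. False)))"
  unfolding concordant_def PiE_dflt_def by (rule mem_Collect_eq)

lemma concordant_Zset: "x \<in> concordant N K y \<Longrightarrow> d \<in> active N y \<Longrightarrow> x d \<in> Zset K"
  unfolding concordant_iff by blast

lemma concordant_inactive: "x \<in> concordant N K y \<Longrightarrow> d \<notin> active N y \<Longrightarrow> x d = (\<lambda>_. False)"
  unfolding concordant_iff by blast

lemma XX_D: "x \<in> XX N K \<Longrightarrow> x d k \<Longrightarrow> d \<in> dyads N \<and> k \<in> {1..K}"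
  unfolding XX_def by blast

definition active_list :: "nat \<Rightarrow> (nat \<times> nat \<Rightarrow> bool) \<Rightarrow> (nat \<times> nat) list" where
  "active_list N y = (SOME ds. set ds = active N y \<and> distinct ds)"

lemma active_list: "set (active_list N y) = active N y" "distinct (active_list N y)"
proof -
  have "\<exists>ds. set ds = active N y \<and> distinct ds"
    using finite_distinct_list[OF finite_active] .
  from someI_ex[OF this] show "set (active_list N y) = active N y" "distinct (active_list N y)"
    by (auto simp: active_list_def)
qed

lemma length_active_list: "length (active_list N y) = card (active N y)"
  using distinct_card[OF active_list(2), of N y] by (simp add: active_list(1))

lemma finite_XX: "finite (XX N K)"
proof (rule finite_subset)
  show "XX N K \<subseteq> PiE_dflt (dyads N) (\<lambda>_. False) (\<lambda>_. (\<lambda>S k. k \<in> S) ` Pow {1..K})"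
  proof
    fix x assume x: "x \<in> XX N K"
    have "x d \<in> (\<lambda>S k. k \<in> S) ` Pow {1..K}" for d
    proof -
      have "x d = (\<lambda>k. k \<in> {k. x d k})" "{k. x d k} \<in> Pow {1..K}" using XX_D[OF x, of d] by auto
      then show ?thesis by blast
    qed
    moreover have "x d = (\<lambda>_. False)" if "d \<notin> dyads N" for d
      using XX_D[OF x] that by blast
    ultimately show "x \<in> PiE_dflt (dyads N) (\<lambda>_. False) (\<lambda>_. (\<lambda>S k. k \<in> S) ` Pow {1..K})"
      by (simp add: PiE_dflt_def)
  qed
qed (intro finite_PiE_dflt finite_dyads, simp)

lemma concordant_subset: "concordant N K y \<subseteq> XX N K"
proof
  fix x assume x: "x \<in> concordant N K y"
  show "x \<in> XX N K"
    unfolding XX_def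
  proof (intro CollectI allI impI)
    fix d k assume xdk: "x d k"
    then have "d \<in> active N y" using concordant_inactive[OF x] by (metis (full_types))
    moreover from this have "x d \<in> Zset K" by (rule concordant_Zset[OF x])
    ultimately show "d \<in> dyads N \<and> k \<in> {1..K}" using xdk by (auto simp: active_def Zset_def)
  qed
qed

lemma hmod_eq:
  assumes x: "x \<in> XX N K" and y: "y \<in> YY N"
  shows "hmod N K x y = ind (x \<in> concordant N K y)"
proof (cases "x \<in> concordant N K y")
  case True
  have "(\<exists>k\<in>{1..K}. x d k) = y d" if d: "d \<in> dyads N" for d
  proof (cases "y d")
    case t: True
    then have "x d \<in> Zset K" using d by (intro concordant_Zset[OF True]) (simp add: active_def)
    with t show ?thesis by (simp add: Zset_def)
  next
    case False
    then have "x d = (\<lambda>_. False)" by (intro concordant_inactive[OF True]) (simp add: active_def)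
    with False show ?thesis by simp
  qed
  with True show ?thesis by (simp add: hmod_def ind_def)
next
  case False
  have "\<exists>d\<in>dyads N. (\<exists>k\<in>{1..K}. x d k) \<noteq> y d"
  proof (rule ccontr)
    assume "\<not> ?thesis"
    then have e: "(\<exists>k\<in>{1..K}. x d k) = y d" if "d \<in> dyads N" for d using that by blast
    have "x \<in> concordant N K y"
      unfolding concordant_iff
    proof (intro allI conjI impI)
      fix d
      show "x d \<in> Zset K" if "d \<in> active N y"
        using that e[of d] XX_D[OF x, of d] unfolding active_def Zset_def by blast
      show "x d = (\<lambda>_. False)" if "d \<notin> active N y"
        using that e[of d] XX_D[OF x, of d] unfolding active_def by blast
    qed
    with False show False by simp
  qed
  then obtain d where "d \<in> dyads N" "(\<exists>k\<in>{1..K}. x d k) \<noteq> y d" by blast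
  then have "hmod N K x y = 0"
    unfolding hmod_def by (intro prod_zero finite_dyads) (auto simp: ind_def)
  with False show ?thesis by (simp add: ind_def)
qed

text \<open>By trichotomy of the lexicographic order the square splits into the diagonal and two
  mirror halves with equal sums.\<close>

lemma lexicographic_split:
  fixes f :: "nat \<times> nat \<Rightarrow> nat \<times> nat \<Rightarrow> real"
  assumes A: "finite A" and sym: "\<And>d e. f d e = f e d"
  shows "(\<Sum>d\<in>A. \<Sum>e\<in>A. f d e) = (\<Sum>d\<in>A. f d d) + 2 * (\<Sum>(d,e)\<in>{(d,e). d \<in> A \<and> e \<in> A \<and> dyad_prec d e}. f d e)"
proof -
  define P where "P = {(d,e). d \<in> A \<and> e \<in> A \<and> dyad_prec d e}"
  define P' where "P' = {(d,e). d \<in> A \<and> e \<in> A \<and> dyad_prec e d}"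
  define E where "E = (\<lambda>d. (d, d)) ` A"
  have fin: "finite P" "finite P'" "finite E"
    by (rule finite_subset[of _ "A \<times> A"]; use A in \<open>auto simp: P_def P'_def E_def\<close>)+
  have "A \<times> A = E \<union> (P \<union> P')"
  proof (intro set_eqI)
    fix w :: "(nat \<times> nat) \<times> (nat \<times> nat)"
    have "fst w = snd w \<or> dyad_prec (fst w) (snd w) \<or> dyad_prec (snd w) (fst w)"
      unfolding dyad_prec_def prod_eq_iff by linarith
    then show "w \<in> A \<times> A \<longleftrightarrow> w \<in> E \<union> (P \<union> P')"
      by (cases w) (auto simp: E_def P_def P'_def)
  qed
  moreover have "E \<inter> (P \<union> P') = {}" "P \<inter> P' = {}"
    by (auto simp: E_def P_def P'_def dyad_prec_def)
  ultimately have "(\<Sum>w\<in>A \<times> A. f (fst w) (snd w))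
      = (\<Sum>w\<in>E. f (fst w) (snd w)) + ((\<Sum>w\<in>P. f (fst w) (snd w)) + (\<Sum>w\<in>P'. f (fst w) (snd w)))"
    using fin by (simp add: sum.union_disjoint)
  also have "(\<Sum>w\<in>P'. f (fst w) (snd w)) = (\<Sum>w\<in>P. f (fst w) (snd w))"
    by (rule sum.reindex_bij_witness[of _ prod.swap prod.swap]) (auto simp: P_def P'_def sym)
  also have "(\<Sum>w\<in>E. f (fst w) (snd w)) = (\<Sum>d\<in>A. f d d)"
    unfolding E_def by (subst sum.reindex) (auto simp: inj_on_def)
  finally show ?thesis
    by (simp add: sum.cartesian_product case_prod_unfold P_def)
qed

locale network_model = dyad_model +
  fixes N :: nat and g :: "(nat \<times> nat \<Rightarrow> bool) \<Rightarrow> real"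
  assumes g_pos: "\<And>y. y \<in> YY N \<Longrightarrow> 0 < g y" and g_sum: "(\<Sum>y\<in>YY N. g y) = 1"
begin

abbreviation "A y \<equiv> active N y"
abbreviation "CX y \<equiv> concordant N K y"

text \<open>Inactive dyads contribute exponent 0 because every index set in \<open>Lfam\<close> is
  non-empty; an empty one would give the statistic 1 at the zero vector.\<close>

lemma fmod_eq:
  assumes x: "x \<in> CX y"
  shows "fmod N K H x \<theta> = (\<Prod>d\<in>A y. exp (ip I \<theta> (tvec (x d))))"
proof -
  have z: "ip I \<theta> (tvec (x d)) = 0" if "d \<in> dyads N - A y" for d
  proof -
    have xd: "x d = (\<lambda>_. False)" using that by (intro concordant_inactive[OF x]) simp
    have "tvec (x d) L = 0" if L: "L \<in> I" for L
    proof -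
      have "L \<noteq> {}" using L by (auto simp: Lfam_def)
      then show ?thesis by (auto simp: xd tvec_def ind_def)
    qed
    then show ?thesis by (simp add: ip_def)
  qed
  have "(\<Sum>L\<in>I. \<theta> L * suff N x L) = (\<Sum>d\<in>dyads N. ip I \<theta> (tvec (x d)))"
    unfolding suff_def ip_def tvec_def sum_distrib_left by (rule sum.swap)
  also have "\<dots> = (\<Sum>d\<in>A y. ip I \<theta> (tvec (x d)))"
    by (rule sum.mono_neutral_right) (use z finite_dyads in \<open>auto simp: active_def\<close>)
  finally show ?thesis by (simp add: fmod_def exp_sum finite_active)
qed

text \<open>Inactive dyads are forced to zero, so the sum factors into one partition function per
  active dyad and depends on \<open>y\<close> only through their number.\<close>

lemma psi_eq:
  assumes y: "y \<in> YY N"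
  shows "psi N K H \<theta> y = 1 / (part \<theta>) ^ card (A y)"
proof -
  have "(\<Sum>x\<in>XX N K. fmod N K H x \<theta> * hmod N K x y) = (\<Sum>x\<in>CX y. fmod N K H x \<theta>)"
    by (rule sum.mono_neutral_cong_right[OF finite_XX concordant_subset])
      (use hmod_eq[OF _ y] hmod_eq[OF subsetD[OF concordant_subset] y] in \<open>simp_all add: ind_def\<close>)
  also have "\<dots> = (\<Sum>x\<in>CX y. \<Prod>d\<in>A y. exp (ip I \<theta> (tvec (x d))))"
    by (rule sum.cong) (simp_all add: fmod_eq)
  also have "\<dots> = (\<Prod>d\<in>A y. part \<theta>)"
    unfolding concordant_def part_def
    by (rule sum_prod_PiE_dflt) (auto simp: finite_active finite_Zset)
  finally show ?thesis by (simp add: psi_def)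
qed

lemma Pr_eq:
  assumes x: "x \<in> CX y" and y: "y \<in> YY N"
  shows "Pr N K H g \<theta> x y = g y * (\<Prod>d\<in>A y. Q \<theta> (x d))"
proof -
  have "hmod N K x y = 1" using hmod_eq[OF subsetD[OF concordant_subset x] y] x by (simp add: ind_def)
  moreover have "(\<Prod>d\<in>A y. Q \<theta> (x d)) = (\<Prod>d\<in>A y. exp (ip I \<theta> (tvec (x d))) / part \<theta>)"
    by (rule prod.cong) (auto simp: Q_eq concordant_Zset[OF x])
  ultimately show ?thesis
    by (simp add: Pr_def psi_eq[OF y] fmod_eq[OF x] prod_dividef)
qed

lemma Pr_eq_0: "x \<in> XX N K \<Longrightarrow> x \<notin> CX y \<Longrightarrow> y \<in> YY N \<Longrightarrow> Pr N K H g \<theta> x y = 0"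
  by (simp add: Pr_def hmod_eq ind_def)

lemma sum_Pr:
  assumes y: "y \<in> YY N"
  shows "(\<Sum>x\<in>XX N K. F x * Pr N K H g \<theta> x y) = g y * (\<Sum>x\<in>CX y. (\<Prod>d\<in>A y. Q \<theta> (x d)) * F x)"
proof -
  have "(\<Sum>x\<in>XX N K. F x * Pr N K H g \<theta> x y) = (\<Sum>x\<in>CX y. g y * ((\<Prod>d\<in>A y. Q \<theta> (x d)) * F x))"
    by (rule sum.mono_neutral_cong_right[OF finite_XX concordant_subset])
      (use Pr_eq[OF _ y] Pr_eq_0[OF _ _ y] in auto)
  then show ?thesis by (simp add: sum_distrib_left)
qed

lemma sum_Q_list:
  "(\<Sum>x\<in>CX y. (\<Prod>d\<in>A y. Q \<theta> (x d)) * F (map x (active_list N y))) = EL ZK (Q \<theta>) (card (A y)) F"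
  using sum_PiE_dflt_EL[OF active_list(2)[of N y] finite_Zset[of K],
      where dflt = "\<lambda>_. False" and q = "Q \<theta>" and F = F]
  by (simp add: active_list(1) length_active_list concordant_def)

lemma sum_Q_const: "(\<Sum>x\<in>CX y. (\<Prod>d\<in>A y. Q \<theta> (x d)) * c) = c"
  using sum_Q_list[where F = "\<lambda>_. c"] fin_pmf.EL_const[OF Q_fin_pmf] by simp

text \<open>\<open>psi\<close> normalizes the layers for each \<open>y\<close> separately, so the
  basis network has law \<open>g\<close> for every parameter.\<close>

lemma expec_Y: "expec N K H g \<theta> (\<lambda>x y. F y) = (\<Sum>y\<in>YY N. g y * F y)"
proof -
  have "expec N K H g \<theta> (\<lambda>x y. F y) = (\<Sum>y\<in>YY N. \<Sum>x\<in>XX N K. F y * Pr N K H g \<theta> x y)"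
    unfolding expec_def by (subst sum.cartesian_product[symmetric]) (rule sum.swap)
  also have "\<dots> = (\<Sum>y\<in>YY N. g y * F y)"
    by (rule sum.cong[OF refl]) (simp add: sum_Pr sum_Q_const)
  finally show ?thesis .
qed

text \<open>Conditionally on \<open>y\<close> the active dyads are an independent sample from the single-dyad model.\<close>
lemma prob_ev_lower:
  assumes E: "\<And>x y. y \<in> YY N \<Longrightarrow> x \<in> CX y \<Longrightarrow> \<not> Bad (map x (active_list N y)) \<Longrightarrow> E x y"
  shows "1 - (\<Sum>y\<in>YY N. g y * EL ZK (Q \<theta>) (card (A y)) (\<lambda>zs. ind (Bad zs))) \<le> prob_ev N K H g \<theta> E"
proof -
  have "(\<Sum>y\<in>YY N. g y * (1 - EL ZK (Q \<theta>) (card (A y)) (\<lambda>zs. ind (Bad zs))))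
      \<le> (\<Sum>y\<in>YY N. g y * (\<Sum>x\<in>CX y. (\<Prod>d\<in>A y. Q \<theta> (x d)) * ind (E x y)))"
  proof (intro sum_mono mult_left_mono)
    fix y assume y: "y \<in> YY N"
    interpret fin_pmf ZK "Q \<theta>" by (rule Q_fin_pmf)
    have "1 - EL ZK (Q \<theta>) (card (A y)) (\<lambda>zs. ind (Bad zs)) = EL ZK (Q \<theta>) (card (A y)) (\<lambda>zs. 1 - ind (Bad zs))"
      by (simp add: EL_diff)
    also have "\<dots> = (\<Sum>x\<in>CX y. (\<Prod>d\<in>A y. Q \<theta> (x d)) * (1 - ind (Bad (map x (active_list N y)))))"
      by (rule sum_Q_list[symmetric])
    also have "\<dots> \<le> (\<Sum>x\<in>CX y. (\<Prod>d\<in>A y. Q \<theta> (x d)) * ind (E x y))"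
    proof (intro sum_mono mult_left_mono prod_nonneg)
      fix x assume x: "x \<in> CX y"
      show "1 - ind (Bad (map x (active_list N y))) \<le> ind (E x y)"
        using E[OF y x] by (auto simp: ind_def)
      show "0 \<le> Q \<theta> (x d)" if "d \<in> A y" for d
        using q_nonneg[OF concordant_Zset[OF x that]] .
    qed
    finally show "1 - EL ZK (Q \<theta>) (card (A y)) (\<lambda>zs. ind (Bad zs)) \<le> \<dots>" .
    show "0 \<le> g y" using g_pos[OF y] by simp
  qed
  also have "\<dots> = (\<Sum>y\<in>YY N. \<Sum>x\<in>XX N K. ind (E x y) * Pr N K H g \<theta> x y)"
    by (rule sum.cong[OF refl]) (simp add: sum_Pr)
  also have "\<dots> = prob_ev N K H g \<theta> E"
    unfolding prob_ev_def by (subst sum.cartesian_product[symmetric]) (rule sum.swap)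
  finally show ?thesis by (simp add: right_diff_distrib sum_subtractf g_sum)
qed

lemma EY1_eq: "EY1 N K H g \<theta> = (\<Sum>y\<in>YY N. g y * card (A y))"
  unfolding EY1_def expec_Y by (simp add: active_def)

lemma EY1_le: "EY1 N K H g \<theta> \<le> (real N)\<^sup>2"
proof -
  have "EY1 N K H g \<theta> \<le> (\<Sum>y\<in>YY N. g y * (real N)\<^sup>2)"
    unfolding EY1_eq
  proof (intro sum_mono mult_left_mono)
    fix y assume "y \<in> YY N"
    show "0 \<le> g y" using g_pos[OF \<open>y \<in> YY N\<close>] by simp
    have "card (A y) \<le> card (dyads N)" by (rule card_mono[OF finite_dyads]) (auto simp: active_def)
    with card_dyads_le[of N] have "card (A y) \<le> N\<^sup>2" by linarith
    then show "real (card (A y)) \<le> (real N)\<^sup>2" by (metis of_nat_le_iff of_nat_power)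
  qed
  also have "\<dots> = (real N)\<^sup>2" by (simp add: sum_distrib_right[symmetric] g_sum)
  finally show ?thesis .
qed

text \<open>For indicators the diagonal covariances are at most the means, and the off-diagonal ones
  add up to twice \<open>Dg\<close>.\<close>

lemma variance_le:
  "(\<Sum>y\<in>YY N. g y * (card (A y) - EY1 N K H g \<theta>)\<^sup>2) \<le> EY1 N K H g \<theta> + 2 * max 0 (Dg N K H g \<theta>)"
proof -
  define E where "E F = (\<Sum>y\<in>YY N. g y * F y)" for F :: "(nat \<times> nat \<Rightarrow> bool) \<Rightarrow> real"
  define a where "a d y = ind (y d)" for d :: "nat \<times> nat" and y
  define m where "m = EY1 N K H g \<theta>"
  have card: "real (card (A y)) = (\<Sum>d\<in>dyads N. a d y)" for y
  proof -
    have "(\<Sum>d\<in>dyads N. a d y) = (\<Sum>d\<in>A y. 1)"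
      by (rule sum.mono_neutral_cong_right) (auto simp: finite_dyads active_def a_def ind_def)
    then show ?thesis by simp
  qed
  have E_sum: "E (\<lambda>y. \<Sum>d\<in>dyads N. F d y) = (\<Sum>d\<in>dyads N. E (F d))" for F
    unfolding E_def sum_distrib_left by (rule sum.swap)
  have m: "m = (\<Sum>d\<in>dyads N. E (a d))"
    unfolding m_def EY1_eq card E_sum[symmetric] by (simp add: E_def)
  have cov: "covY N K H g \<theta> d e = E (\<lambda>y. a d y * a e y) - E (a d) * E (a e)" for d e
    unfolding covY_def expec_Y by (simp add: E_def a_def[abs_def])
  have "(\<Sum>y\<in>YY N. g y * (card (A y) - m)\<^sup>2) = E (\<lambda>y. (real (card (A y)))\<^sup>2) - m\<^sup>2"
  proof -
    have "(\<Sum>y\<in>YY N. g y * (card (A y) - m)\<^sup>2)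
        = (\<Sum>y\<in>YY N. g y * (real (card (A y)))\<^sup>2) - 2 * m * (\<Sum>y\<in>YY N. g y * card (A y)) + m\<^sup>2 * (\<Sum>y\<in>YY N. g y)"
      by (simp add: power2_eq_square algebra_simps sum.distrib sum_subtractf sum_distrib_left)
    then show ?thesis unfolding g_sum E_def EY1_eq[symmetric, of \<theta>] m_def[symmetric]
      by (simp add: power2_eq_square)
  qed
  also have "\<dots> = (\<Sum>d\<in>dyads N. \<Sum>e\<in>dyads N. covY N K H g \<theta> d e)"
  proof -
    have "E (\<lambda>y. (real (card (A y)))\<^sup>2) = (\<Sum>d\<in>dyads N. \<Sum>e\<in>dyads N. E (\<lambda>y. a d y * a e y))"
      unfolding card power2_eq_square sum_product E_sum ..
    moreover have "m\<^sup>2 = (\<Sum>d\<in>dyads N. \<Sum>e\<in>dyads N. E (a d) * E (a e))"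
      unfolding m power2_eq_square sum_product ..
    ultimately show ?thesis by (simp add: cov sum_subtractf)
  qed
  also have "\<dots> = (\<Sum>d\<in>dyads N. covY N K H g \<theta> d d) + 2 * Dg N K H g \<theta>"
    unfolding Dg_def
    by (rule lexicographic_split[OF finite_dyads]) (simp add: cov mult.commute)
  also have "(\<Sum>d\<in>dyads N. covY N K H g \<theta> d d) \<le> (\<Sum>d\<in>dyads N. E (a d))"
  proof (rule sum_mono)
    fix d
    have "(\<lambda>y. a d y * a d y) = a d" by (auto simp: a_def ind_def)
    then show "covY N K H g \<theta> d d \<le> E (a d)" unfolding cov by simp
  qed
  finally show ?thesis unfolding m[symmetric] by (simp add: m_def)
qed

subsection \<open>Likelihood and pseudolikelihood of concordant pairs\<close>

lemma sum_active_list: "(\<Sum>d\<in>A y. f (x d)) = (\<Sum>z\<leftarrow>map x (active_list N y). f z)" for f :: "_ \<Rightarrow> real"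
  using sum.distinct_set_conv_list[OF active_list(2), of "\<lambda>d. f (x d)" N y] by (simp add: active_list(1) o_def)

lemma loglik_eq:
  assumes x: "x \<in> CX y" and y: "y \<in> YY N"
  shows "loglik N K H g \<theta> x y = ln (g y) - (\<Sum>z\<leftarrow>map x (active_list N y). nll \<theta> z)"
proof -
  have pos: "0 < Q \<theta> (x d)" if "d \<in> A y" for d using Q_pos[OF concordant_Zset[OF x that]] .
  have "loglik N K H g \<theta> x y = ln (g y) + (\<Sum>d\<in>A y. ln (Q \<theta> (x d)))"
  proof -
    have "0 < (\<Prod>d\<in>A y. Q \<theta> (x d))" by (rule prod_pos) (rule pos)
    moreover have "ln (\<Prod>d\<in>A y. Q \<theta> (x d)) = (\<Sum>d\<in>A y. ln (Q \<theta> (x d)))"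
    proof (rule ln_prod[OF finite_active])
      fix d assume "d \<in> A y"
      from pos[OF this] show "Q \<theta> (x d) \<noteq> 0" by simp
    qed
    ultimately show ?thesis
      unfolding loglik_def Pr_eq[OF x y] using g_pos[OF y] by (simp add: ln_mult)
  qed
  also have "(\<Sum>d\<in>A y. ln (Q \<theta> (x d))) = - (\<Sum>d\<in>A y. nll \<theta> (x d))"
    by (simp add: nll_def sum_negf)
  finally show ?thesis unfolding sum_active_list by simp
qed

lemma sum_Q_marginal:
  assumes d: "d \<in> A y"
  shows "(\<Sum>x\<in>CX y. (\<Prod>e\<in>A y. Q \<theta> (x e)) * h (x d)) = (\<Sum>z\<in>ZK. Q \<theta> z * h z)"
proof -
  interpret fin_pmf ZK "Q \<theta>" by (rule Q_fin_pmf)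
  let ?f = "\<lambda>e z. Q \<theta> z * (if e = d then h z else 1)"
  have "(\<Sum>x\<in>CX y. (\<Prod>e\<in>A y. Q \<theta> (x e)) * h (x d)) = (\<Sum>x\<in>CX y. \<Prod>e\<in>A y. ?f e (x e))"
    by (rule sum.cong[OF refl]) (simp add: prod.distrib finite_active d)
  also have "\<dots> = (\<Prod>e\<in>A y. \<Sum>z\<in>ZK. ?f e z)"
    unfolding concordant_def by (rule sum_prod_PiE_dflt) (auto simp: finite_active finite_Zset)
  also have "\<dots> = (\<Prod>e\<in>A y. if e = d then \<Sum>z\<in>ZK. Q \<theta> z * h z else 1)"
    by (rule prod.cong) (auto simp: q_sum)
  also have "\<dots> = (\<Sum>z\<in>ZK. Q \<theta> z * h z)" by (simp add: finite_active d)
  finally show ?thesis .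
qed

text \<open>Given \<open>y\<close> the dyads are independent, so all other dyads and the factor
  \<open>g y\<close> cancel from the quotient.\<close>

lemma condP_active:
  assumes x: "x \<in> CX y" and y: "y \<in> YY N" and d: "d \<in> A y"
  shows "condP N K H g \<theta> x y d k = Qcond K H \<theta> (x d) k"
proof -
  have xd: "x d \<in> ZK" by (rule concordant_Zset[OF x d])
  have "(\<Sum>x'\<in>XX N K. ind (x' d = x d) * Pr N K H g \<theta> x' y) = g y * (\<Sum>z\<in>ZK. Q \<theta> z * ind (z = x d))"
    unfolding sum_Pr[OF y] by (subst sum_Q_marginal[OF d, of \<theta> "\<lambda>z. ind (z = x d)"]) simp
  also have "(\<Sum>z\<in>ZK. Q \<theta> z * ind (z = x d)) = Q \<theta> (x d)"
    using xd finite_Zset by (simp add: ind_def if_distrib[of "\<lambda>c. _ * c"] cong: if_cong)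
  finally have num: "(\<Sum>x'\<in>XX N K. ind (x' d = x d) * Pr N K H g \<theta> x' y) = g y * Q \<theta> (x d)" .
  have den: "(\<Sum>x'\<in>XX N K. ind (\<forall>j. j \<noteq> k \<longrightarrow> x' d j = x d j) * Pr N K H g \<theta> x' y)
      = g y * (\<Sum>z\<in>ZK. ind (\<forall>j. j \<noteq> k \<longrightarrow> z j = x d j) * Q \<theta> z)"
    unfolding sum_Pr[OF y]
    by (subst sum_Q_marginal[OF d, of \<theta> "\<lambda>z. ind (\<forall>j. j \<noteq> k \<longrightarrow> z j = x d j)"]) (simp add: mult.commute)
  show ?thesis
    unfolding condP_def num den Qcond_def using g_pos[OF y] by simp
qed

text \<open>Given \<open>y\<close> an inactive dyad vanishes surely, so both sums equal
  \<open>g y\<close> and its terms drop out of the log-pseudolikelihood.\<close>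

lemma condP_inactive:
  assumes x: "x \<in> CX y" and y: "y \<in> YY N" and d: "d \<notin> A y"
  shows "condP N K H g \<theta> x y d k = 1"
proof -
  have eq: "x' d = x d" if "x' \<in> CX y" for x'
    using concordant_inactive[OF that d] concordant_inactive[OF x d] by simp
  have num: "(\<Sum>x'\<in>XX N K. ind (x' d = x d) * Pr N K H g \<theta> x' y) = g y"
  proof -
    have "(\<Sum>x'\<in>CX y. (\<Prod>e\<in>A y. Q \<theta> (x' e)) * ind (x' d = x d)) = (\<Sum>x'\<in>CX y. (\<Prod>e\<in>A y. Q \<theta> (x' e)) * 1)"
      by (rule sum.cong[OF refl]) (simp add: eq ind_def)
    then show ?thesis unfolding sum_Pr[OF y] sum_Q_const by simp
  qed
  have den: "(\<Sum>x'\<in>XX N K. ind (\<forall>j. j \<noteq> k \<longrightarrow> x' d j = x d j) * Pr N K H g \<theta> x' y) = g y"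
  proof -
    have "(\<Sum>x'\<in>CX y. (\<Prod>e\<in>A y. Q \<theta> (x' e)) * ind (\<forall>j. j \<noteq> k \<longrightarrow> x' d j = x d j)) = (\<Sum>x'\<in>CX y. (\<Prod>e\<in>A y. Q \<theta> (x' e)) * 1)"
      by (rule sum.cong[OF refl]) (simp add: eq ind_def)
    then show ?thesis unfolding sum_Pr[OF y] sum_Q_const by simp
  qed
  show ?thesis unfolding condP_def num den using g_pos[OF y] by simp
qed

lemma pseudolik_eq:
  assumes x: "x \<in> CX y" and y: "y \<in> YY N"
  shows "pseudolik N K H g \<theta> x y = 0 - (\<Sum>z\<leftarrow>map x (active_list N y). npl \<theta> z)"
proof -
  have "pseudolik N K H g \<theta> x y = (\<Sum>d\<in>A y. \<Sum>k\<in>{1..K}. ln (condP N K H g \<theta> x y d k))"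
    unfolding pseudolik_def
    by (rule sum.mono_neutral_right) (auto simp: finite_dyads active_def condP_inactive[OF x y])
  also have "\<dots> = (\<Sum>d\<in>A y. - npl \<theta> (x d))"
    by (rule sum.cong[OF refl]) (simp add: condP_active[OF x y] npl_def)
  also have "\<dots> = - (\<Sum>d\<in>A y. npl \<theta> (x d))" by (simp add: sum_negf)
  finally show ?thesis unfolding sum_active_list by simp
qed

end

section \<open>From conditional error bounds to the two estimators\<close>

context network_model
begin

text \<open>Separates the radius into dimension and noise: the last root is the scale \<tau> per
  score coordinate, free of \<open>p\<close> and \<open>K\<close>. The factor \<open>c\<close> is 1
  for the likelihood and \<open>K\<close> for the pseudolikelihood.\<close>

lemma radius_eq:
  fixes m D x :: real
  assumes "0 < m" "0 \<le> D" "1 \<le> real N" "0 < x" "0 \<le> c"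
  shows "x * (sqrt (3 * real (card I) * c\<^sup>2 * ln (real N) / m) * sqrt (1 + D) / x)
    = c * sqrt (card I) * sqrt (3 * ln (real N) * (1 + D) / m)"
proof -
  have "3 * real (card I) * c\<^sup>2 * ln (real N) / m * (1 + D) = c\<^sup>2 * (card I * (3 * ln (real N) * (1 + D) / m))"
    by simp
  then have "sqrt (3 * real (card I) * c\<^sup>2 * ln (real N) / m) * sqrt (1 + D)
      = c * sqrt (card I) * sqrt (3 * ln (real N) * (1 + D) / m)"
    using assms by (simp only: real_sqrt_mult[symmetric]) (simp only: real_sqrt_mult, simp)
  then show ?thesis using assms by simp
qed

lemma average_failure:
  fixes \<theta>s :: "nat set \<Rightarrow> real" and Bad :: "(nat \<Rightarrow> bool) list \<Rightarrow> bool"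
  defines "m \<equiv> EY1 N K H g \<theta>s" and "D \<equiv> max 0 (Dg N K H g \<theta>s)"
  defines "\<tau> \<equiv> sqrt (3 * ln (real N) * (1 + D) / m)"
  assumes m: "1 \<le> m" and N: "2560000 \<le> ln (real N)" and p: "card I \<le> N" and \<tau>: "\<tau> \<le> 1 / 1000000"
    and bad: "\<And>n. 0 < n \<Longrightarrow> 2560000 \<le> real n * \<tau>\<^sup>2 \<Longrightarrow>
      EL ZK (Q \<theta>s) n (\<lambda>zs. ind (Bad zs)) \<le> 2 * real (card I) * exp (- 81 / 50 * (n * \<tau>\<^sup>2)) + exp (- (n * \<tau>) / 60800)"
  shows "(\<Sum>y\<in>YY N. g y * EL ZK (Q \<theta>s) (card (A y)) (\<lambda>zs. ind (Bad zs))) \<le> 3 / m"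
proof -
  interpret fin_pmf ZK "Q \<theta>s" by (rule Q_fin_pmf)
  have D: "0 \<le> D" by (simp add: D_def)
  have pos: "0 < 3 * ln (real N) * (1 + D) / m" using N D m by (intro divide_pos_pos mult_pos_pos) auto
  show ?thesis
  proof (rule sample_size_average[OF finite_YY _ g_sum _ m _ D N _ _ _ \<tau> _ _ bad])
    show "(\<Sum>y\<in>YY N. g y * (card (A y) - m)\<^sup>2) \<le> m + 2 * D" unfolding m_def D_def by (rule variance_le)
    show "m \<le> (real N)\<^sup>2" unfolding m_def by (rule EY1_le)
    show "0 < \<tau>" using pos by (simp add: \<tau>_def)
    show "\<tau>\<^sup>2 = 3 * ln (real N) * (1 + D) / m" using pos by (simp add: \<tau>_def)
    show "EL ZK (Q \<theta>s) n (\<lambda>zs. ind (Bad zs)) \<le> 1" for n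
      using EL_mono[of n "\<lambda>zs. ind (Bad zs)" "\<lambda>_. 1"] by (simp add: ind_def)
  qed (use p g_pos in \<open>auto intro: less_imp_le\<close>)
qed

lemma mle_probability:
  fixes \<theta>s :: "nat set \<Rightarrow> real" and \<epsilon> :: real
  defines "m \<equiv> EY1 N K H g \<theta>s" and "D \<equiv> max 0 (Dg N K H g \<theta>s)" and "x \<equiv> xi K H \<theta>s \<epsilon>"
  defines "\<delta> \<equiv> sqrt (3 * real (pdim K H) * ln (real N) / m) * sqrt (1 + D) / x"
  assumes \<theta>s: "\<theta>s \<in> Theta K H" and m: "1 \<le> m" and N: "2560000 \<le> ln (real N)" and p: "pdim K H \<le> N"
    and x: "0 < x" and \<delta>: "\<delta> \<le> \<epsilon>" "\<delta> \<le> 1 / 1000000"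
  shows "1 - 3 / m \<le> prob_ev N K H g \<theta>s (\<lambda>x y. \<exists>\<theta>h. argmax_Theta K H (\<lambda>\<theta>. loglik N K H g \<theta> x y) = {\<theta>h} \<and>
      norm2 K H (\<lambda>L. \<theta>h L - \<theta>s L) \<le> \<delta>)"
proof -
  interpret fin_pmf ZK "Q \<theta>s" by (rule Q_fin_pmf)
  define \<tau> where "\<tau> = sqrt (3 * ln (real N) * (1 + D) / m)"
  have D: "0 \<le> D" by (simp add: D_def)
  have N1: "1 \<le> real N" using N by (cases "N = 0") auto
  have p1: "1 \<le> sqrt (card I)" using card_I_pos by simp
  have \<tau>0: "0 < \<tau>" using N D m by (simp add: \<tau>_def)
  have x\<delta>: "x * \<delta> = sqrt (card I) * \<tau>"
    using radius_eq[of m D x 1] m D N1 x by (simp add: \<delta>_def \<tau>_def pdim_def)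
  have \<delta>0: "0 < \<delta>"
  proof -
    have "0 < x * \<delta>" unfolding x\<delta> using \<tau>0 p1 by simp
    then show ?thesis using x by (simp add: zero_less_mult_iff)
  qed
  have x4: "x \<le> 1 / 4" unfolding x_def by (rule xi_le_quarter[OF \<theta>s]) (use \<delta>0 \<delta> in simp)
  \<comment> \<open>The bound 1/4 on \<open>x\<close> yields
    \<open>\<tau> \<le> x * \<delta> \<le> \<delta> / 4\<close>, so a small radius makes \<tau>
    small.\<close>
  have "\<tau> \<le> sqrt (card I) * \<tau>" using mult_right_mono[OF p1, of \<tau>] \<tau>0 by simp
  also have "\<dots> \<le> 1 / 4 * \<delta>" unfolding x\<delta>[symmetric] using x4 \<delta>0 by (intro mult_right_mono) auto
  finally have \<tau>1: "\<tau> \<le> 1 / 1000000" using \<delta> \<delta>0 by linarith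
  define Sp where "Sp zs \<longleftrightarrow> (\<exists>D\<in>supp_on I. nrm I D = \<delta> \<and>
        \<not> (\<Sum>z\<leftarrow>zs. nll (\<lambda>L. \<theta>s L + (1 - 1 / 20) * D L) z) < (\<Sum>z\<leftarrow>zs. nll (\<lambda>L. \<theta>s L + D L) z))" for zs
  \<comment> \<open>The empty sample is declared bad because uniqueness needs at least one active
    dyad; for positive \<open>n\<close> the two events coincide.\<close>
  define Bad where "Bad zs \<longleftrightarrow> zs = [] \<or> Sp zs" for zs
  have "(\<Sum>y\<in>YY N. g y * EL ZK (Q \<theta>s) (card (A y)) (\<lambda>zs. ind (Bad zs))) \<le> 3 / m"
    unfolding m_def
  proof (rule average_failure)
    fix n :: nat assume n: "0 < n"
    have "EL ZK (Q \<theta>s) n (\<lambda>zs. ind (Bad zs)) = EL ZK (Q \<theta>s) n (\<lambda>zs. ind (Sp zs))"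
      by (rule EL_cong) (use n in \<open>auto simp: Bad_def lists_n_def\<close>)
    also have "\<dots> \<le> 2 * real (card I) * exp (- 2 * (9 / 10 * n * \<tau>)\<^sup>2 / n)"
      unfolding Sp_def
    proof (rule nll_localization[OF \<theta>s x[unfolded x_def] \<delta>0 \<delta>(1) n])
      show "sqrt (card I) * (9 / 10 * n * \<tau>) \<le> 9 / 10 * n * (xi K H \<theta>s \<epsilon> * \<delta>)"
        using x\<delta> by (simp add: x_def)
    qed (use n \<tau>0 in simp)
    also have "- 2 * (9 / 10 * n * \<tau>)\<^sup>2 / n = - 81 / 50 * (n * \<tau>\<^sup>2)"
      using n by (simp add: power2_eq_square)
    \<comment> \<open>The second exponential is pure slack here, since the likelihood remainder is
      deterministic; it fits the form shared by both estimators.\<close>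
    finally show "EL ZK (Q \<theta>s) n (\<lambda>zs. ind (Bad zs)) \<le> 2 * real (card I)
        * exp (- 81 / 50 * (n * (sqrt (3 * ln (real N) * (1 + max 0 (Dg N K H g \<theta>s)) / EY1 N K H g \<theta>s))\<^sup>2))
        + exp (- (n * sqrt (3 * ln (real N) * (1 + max 0 (Dg N K H g \<theta>s)) / EY1 N K H g \<theta>s)) / 60800)"
      unfolding D_def[symmetric] m_def[symmetric] \<tau>_def[symmetric] by (smt (verit) exp_gt_zero)
  qed (use m N p \<tau>1 in \<open>auto simp: m_def D_def \<tau>_def pdim_def\<close>)
  moreover have "1 - (\<Sum>y\<in>YY N. g y * EL ZK (Q \<theta>s) (card (A y)) (\<lambda>zs. ind (Bad zs)))
      \<le> prob_ev N K H g \<theta>s (\<lambda>x y. \<exists>\<theta>h. argmax_Theta K H (\<lambda>\<theta>. loglik N K H g \<theta> x y) = {\<theta>h} \<and>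
      norm2 K H (\<lambda>L. \<theta>h L - \<theta>s L) \<le> \<delta>)"
  proof (rule prob_ev_lower)
    fix c y assume y: "y \<in> YY N" and c: "c \<in> CX y" and nb: "\<not> Bad (map c (active_list N y))"
    show "\<exists>\<theta>h. argmax_Theta K H (\<lambda>\<theta>. loglik N K H g \<theta> c y) = {\<theta>h} \<and> norm2 K H (\<lambda>L. \<theta>h L - \<theta>s L) \<le> \<delta>"
    proof (rule nll_argmax[OF \<theta>s \<delta>0 \<delta>(1) x[unfolded x_def]])
      show "set (map c (active_list N y)) \<subseteq> ZK"
        using concordant_Zset[OF c] active_list(1)[of N y] by auto
      show "map c (active_list N y) \<noteq> []" using nb by (simp add: Bad_def)
      show "loglik N K H g \<theta> c y = ln (g y) - (\<Sum>z\<leftarrow>map c (active_list N y). nll \<theta> z)" for \<theta>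
        by (rule loglik_eq[OF c y])
      show "\<not> (\<exists>D\<in>supp_on I. nrm I D = \<delta> \<and>
        \<not> (\<Sum>z\<leftarrow>map c (active_list N y). nll (\<lambda>L. \<theta>s L + (1 - 1 / 20) * D L) z)
          < (\<Sum>z\<leftarrow>map c (active_list N y). nll (\<lambda>L. \<theta>s L + D L) z))"
        using nb unfolding Bad_def Sp_def by blast
    qed
  qed
  ultimately show ?thesis by linarith
qed

lemma mple_probability:
  fixes \<theta>s :: "nat set \<Rightarrow> real" and \<epsilon> :: real
  defines "m \<equiv> EY1 N K H g \<theta>s" and "D \<equiv> max 0 (Dg N K H g \<theta>s)" and "x \<equiv> xitil K H \<theta>s \<epsilon>"
  defines "\<delta> \<equiv> sqrt (3 * real (pdim K H) * (real K)\<^sup>2 * ln (real N) / m) * sqrt (1 + D) / x"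
  assumes \<theta>s: "\<theta>s \<in> Theta K H" and m: "1 \<le> m" and N: "2560000 \<le> ln (real N)" and p: "pdim K H \<le> N"
    and x: "0 < x" and \<delta>: "\<delta> \<le> \<epsilon>" "\<delta> \<le> 1 / 1000000"
  shows "1 - 3 / m \<le> prob_ev N K H g \<theta>s (\<lambda>x y. argmax_Theta K H (\<lambda>\<theta>. pseudolik N K H g \<theta> x y) \<noteq> {} \<and>
      (\<forall>\<theta>t\<in>argmax_Theta K H (\<lambda>\<theta>. pseudolik N K H g \<theta> x y). norm2 K H (\<lambda>L. \<theta>t L - \<theta>s L) \<le> \<delta>))"
proof -
  interpret fin_pmf ZK "Q \<theta>s" by (rule Q_fin_pmf)
  define \<tau> where "\<tau> = sqrt (3 * ln (real N) * (1 + D) / m)"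
  have D: "0 \<le> D" by (simp add: D_def)
  have N1: "1 \<le> real N" using N by (cases "N = 0") auto
  have K1: "1 \<le> real K" using K by simp
  have p1: "1 \<le> sqrt (card I)" using card_I_pos by simp
  have \<tau>0: "0 < \<tau>" using N D m by (simp add: \<tau>_def)
  have x\<delta>: "x * \<delta> = K * sqrt (card I) * \<tau>"
    using radius_eq[of m D x "real K"] m D N1 x by (simp add: \<delta>_def \<tau>_def pdim_def)
  have \<delta>0: "0 < \<delta>"
  proof -
    have "0 < x * \<delta>" unfolding x\<delta> using \<tau>0 p1 K1 by simp
    then show ?thesis using x by (simp add: zero_less_mult_iff)
  qed
  have x4: "x \<le> 1 / 4" unfolding x_def by (rule xitil_le_quarter[OF \<theta>s]) (use \<delta>0 \<delta> in simp)
  have "1 * 1 \<le> K * sqrt (card I)" using K1 p1 by (intro mult_mono) auto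
  then have "\<tau> \<le> K * sqrt (card I) * \<tau>" using mult_right_mono[of 1 "K * sqrt (card I)" \<tau>] \<tau>0 by simp
  also have "\<dots> \<le> 1 / 4 * \<delta>" unfolding x\<delta>[symmetric] using x4 \<delta>0 by (intro mult_right_mono) auto
  finally have \<tau>1: "\<tau> \<le> 1 / 1000000" using \<delta> \<delta>0 by linarith
  define Bad where "Bad zs \<longleftrightarrow> (\<exists>D\<in>supp_on I. nrm I D = \<delta> \<and>
        \<not> (\<Sum>z\<leftarrow>zs. npl (\<lambda>L. \<theta>s L + (1 - 1 / 20) * D L) z) < (\<Sum>z\<leftarrow>zs. npl (\<lambda>L. \<theta>s L + D L) z))" for zs
  have "(\<Sum>y\<in>YY N. g y * EL ZK (Q \<theta>s) (card (A y)) (\<lambda>zs. ind (Bad zs))) \<le> 3 / m"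
    unfolding m_def
  proof (rule average_failure)
    fix n :: nat
    assume n: "0 < n"
      and "2560000 \<le> real n * (sqrt (3 * ln (real N) * (1 + max 0 (Dg N K H g \<theta>s)) / EY1 N K H g \<theta>s))\<^sup>2"
    then have nt: "1600\<^sup>2 \<le> real n * \<tau>\<^sup>2" by (simp add: \<tau>_def D_def m_def)
    \<comment> \<open>Origin of the threshold 2560000 = 1600^2: as
      \<open>x * \<delta> = K * sqrt (card I) * \<tau>\<close>, the expected deviation
      \<open>2 * K * sqrt (n * card I)\<close> is at most \<open>n * (x * \<delta>) / 800\<close>
      exactly when \<open>sqrt n * \<tau> \<ge> 1600\<close>.\<close>
    have sq: "1600 \<le> sqrt n * \<tau>"
      by (rule power2_le_imp_le) (use nt n \<tau>0 in \<open>simp_all add: power_mult_distrib\<close>)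
    have "EL ZK (Q \<theta>s) n (\<lambda>zs. ind (Bad zs)) \<le> 2 * real (card I) * exp (- 2 * (9 / 10 * n * (K * \<tau>))\<^sup>2 / (n * (real K)\<^sup>2))
        + exp (- (n * (xitil K H \<theta>s \<epsilon> * \<delta>)) / (60800 * K * sqrt (card I)))"
      unfolding Bad_def
    proof (rule npl_localization[OF \<theta>s x[unfolded x_def] \<delta>0 \<delta>(1) n])
      show "sqrt (card I) * (9 / 10 * n * (K * \<tau>)) \<le> 9 / 10 * n * (xitil K H \<theta>s \<epsilon> * \<delta>)"
        using x\<delta> by (simp add: x_def)
      have "2 * K * sqrt (n * card I) = K * sqrt (card I) * sqrt n * (1600 / 800)"
        by (simp add: real_sqrt_mult)
      also have "\<dots> \<le> K * sqrt (card I) * sqrt n * (sqrt n * \<tau> / 800)"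
        using sq by (intro mult_left_mono divide_right_mono) auto
      also have "\<dots> = (sqrt n * sqrt n) * (K * sqrt (card I) * \<tau>) / 800" by simp
      also have "\<dots> = n * (xitil K H \<theta>s \<epsilon> * \<delta>) / 800" using x\<delta> by (simp add: x_def)
      finally show "2 * K * sqrt (n * card I) \<le> n * (xitil K H \<theta>s \<epsilon> * \<delta>) / 800" by simp
    qed (use n \<tau>0 K1 in simp)
    also have "- 2 * (9 / 10 * n * (K * \<tau>))\<^sup>2 / (n * (real K)\<^sup>2) = - 81 / 50 * (n * \<tau>\<^sup>2)"
      using n K1 by (simp add: power2_eq_square)
    also have "- (n * (xitil K H \<theta>s \<epsilon> * \<delta>)) / (60800 * K * sqrt (card I)) = - (n * \<tau>) / 60800"
    proof -
      have e: "n * (xitil K H \<theta>s \<epsilon> * \<delta>) = n * \<tau> * (K * sqrt (card I))" using x\<delta> by (simp add: x_def)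
      show ?thesis unfolding e using K1 p1 by simp
    qed
    finally show "EL ZK (Q \<theta>s) n (\<lambda>zs. ind (Bad zs)) \<le> 2 * real (card I)
        * exp (- 81 / 50 * (n * (sqrt (3 * ln (real N) * (1 + max 0 (Dg N K H g \<theta>s)) / EY1 N K H g \<theta>s))\<^sup>2))
        + exp (- (n * sqrt (3 * ln (real N) * (1 + max 0 (Dg N K H g \<theta>s)) / EY1 N K H g \<theta>s)) / 60800)"
      unfolding D_def[symmetric] m_def[symmetric] \<tau>_def[symmetric] .
  qed (use m N p \<tau>1 in \<open>auto simp: m_def D_def \<tau>_def pdim_def\<close>)
  moreover have "1 - (\<Sum>y\<in>YY N. g y * EL ZK (Q \<theta>s) (card (A y)) (\<lambda>zs. ind (Bad zs)))
      \<le> prob_ev N K H g \<theta>s (\<lambda>x y. argmax_Theta K H (\<lambda>\<theta>. pseudolik N K H g \<theta> x y) \<noteq> {} \<and>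
      (\<forall>\<theta>t\<in>argmax_Theta K H (\<lambda>\<theta>. pseudolik N K H g \<theta> x y). norm2 K H (\<lambda>L. \<theta>t L - \<theta>s L) \<le> \<delta>))"
  proof (rule prob_ev_lower)
    fix c y assume y: "y \<in> YY N" and c: "c \<in> CX y" and nb: "\<not> Bad (map c (active_list N y))"
    show "argmax_Theta K H (\<lambda>\<theta>. pseudolik N K H g \<theta> c y) \<noteq> {} \<and>
      (\<forall>\<theta>t\<in>argmax_Theta K H (\<lambda>\<theta>. pseudolik N K H g \<theta> c y). norm2 K H (\<lambda>L. \<theta>t L - \<theta>s L) \<le> \<delta>)"
    proof (rule npl_argmax[OF \<theta>s \<delta>0])
      show "set (map c (active_list N y)) \<subseteq> ZK"
        using concordant_Zset[OF c] active_list(1)[of N y] by auto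
      show "pseudolik N K H g \<theta> c y = 0 - (\<Sum>z\<leftarrow>map c (active_list N y). npl \<theta> z)" for \<theta>
        by (rule pseudolik_eq[OF c y])
      show "\<not> (\<exists>D\<in>supp_on I. nrm I D = \<delta> \<and>
        \<not> (\<Sum>z\<leftarrow>map c (active_list N y). npl (\<lambda>L. \<theta>s L + (1 - 1 / 20) * D L) z)
          < (\<Sum>z\<leftarrow>map c (active_list N y). npl (\<lambda>L. \<theta>s L + D L) z))"
        using nb unfolding Bad_def .
    qed
  qed
  ultimately show ?thesis by linarith
qed

end

text \<open>All asymptotics are confined here. For large \<open>N\<close> the radius is below
  \<open>\<epsilon>\<close>, which places the sphere inside the ball that defines the smallest
  eigenvalue, and below the numerical threshold, while \<open>ln N\<close> exceeds its own.\<close>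

lemma eventually_regime:
  fixes r x :: "nat \<Rightarrow> real"
  assumes reg: "eventually (\<lambda>N. 0 < x N) sequentially \<and> r \<longlonglongrightarrow> 0" and \<epsilon>: "0 < \<epsilon>"
    and P: "\<And>N. 3 \<le> N \<Longrightarrow> 2560000 \<le> ln (real N) \<Longrightarrow> 0 < x N \<Longrightarrow> r N \<le> \<epsilon> \<Longrightarrow> r N \<le> 1 / 1000000 \<Longrightarrow> P N"
  shows "\<exists>N0\<ge>3. \<forall>N\<ge>N0. P N"
proof -
  have "eventually (\<lambda>N. r N < \<epsilon>) sequentially" "eventually (\<lambda>N. r N < 1 / 1000000) sequentially"
    using order_tendstoD(2)[of r 0 sequentially \<epsilon>] order_tendstoD(2)[of r 0 sequentially "1 / 1000000"] reg \<epsilon>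
    by simp_all
  moreover have "filterlim (\<lambda>N. ln (real N)) at_top sequentially"
    by (rule filterlim_compose[OF ln_at_top filterlim_real_sequentially])
  then have "eventually (\<lambda>N. 2560000 \<le> ln (real N)) sequentially"
    by (simp add: filterlim_at_top)
  moreover have "eventually (\<lambda>N. 3 \<le> N) sequentially" by (rule eventually_ge_at_top)
  ultimately have "eventually P sequentially"
    using reg[THEN conjunct1] by eventually_elim (auto intro: P)
  then obtain N1 where "\<forall>N\<ge>N1. P N"
    unfolding eventually_sequentially by blast
  then show ?thesis by (intro exI[of _ "max 3 N1"]) auto
qed

text \<open>Each limit hypothesis includes eventual positivity of the eigenvalue infimum: division
  by zero yields 0 in HOL, so a vanishing infimum would otherwise satisfy the limit
  spuriously.\<close>

theorem theorem1:
  fixes K H :: "nat \<Rightarrow> nat"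
    and g :: "nat \<Rightarrow> (nat \<times> nat \<Rightarrow> bool) \<Rightarrow> real"
    and \<theta>s :: "nat \<Rightarrow> nat set \<Rightarrow> real"
    and \<epsilon> :: real
  assumes eps: "\<epsilon> > 0"
    and K: "\<And>N. N \<ge> 3 \<Longrightarrow> 1 \<le> K N"
    and H: "\<And>N. N \<ge> 3 \<Longrightarrow> 1 \<le> H N \<and> H N \<le> K N"
    and g_pos: "\<And>N y. N \<ge> 3 \<Longrightarrow> y \<in> YY N \<Longrightarrow> g N y > 0"
    and g_sum: "\<And>N. N \<ge> 3 \<Longrightarrow> (\<Sum>y\<in>YY N. g N y) = 1"
    and theta: "\<And>N. N \<ge> 3 \<Longrightarrow> \<theta>s N \<in> Theta (K N) (H N)"
    and EY: "\<And>N. N \<ge> 3 \<Longrightarrow> EY1 N (K N) (H N) (g N) (\<theta>s N) \<ge> 1"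
    and p_le: "\<And>N. N \<ge> 3 \<Longrightarrow> pdim (K N) (H N) \<le> N"
  shows
   "((eventually (\<lambda>N. xi (K N) (H N) (\<theta>s N) \<epsilon> > 0) sequentially \<and>
      (\<lambda>N. sqrt (3 * real (pdim (K N) (H N)) * ln (real N) / EY1 N (K N) (H N) (g N) (\<theta>s N))
           * sqrt (1 + max 0 (Dg N (K N) (H N) (g N) (\<theta>s N))) / xi (K N) (H N) (\<theta>s N) \<epsilon>)
        \<longlonglongrightarrow> 0)
    \<longrightarrow> (\<exists>N0\<ge>3. \<forall>N\<ge>N0.
          prob_ev N (K N) (H N) (g N) (\<theta>s N)
            (\<lambda>x y. \<exists>\<theta>h. argmax_Theta (K N) (H N) (\<lambda>\<theta>. loglik N (K N) (H N) (g N) \<theta> x y) = {\<theta>h} \<and>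
                 norm2 (K N) (H N) (\<lambda>L. \<theta>h L - \<theta>s N L) \<le>
                   sqrt (3 * real (pdim (K N) (H N)) * ln (real N) / EY1 N (K N) (H N) (g N) (\<theta>s N))
                   * sqrt (1 + max 0 (Dg N (K N) (H N) (g N) (\<theta>s N))) / xi (K N) (H N) (\<theta>s N) \<epsilon>)
          \<ge> 1 - 3 / EY1 N (K N) (H N) (g N) (\<theta>s N)))
  \<and>
   ((eventually (\<lambda>N. xitil (K N) (H N) (\<theta>s N) \<epsilon> > 0) sequentially \<and>
      (\<lambda>N. sqrt (3 * real (pdim (K N) (H N)) * (real (K N))\<^sup>2 * ln (real N) / EY1 N (K N) (H N) (g N) (\<theta>s N))
           * sqrt (1 + max 0 (Dg N (K N) (H N) (g N) (\<theta>s N))) / xitil (K N) (H N) (\<theta>s N) \<epsilon>)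
        \<longlonglongrightarrow> 0)
    \<longrightarrow> (\<exists>N0\<ge>3. \<forall>N\<ge>N0.
          prob_ev N (K N) (H N) (g N) (\<theta>s N)
            (\<lambda>x y. argmax_Theta (K N) (H N) (\<lambda>\<theta>. pseudolik N (K N) (H N) (g N) \<theta> x y) \<noteq> {} \<and>
                 (\<forall>\<theta>t\<in>argmax_Theta (K N) (H N) (\<lambda>\<theta>. pseudolik N (K N) (H N) (g N) \<theta> x y).
                   norm2 (K N) (H N) (\<lambda>L. \<theta>t L - \<theta>s N L) \<le>
                   sqrt (3 * real (pdim (K N) (H N)) * (real (K N))\<^sup>2 * ln (real N) / EY1 N (K N) (H N) (g N) (\<theta>s N))
                   * sqrt (1 + max 0 (Dg N (K N) (H N) (g N) (\<theta>s N))) / xitil (K N) (H N) (\<theta>s N) \<epsilon>))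
          \<ge> 1 - 3 / EY1 N (K N) (H N) (g N) (\<theta>s N)))"
proof -
  have model: "network_model (K N) (H N) N (g N)" if "3 \<le> N" for N
    using K[OF that] H[OF that] g_pos[OF that] g_sum[OF that] by unfold_locales auto
  show ?thesis
    by (intro conjI impI; erule eventually_regime[OF _ eps])
      (rule network_model.mle_probability[OF model theta EY _ p_le]
        network_model.mple_probability[OF model theta EY _ p_le]; assumption)+
qed

end
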